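(* Consider a quiver representation over a field $\mathbb{F}$ whose underlying graph is a line with vertices carrying finite-dimensional vector spaces $V_0,\dots,V_n$ and $n$ edges (each of arbitrary direction), and let $d=\max\{\dim V_0,\dots,\dim V_n\}$. The rightward-initial algorithm described in the context computes the barcode form of the representation in $O(nd^3)$ time.
   Context: Setting. Edge $i$ ($0\le i\le n-1$) joins $V_i$ and $V_{i+1}$; it has direction $\leftarrow$ if it carries a matrix $V_{i+1}\to V_i$ and $\rightarrow$ if it carries a matrix $V_i\to V_{i+1}$. Two representations of the same directed graph are isomorphic if they differ by invertible changes of basis at the vertices. The companion matrix of the representation is the block matrix acting on $\bigoplus_i V_i$ whose non-zero blocks are the edge matrices, placed in the non-zero entries of the adjacency matrix of the directed graph. A pivot matrix is a matrix with at most one non-zero entry in each row and each column, the non-zero entries being $1$. Computing the barcode form means finding an isomorphic representation whose companion matrix is in barcode form, i.e. equals $PTP^T$, with $T$ a direct sum of companion matrices of interval representations $I[b,d]$ (copies of $\mathbb F$ at vertices $b,\dots,d$, identity maps between them, zero elsewhere) and $P$ a permutation matrix compatible with the vertex block structure; equivalently, every edge matrix is a pivot matrix. Shapes. $E_L$ shape: $E=\sum_{(i,j)\in S}e_ie_j^T$ is a pivot matrix such that, writing $(i(j),j)$ for the elements of $S$, $j_1<j_2$ implies $i(j_1)<i(j_2)$, and every column to the right of a zero column is zero. $J$ is the anti-diagonal permutation matrix. $E_U$ shape: transpose of an $E_L$ shape. $\hat E_L$ shape: $J\hat E_LJ$ has $E_U$ shape (with $J$'s of the appropriate sizes). $L$,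 $U$, $P$ denote (invertible) lower triangular, (invertible) upper triangular, and permutation matrices. "Passing" a factor from an edge to the adjacent edge means performing the change of basis at the common vertex that removes this factor from the first edge's matrix; the adjacent edge's matrix is multiplied by the factor or its inverse accordingly. Rightward-initial algorithm. First pass, for $i=0,\dots,n-1$: if edge $i$ is $\leftarrow$, factor its matrix as $LE_LUP$ and pass $UP$ to edge $i+1$; if it is $\rightarrow$, factor its matrix as $PU\hat E_LL$ and pass $PU$ to edge $i+1$ (past the last edge, this is just a change of basis on $V_n$). Second pass, for $i=n-1,\dots,0$: if edge $i$ is $\leftarrow$, rewrite its current matrix $L_1E_LL_2=\tilde L_1E_L$ and pass $\tilde L_1$ to edge $i-1$; if it is $\rightarrow$, rewrite $L_1\hat E_LL_2=\hat E_L\tilde L_2$ and pass $\tilde L_2$ to edge $i-1$ (for $i=0$, this is a change of basis on $V_0$). Time is counted with unit cost for operations in $\mathbb F$ and for moving a matrix entry. *)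

theory Defs
  imports
    "Jordan_Normal_Form.Matrix"
    "HOL-Combinatorics.Permutations"
    "HOL-Library.Monad_Syntax"
begin

section \<open>Representations of a quiver whose underlying graph is a line\<close>

datatype direction = Leftward | Rightward

text \<open>
  The vector space at vertex \<open>i \<in> {0..nedges}\<close> is \<open>'a\<close>-coordinate space of dimension \<open>vdim i\<close>;
  edge \<open>i < nedges\<close> joins the vertices \<open>i\<close> and \<open>i + 1\<close>.  Values of the three functions
  outside these ranges are irrelevant.
\<close>

record 'a zigzag =
  nedges :: nat
  vdim :: "nat \<Rightarrow> nat"
  dir :: "nat \<Rightarrow> direction"
  edge_mat :: "nat \<Rightarrow> 'a mat"

definition src :: "'a zigzag \<Rightarrow> nat \<Rightarrow> nat" where
  "src R i = (case dir R i of Leftward \<Rightarrow> Suc i | Rightward \<Rightarrow> i)"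

definition tgt :: "'a zigzag \<Rightarrow> nat \<Rightarrow> nat" where
  "tgt R i = (case dir R i of Leftward \<Rightarrow> i | Rightward \<Rightarrow> Suc i)"

definition zigzag_rep :: "'a zigzag \<Rightarrow> bool" where
  "zigzag_rep R \<longleftrightarrow>
     (\<forall>i < nedges R. edge_mat R i \<in> carrier_mat (vdim R (tgt R i)) (vdim R (src R i)))"

definition max_dim :: "'a zigzag \<Rightarrow> nat" where
  "max_dim R = Max (vdim R ` {..nedges R})"

definition isomorphic :: "'a::field zigzag \<Rightarrow> 'a zigzag \<Rightarrow> bool" where
  "isomorphic R S \<longleftrightarrow>
     zigzag_rep R \<and> zigzag_rep S \<and> nedges S = nedges R \<and>
     (\<forall>i \<le> nedges R. vdim S i = vdim R i) \<and>
     (\<forall>i < nedges R. dir S i = dir R i) \<and>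
     (\<exists>g. (\<forall>i \<le> nedges R. g i \<in> carrier_mat (vdim R i) (vdim R i) \<and> invertible_mat (g i)) \<and>
          (\<forall>i < nedges R. edge_mat S i * g (src R i) = g (tgt R i) * edge_mat R i))"


section \<open>Companion matrix and barcode form\<close>

definition offset :: "'a zigzag \<Rightarrow> nat \<Rightarrow> nat" where
  "offset R i = (\<Sum>k<i. vdim R k)"

definition total_dim :: "'a zigzag \<Rightarrow> nat" where
  "total_dim R = offset R (Suc (nedges R))"

text \<open>The vertex to which the coordinate \<open>a < total_dim R\<close> of the direct sum belongs.\<close>

definition vertex_of :: "'a zigzag \<Rightarrow> nat \<Rightarrow> nat" where
  "vertex_of R a = (LEAST i. a < offset R (Suc i))"

text \<open>At most one summand below is non-zero: the block at row \<open>p\<close> and column \<open>q\<close> is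
  the matrix of the edge from \<open>q\<close> to \<open>p\<close>, if there is one.\<close>

definition companion :: "'a::comm_monoid_add zigzag \<Rightarrow> 'a mat" where
  "companion R = mat (total_dim R) (total_dim R) (\<lambda>(a, b).
     \<Sum>i<nedges R. if vertex_of R a = tgt R i \<and> vertex_of R b = src R i
       then edge_mat R i $$ (a - offset R (tgt R i), b - offset R (src R i)) else 0)"

definition interval_rep :: "nat \<Rightarrow> (nat \<Rightarrow> direction) \<Rightarrow> nat \<times> nat \<Rightarrow> 'a::{zero,one} zigzag" where
  "interval_rep n dr = (\<lambda>(b, d).
     let dm = (\<lambda>i. if b \<le> i \<and> i \<le> d then 1 else 0) in
     \<lparr> nedges = n, vdim = dm, dir = dr,
       edge_mat = (\<lambda>i. if b \<le> i \<and> Suc i \<le> d then 1\<^sub>m 1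
         else (case dr i of Leftward \<Rightarrow> 0\<^sub>m (dm i) (dm (Suc i))
                          | Rightward \<Rightarrow> 0\<^sub>m (dm (Suc i)) (dm i))) \<rparr>)"

definition perm_matrix :: "nat \<Rightarrow> (nat \<Rightarrow> nat) \<Rightarrow> 'a::{zero,one} mat" where
  "perm_matrix n \<pi> = mat n n (\<lambda>(i, j). if i = \<pi> j then 1 else 0)"

definition permutation_mat :: "'a::{zero,one} mat \<Rightarrow> bool" where
  "permutation_mat P \<longleftrightarrow> (\<exists>\<pi>. \<pi> permutes {..<dim_row P} \<and> P = perm_matrix (dim_row P) \<pi>)"

text \<open>
  The coordinates of the direct sum of the interval representations \<open>bars\<close> are ordered interval
  by interval; the list \<open>labels\<close> records the vertex to which each of them belongs.  Compatibility of
  the permutation with the vertex block structure means that each coordinate is sent into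
  the block of its vertex.
\<close>

definition barcode_form :: "'a::field zigzag \<Rightarrow> bool" where
  "barcode_form R \<longleftrightarrow>
     (\<exists>bars \<pi>.
        let N = total_dim R;
            labels = concat (map (\<lambda>(b, d). [b..<Suc d]) bars);
            T = diag_block_mat (map (\<lambda>I. companion (interval_rep (nedges R) (dir R) I)) bars);
            P = perm_matrix N \<pi>
        in (\<forall>(b, d) \<in> set bars. b \<le> d \<and> d \<le> nedges R) \<and>
           \<pi> permutes {..<N} \<and>
           length labels = N \<and>
           (\<forall>x < N. vertex_of R (\<pi> x) = labels ! x) \<and>
           companion R = P * T * P\<^sup>T)"


section \<open>Shapes and factorizations\<close>

definition pivot_mat :: "'a::{zero,one} mat \<Rightarrow> bool" where
  "pivot_mat E \<longleftrightarrow>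
     (\<forall>i < dim_row E. \<forall>j < dim_col E. E $$ (i, j) \<noteq> 0 \<longrightarrow> E $$ (i, j) = 1) \<and>
     (\<forall>i < dim_row E. \<forall>j < dim_col E. \<forall>j' < dim_col E.
        E $$ (i, j) \<noteq> 0 \<and> E $$ (i, j') \<noteq> 0 \<longrightarrow> j = j') \<and>
     (\<forall>i < dim_row E. \<forall>i' < dim_row E. \<forall>j < dim_col E.
        E $$ (i, j) \<noteq> 0 \<and> E $$ (i', j) \<noteq> 0 \<longrightarrow> i = i')"

definition EL_shape :: "'a::{zero,one} mat \<Rightarrow> bool" where
  "EL_shape E \<longleftrightarrow> pivot_mat E \<and>
     (\<forall>i1 < dim_row E. \<forall>i2 < dim_row E. \<forall>j1 < dim_col E. \<forall>j2 < dim_col E.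
        E $$ (i1, j1) \<noteq> 0 \<and> E $$ (i2, j2) \<noteq> 0 \<and> j1 < j2 \<longrightarrow> i1 < i2) \<and>
     (\<forall>j < dim_col E. \<forall>k < dim_col E.
        j < k \<and> (\<forall>i < dim_row E. E $$ (i, j) = 0) \<longrightarrow> (\<forall>i < dim_row E. E $$ (i, k) = 0))"

definition EU_shape :: "'a::{zero,one} mat \<Rightarrow> bool" where
  "EU_shape E \<longleftrightarrow> EL_shape (E\<^sup>T)"

definition antidiag :: "nat \<Rightarrow> 'a::{zero,one} mat" where
  "antidiag m = mat m m (\<lambda>(i, j). if i + j + 1 = m then 1 else 0)"

definition EL_hat_shape :: "'a::semiring_1 mat \<Rightarrow> bool" where
  "EL_hat_shape E \<longleftrightarrow> EU_shape (antidiag (dim_row E) * E * antidiag (dim_col E))"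

definition lower_triangular :: "'a::zero mat \<Rightarrow> bool" where
  "lower_triangular A \<longleftrightarrow> (\<forall>i < dim_row A. \<forall>j < dim_col A. i < j \<longrightarrow> A $$ (i, j) = 0)"

definition is_L :: "nat \<Rightarrow> 'a::field mat \<Rightarrow> bool" where
  "is_L m L \<longleftrightarrow> L \<in> carrier_mat m m \<and> lower_triangular L \<and> invertible_mat L"

definition is_U :: "nat \<Rightarrow> 'a::field mat \<Rightarrow> bool" where
  "is_U m U \<longleftrightarrow> U \<in> carrier_mat m m \<and> upper_triangular U \<and> invertible_mat U"

definition is_P :: "nat \<Rightarrow> 'a::field mat \<Rightarrow> bool" where
  "is_P m P \<longleftrightarrow> P \<in> carrier_mat m m \<and> permutation_mat P"

definition is_LEUP :: "'a::field mat \<Rightarrow> 'a mat \<Rightarrow> 'a mat \<Rightarrow> 'a mat \<Rightarrow> 'a mat \<Rightarrow> bool" where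
  "is_LEUP A L E U P \<longleftrightarrow>
     is_L (dim_row A) L \<and> E \<in> carrier_mat (dim_row A) (dim_col A) \<and> EL_shape E \<and>
     is_U (dim_col A) U \<and> is_P (dim_col A) P \<and> A = L * E * U * P"

definition is_PUEL :: "'a::field mat \<Rightarrow> 'a mat \<Rightarrow> 'a mat \<Rightarrow> 'a mat \<Rightarrow> 'a mat \<Rightarrow> bool" where
  "is_PUEL A P U E L \<longleftrightarrow>
     is_P (dim_row A) P \<and> is_U (dim_row A) U \<and>
     E \<in> carrier_mat (dim_row A) (dim_col A) \<and> EL_hat_shape E \<and>
     is_L (dim_col A) L \<and> A = P * U * E * L"


section \<open>The rightward-initial algorithm, for arbitrary choices of the factors\<close>

text \<open>
  New coordinates \<open>g x\<close> at vertex \<open>v\<close>, where \<open>h\<close> is the inverse of \<open>g\<close>.  A right factor \<open>g\<close> is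
  thus removed from the matrix of an edge leaving \<open>v\<close>, and a left factor \<open>h\<close> from the matrix of an
  edge entering \<open>v\<close>; the other edge at \<open>v\<close>, if there is one, absorbs it.
\<close>

definition change_basis :: "nat \<Rightarrow> 'a::semiring_0 mat \<Rightarrow> 'a mat \<Rightarrow> 'a zigzag \<Rightarrow> 'a zigzag" where
  "change_basis v g h R = R\<lparr>edge_mat := (\<lambda>i.
     if i < nedges R \<and> tgt R i = v then g * edge_mat R i
     else if i < nedges R \<and> src R i = v then edge_mat R i * h
     else edge_mat R i)\<rparr>"

definition inverse_mats :: "'a::field mat \<Rightarrow> 'a mat \<Rightarrow> bool" where
  "inverse_mats g h \<longleftrightarrow> square_mat g \<and> dim_row h = dim_row g \<and> square_mat h \<and>
     inverts_mat g h \<and> inverts_mat h g"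

definition first_pass_rel :: "nat \<Rightarrow> 'a::field mat \<Rightarrow> 'a zigzag \<Rightarrow> 'a zigzag \<Rightarrow> bool" where
  "first_pass_rel i E R R' \<longleftrightarrow>
     (case dir R i of
        Leftward \<Rightarrow> \<exists>L U P h. is_LEUP (edge_mat R i) L E U P \<and> inverse_mats (U * P) h \<and>
          R' = change_basis (Suc i) (U * P) h R
      | Rightward \<Rightarrow> \<exists>P U L g. is_PUEL (edge_mat R i) P U E L \<and> inverse_mats g (P * U) \<and>
          R' = change_basis (Suc i) g (P * U) R)"

text \<open>Here \<open>E\<close> is the shape matrix produced for edge \<open>i\<close> in the first pass.\<close>

definition second_pass_rel :: "nat \<Rightarrow> 'a::field mat \<Rightarrow> 'a zigzag \<Rightarrow> 'a zigzag \<Rightarrow> bool" where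
  "second_pass_rel i E R R' \<longleftrightarrow>
     (\<exists>L1 L2. is_L (dim_row E) L1 \<and> is_L (dim_col E) L2 \<and> edge_mat R i = L1 * E * L2 \<and>
       (case dir R i of
          Leftward \<Rightarrow> \<exists>K g. is_L (dim_row E) K \<and> L1 * E * L2 = K * E \<and> inverse_mats g K \<and>
            R' = change_basis i g K R
        | Rightward \<Rightarrow> \<exists>K h. is_L (dim_col E) K \<and> L1 * E * L2 = E * K \<and> inverse_mats K h \<and>
            R' = change_basis i K h R))"

definition rightward_initial_run :: "'a::field zigzag \<Rightarrow> 'a zigzag \<Rightarrow> bool" where
  "rightward_initial_run R B \<longleftrightarrow>
     (\<exists>E X Y.
        X 0 = R \<and> (\<forall>i < nedges R. first_pass_rel i (E i) (X i) (X (Suc i))) \<and>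
        Y (nedges R) = X (nedges R) \<and>
        (\<forall>i < nedges R. second_pass_rel i (E i) (Y (Suc i)) (Y i)) \<and> Y 0 = B)"


section \<open>Computations with counted cost\<close>

text \<open>
  Cost one is charged for each arithmetic operation and each zero test in the field, and for
  each entry stored into a matrix (whether moved from another matrix, freshly computed, or constant).
  Arithmetic on indices and the control flow are free.  In the procedures below, field
  elements are combined only by the operations of this section.
\<close>

datatype 'r timed = Timed (result: 'r) (cost: nat)

definition ret :: "'r \<Rightarrow> 'r timed" where
  "ret x = Timed x 0"

definition bind_timed :: "'r timed \<Rightarrow> ('r \<Rightarrow> 's timed) \<Rightarrow> 's timed" where
  "bind_timed m f = Timed (result (f (result m))) (cost m + cost (f (result m)))"

adhoc_overloading Monad_Syntax.bind \<rightleftharpoons> bind_timed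

definition fadd :: "'a::field \<Rightarrow> 'a \<Rightarrow> 'a timed" where "fadd x y = Timed (x + y) 1"
definition fsub :: "'a::field \<Rightarrow> 'a \<Rightarrow> 'a timed" where "fsub x y = Timed (x - y) 1"
definition fmul :: "'a::field \<Rightarrow> 'a \<Rightarrow> 'a timed" where "fmul x y = Timed (x * y) 1"
definition fdiv :: "'a::field \<Rightarrow> 'a \<Rightarrow> 'a timed" where "fdiv x y = Timed (x / y) 1"
definition fzero :: "'a::field \<Rightarrow> bool timed" where "fzero x = Timed (x = 0) 1"

definition make_mat :: "nat \<Rightarrow> nat \<Rightarrow> (nat \<Rightarrow> nat \<Rightarrow> 'a timed) \<Rightarrow> 'a mat timed" where
  "make_mat m n f = Timed (mat m n (\<lambda>(i, j). result (f i j)))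
     (\<Sum>i<m. \<Sum>j<n. (cost (f i j) + 1))"

fun fold_timed :: "('i \<Rightarrow> 's \<Rightarrow> 's timed) \<Rightarrow> 'i list \<Rightarrow> 's \<Rightarrow> 's timed" where
  "fold_timed f [] s = ret s"
| "fold_timed f (i # is) s = do { s' \<leftarrow> f i s; fold_timed f is s' }"

fun sum_timed :: "(nat \<Rightarrow> 'a::field timed) \<Rightarrow> nat \<Rightarrow> 'a timed" where
  "sum_timed f 0 = ret 0"
| "sum_timed f (Suc n) = do { s \<leftarrow> sum_timed f n; x \<leftarrow> f n; fadd s x }"

fun find_nonzero :: "(nat \<Rightarrow> 'a::field) \<Rightarrow> nat list \<Rightarrow> nat option timed" where
  "find_nonzero f [] = ret None"
| "find_nonzero f (i # is) = do {
     z \<leftarrow> fzero (f i);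
     if z then find_nonzero f is else ret (Some i)
   }"


section \<open>Matrix procedures\<close>

abbreviation delta :: "nat \<Rightarrow> nat \<Rightarrow> 'a::{zero,one}" where
  "delta i j \<equiv> (if i = j then 1 else 0)"

definition copy_timed :: "'a mat \<Rightarrow> 'a mat timed" where
  "copy_timed A = make_mat (dim_row A) (dim_col A) (\<lambda>i j. ret (A $$ (i, j)))"

definition one_timed :: "nat \<Rightarrow> 'a::field mat timed" where
  "one_timed n = make_mat n n (\<lambda>i j. ret (delta i j))"

definition transpose_timed :: "'a mat \<Rightarrow> 'a mat timed" where
  "transpose_timed A = make_mat (dim_col A) (dim_row A) (\<lambda>i j. ret (A $$ (j, i)))"

text \<open>\<open>J A\<^sup>T J\<close>, reflection in the anti-diagonal.\<close>

definition antitranspose_timed :: "'a mat \<Rightarrow> 'a mat timed" where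
  "antitranspose_timed A = make_mat (dim_col A) (dim_row A)
     (\<lambda>i j. ret (A $$ (dim_row A - 1 - j, dim_col A - 1 - i)))"

definition mult_timed :: "'a::field mat \<Rightarrow> 'a mat \<Rightarrow> 'a mat timed" where
  "mult_timed A B = make_mat (dim_row A) (dim_col B)
     (\<lambda>i j. sum_timed (\<lambda>k. fmul (A $$ (i, k)) (B $$ (k, j))) (dim_col A))"

text \<open>Forward substitution; row \<open>k\<close> of the inverse is computed from the rows above it.\<close>

definition lower_inverse_timed :: "'a::field mat \<Rightarrow> 'a mat timed" where
  "lower_inverse_timed L = (let n = dim_row L in do {
     X0 \<leftarrow> one_timed n;
     fold_timed (\<lambda>k X. make_mat n n (\<lambda>i j.
         if i = k then do {
           s \<leftarrow> sum_timed (\<lambda>l. fmul (L $$ (k, l)) (X $$ (l, j))) k;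
           t \<leftarrow> fsub (delta k j) s;
           fdiv t (L $$ (k, k))
         } else ret (X $$ (i, j)))) [0..<n] X0
   })"

definition upper_inverse_timed :: "'a::field mat \<Rightarrow> 'a mat timed" where
  "upper_inverse_timed U = do {
     L \<leftarrow> transpose_timed U;
     X \<leftarrow> lower_inverse_timed L;
     transpose_timed X
   }"

text \<open>
  Gaussian elimination with column pivoting.  Throughout, the product \<open>L W U P\<close> is the
  matrix to be factored; after step \<open>i\<close>, the rows \<open>0..i\<close> of \<open>W\<close> have their final form, and \<open>r\<close> pivots
  have been found, in the columns \<open>0..<r\<close>.  Rows \<open>r\<close> and below of \<open>U\<close>, and columns \<open>i + 1\<close> and
  beyond of \<open>L\<close>, are those of the identity matrix.
\<close>

type_synonym 'a leup_state = "'a mat \<times> 'a mat \<times> 'a mat \<times> 'a mat \<times> nat"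

definition leup_step :: "nat \<Rightarrow> 'a::field leup_state \<Rightarrow> 'a leup_state timed" where
  "leup_step i = (\<lambda>(L, W, U, P, r).
     let m = dim_row W; n = dim_col W in do {
       piv \<leftarrow> find_nonzero (\<lambda>j. W $$ (i, j)) [r..<n];
       case piv of
         None \<Rightarrow> ret (L, W, U, P, r)
       | Some c \<Rightarrow> (let s = Transposition.transpose r c in do {
           W1 \<leftarrow> make_mat m n (\<lambda>a b. ret (W $$ (a, s b)));
           U1 \<leftarrow> make_mat n n (\<lambda>a b. ret (U $$ (s a, s b)));
           P1 \<leftarrow> make_mat n n (\<lambda>a b. ret (P $$ (s a, b)));
           L2 \<leftarrow> make_mat m m (\<lambda>a b.
             if b = i \<and> i < a then fdiv (W1 $$ (a, r)) (W1 $$ (i, r)) else ret (L $$ (a, b)));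
           U2 \<leftarrow> make_mat n n (\<lambda>a b.
             if a = r \<and> r \<le> b then ret (W1 $$ (i, b)) else ret (U1 $$ (a, b)));
           W2 \<leftarrow> make_mat m n (\<lambda>a b.
             if a < i then ret (W1 $$ (a, b))
             else if a = i then ret (delta r b)
             else do { t \<leftarrow> fmul (L2 $$ (a, i)) (W1 $$ (i, b)); fsub (W1 $$ (a, b)) t });
           ret (L2, W2, U2, P1, Suc r)
         })
     })"

definition leup_timed :: "'a::field mat \<Rightarrow> ('a mat \<times> 'a mat \<times> 'a mat \<times> 'a mat) timed" where
  "leup_timed A = do {
     L0 \<leftarrow> one_timed (dim_row A);
     W0 \<leftarrow> copy_timed A;
     U0 \<leftarrow> one_timed (dim_col A);
     P0 \<leftarrow> one_timed (dim_col A);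
     (L, E, U, P, r) \<leftarrow> fold_timed leup_step [0..<dim_row A] (L0, W0, U0, P0, 0);
     ret (L, E, U, P)
   }"

text \<open>Reflection in the anti-diagonal reverses products, preserves the types \<open>L\<close>, \<open>U\<close> and \<open>P\<close>, and
  turns the shape \<open>E_L\<close> into the shape \<open>E_L\<close>-hat.\<close>

definition puel_timed :: "'a::field mat \<Rightarrow> ('a mat \<times> 'a mat \<times> 'a mat \<times> 'a mat) timed" where
  "puel_timed A = do {
     B \<leftarrow> antitranspose_timed A;
     (L0, E0, U0, P0) \<leftarrow> leup_timed B;
     P \<leftarrow> antitranspose_timed P0;
     U \<leftarrow> antitranspose_timed U0;
     E \<leftarrow> antitranspose_timed E0;
     L \<leftarrow> antitranspose_timed L0;
     ret (P, U, E, L)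
   }"

text \<open>
  Given \<open>M = K E\<close> with \<open>E\<close> of shape \<open>E_L\<close>, column \<open>j\<close> of \<open>M\<close> is column \<open>b\<close> of \<open>K\<close> when the pivot of
  row \<open>b\<close> of \<open>E\<close> lies in column \<open>j\<close>; the other columns of \<open>K\<close> can be chosen as unit vectors.
  The second procedure does the same with rows, for \<open>M = E K\<close>.
\<close>

definition left_factor_timed :: "'a::field mat \<Rightarrow> 'a mat \<Rightarrow> 'a mat timed" where
  "left_factor_timed E M = make_mat (dim_row E) (dim_row E) (\<lambda>a b. do {
     piv \<leftarrow> find_nonzero (\<lambda>j. E $$ (b, j)) [0..<dim_col E];
     case piv of None \<Rightarrow> ret (delta a b) | Some j \<Rightarrow> ret (M $$ (a, j))
   })"

definition right_factor_timed :: "'a::field mat \<Rightarrow> 'a mat \<Rightarrow> 'a mat timed" where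
  "right_factor_timed E M = make_mat (dim_col E) (dim_col E) (\<lambda>a b. do {
     piv \<leftarrow> find_nonzero (\<lambda>i. E $$ (i, a)) [0..<dim_row E];
     case piv of None \<Rightarrow> ret (delta a b) | Some i \<Rightarrow> ret (M $$ (i, b))
   })"


section \<open>The rightward-initial algorithm with counted cost\<close>

definition set_edge :: "nat \<Rightarrow> 'a mat \<Rightarrow> 'a zigzag \<Rightarrow> 'a zigzag" where
  "set_edge i M R = R\<lparr>edge_mat := (edge_mat R)(i := M)\<rparr>"

text \<open>The effect on edge \<open>e\<close> of the change of basis \<open>(g, h)\<close> at its end point \<open>v\<close>.\<close>

definition pass_to_edge :: "nat \<Rightarrow> nat \<Rightarrow> 'a::field mat \<Rightarrow> 'a mat \<Rightarrow> 'a zigzag \<Rightarrow> 'a zigzag timed" where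
  "pass_to_edge e v g h R = do {
     M \<leftarrow> (if tgt R e = v then mult_timed g (edge_mat R e) else mult_timed (edge_mat R e) h);
     ret (set_edge e M R)
   }"

definition first_pass_step ::
    "nat \<Rightarrow> 'a::field zigzag \<times> (nat \<Rightarrow> 'a mat) \<Rightarrow> ('a zigzag \<times> (nat \<Rightarrow> 'a mat)) timed" where
  "first_pass_step i = (\<lambda>(R, Es). do {
     (A, E, g, h) \<leftarrow> (case dir R i of
        Leftward \<Rightarrow> do {
          (L, E, U, P) \<leftarrow> leup_timed (edge_mat R i);
          A \<leftarrow> mult_timed L E;
          g \<leftarrow> mult_timed U P;
          U' \<leftarrow> upper_inverse_timed U;
          P' \<leftarrow> transpose_timed P;
          h \<leftarrow> mult_timed P' U';
          ret (A, E, g, h)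
        }
      | Rightward \<Rightarrow> do {
          (P, U, E, L) \<leftarrow> puel_timed (edge_mat R i);
          A \<leftarrow> mult_timed E L;
          h \<leftarrow> mult_timed P U;
          U' \<leftarrow> upper_inverse_timed U;
          P' \<leftarrow> transpose_timed P;
          g \<leftarrow> mult_timed U' P';
          ret (A, E, g, h)
        });
     let R1 = set_edge i A R;
     R2 \<leftarrow> (if Suc i < nedges R then pass_to_edge (Suc i) (Suc i) g h R1 else ret R1);
     ret (R2, Es(i := E))
   })"

definition second_pass_step ::
    "(nat \<Rightarrow> 'a mat) \<Rightarrow> nat \<Rightarrow> 'a::field zigzag \<Rightarrow> 'a zigzag timed" where
  "second_pass_step Es i R = do {
     (g, h) \<leftarrow> (case dir R i of
        Leftward \<Rightarrow> do {
          K \<leftarrow> left_factor_timed (Es i) (edge_mat R i);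
          K' \<leftarrow> lower_inverse_timed K;
          ret (K', K)
        }
      | Rightward \<Rightarrow> do {
          K \<leftarrow> right_factor_timed (Es i) (edge_mat R i);
          K' \<leftarrow> lower_inverse_timed K;
          ret (K, K')
        });
     A \<leftarrow> copy_timed (Es i);
     let R1 = set_edge i A R;
     if 0 < i then pass_to_edge (i - 1) i g h R1 else ret R1
   }"

definition rightward_initial :: "'a::field zigzag \<Rightarrow> 'a zigzag timed" where
  "rightward_initial R = do {
     (R1, Es) \<leftarrow> fold_timed first_pass_step [0..<nedges R] (R, \<lambda>_. 0\<^sub>m 0 0);
     fold_timed (second_pass_step Es) (rev [0..<nedges R]) R1
   }"

definition computes_barcode_form :: "'a::field zigzag \<Rightarrow> 'a zigzag \<Rightarrow> bool" where
  "computes_barcode_form R B \<longleftrightarrow> isomorphic R B \<and> barcode_form B"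

end

theory Submission
  imports Defs "Jordan_Normal_Form.Determinant"
begin

text \<open>
The algorithm only changes bases, so its output is isomorphic to its input; the point is that every
edge ends up as a pivot matrix, although the second pass disturbs edges that are still to be treated.
After the first pass a leftward edge carries \<open>L E\<close> and a rightward edge \<open>E L\<close> with \<open>E\<close> of
shape \<open>E_L\<close> or \<open>E_L\<close>-hat and \<open>L\<close> lower triangular.  The second pass multiplies the next edge to
the left by a lower triangular matrix, so it meets matrices \<open>L1 E L2\<close>.  The shapes are
made for this situation.  In a matrix of shape \<open>E_L\<close>, a column operation that adds later columns to
earlier ones acts on pivots that lie lower and lower, so it can be replaced by a row operation of
lower triangular type: \<open>L1 E L2 = K E\<close> (lemma \<open>left_factor_timed_correct\<close>).  The reflection
\<open>A \<mapsto> J A\<^sup>T J\<close> reverses products, preserves lower and upper triangularity, and exchanges the two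
shapes; it gives \<open>L1 E L2 = E K\<close> for the shape \<open>E_L\<close>-hat, and also reduces the factorization
\<open>P U E L\<close> to \<open>L E U P\<close>.  Passing \<open>K\<close> on leaves \<open>E\<close> behind, and the factor that the next edge
absorbs is \<open>K\<close> or its inverse, hence again lower triangular.  The factorization \<open>L E U P\<close> itself is
Gaussian elimination with exchange of columns (lemma \<open>leup_timed_correct\<close>).

Pivot matrices on all edges amount to a barcode form.  A non-zero entry links a basis vector at a vertex
with a basis vector at the next vertex, and each basis vector has at most one link on either side.  The
basis therefore splits into chains over consecutive vertices; listing it chain by chain turns the
companion matrix into a direct sum of companion matrices of interval representations (lemma
\<open>pivot_barcode_form\<close>).

For each edge, each pass performs a bounded number of factorizations, triangular inversions and products of
matrices of size at most \<open>d\<close>, and each of these costs \<open>O(d\<^sup>3)\<close>.  Whenever the claimed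
bound is zero there is nothing to do: every procedure on matrices without entries is free.
\<close>

section \<open>Results of counted computations\<close>

lemma result_bind [simp]: "result (bind_timed m f) = result (f (result m))"
  and cost_bind [simp]: "cost (bind_timed m f) = cost m + cost (f (result m))"
  by (simp_all add: bind_timed_def)

lemma result_ret [simp]: "result (ret x) = x" and cost_ret [simp]: "cost (ret x) = 0"
  by (simp_all add: ret_def)

lemma result_field_ops [simp]:
  "result (fadd x y) = x + y" "result (fsub x y) = x - y" "result (fmul x y) = x * y"
  "result (fdiv x y) = x / y" "result (fzero x) \<longleftrightarrow> x = 0"
  by (simp_all add: fadd_def fsub_def fmul_def fdiv_def fzero_def)

lemma cost_field_ops [simp]:
  "cost (fadd x y) = 1" "cost (fsub x y) = 1" "cost (fmul x y) = 1"
  "cost (fdiv x y) = 1" "cost (fzero x) = 1"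
  by (simp_all add: fadd_def fsub_def fmul_def fdiv_def fzero_def)

lemma result_make_mat [simp]:
  "result (make_mat m n f) = mat m n (\<lambda>(i, j). result (f i j))"
  by (simp add: make_mat_def)

lemma result_sum_timed [simp]: "result (sum_timed f n) = (\<Sum>k<n. result (f k))"
  by (induction n) auto

lemma result_mult_timed [simp]:
  assumes "dim_col A = dim_row B"
  shows "result (mult_timed A B) = A * B"
  using assms
  by (intro eq_matI) (auto simp: mult_timed_def scalar_prod_def atLeast0LessThan)

lemma result_transpose_timed [simp]: "result (transpose_timed A) = A\<^sup>T"
  by (intro eq_matI) (auto simp: transpose_timed_def)

lemma result_one_timed [simp]: "result (one_timed n) = 1\<^sub>m n"
  by (intro eq_matI) (auto simp: one_timed_def)

lemma result_copy_timed [simp]: "result (copy_timed A) = A"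
  by (intro eq_matI) (auto simp: copy_timed_def)

lemma fold_timed_append [simp]:
  "result (fold_timed f (xs @ ys) s) = result (fold_timed f ys (result (fold_timed f xs s)))"
  "cost (fold_timed f (xs @ ys) s) =
     cost (fold_timed f xs s) + cost (fold_timed f ys (result (fold_timed f xs s)))"
  by (induction xs arbitrary: s) auto

lemma fold_timed_upt_invariant:
  assumes "P 0 s" and "\<And>k s. k < n \<Longrightarrow> P k s \<Longrightarrow> P (Suc k) (result (f k s))"
  shows "P n (result (fold_timed f [0..<n] s))"
  using assms
proof (induction n)
  case (Suc n)
  then show ?case by simp
qed simp

section \<open>Triangular matrices and their inverses\<close>

lemma inverse_matsI:
  fixes g :: "'a::field mat"
  assumes "g \<in> carrier_mat n n" "h \<in> carrier_mat n n" "g * h = 1\<^sub>m n"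
  shows "inverse_mats g h"
  using assms mat_mult_left_right_inverse[OF assms]
  by (auto simp: inverse_mats_def inverts_mat_def)

lemma inverse_matsD:
  assumes "inverse_mats g h" "g \<in> carrier_mat n n \<or> h \<in> carrier_mat n n"
  shows "g \<in> carrier_mat n n" "h \<in> carrier_mat n n" "g * h = 1\<^sub>m n" "h * g = 1\<^sub>m n"
  using assms by (auto simp: inverse_mats_def inverts_mat_def)

lemma inverse_mats_sym: "inverse_mats g h \<Longrightarrow> inverse_mats h g"
  by (auto simp: inverse_mats_def)

lemma inverse_mats_invertible: "inverse_mats g h \<Longrightarrow> invertible_mat g"
  by (auto simp: inverse_mats_def invertible_mat_def)

text \<open>
Invertibility of triangular matrices is decided on the diagonal, by way of the determinant; this gives the
entrywise descriptions \<open>is_L_iff\<close> and \<open>is_U_iff\<close>, in which triangular matrices are recognized below.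
\<close>

lemma invertible_mat_iff_det:
  fixes A :: "'a::field mat"
  assumes A: "A \<in> carrier_mat n n"
  shows "invertible_mat A \<longleftrightarrow> det A \<noteq> 0"
proof
  assume "invertible_mat A"
  then obtain B where AB: "A * B = 1\<^sub>m n" and BA: "B * A = 1\<^sub>m (dim_row B)"
    using A by (auto simp: invertible_mat_def inverts_mat_def)
  have "dim_col B = n" using arg_cong[OF AB, of dim_col] by simp
  moreover have "dim_row B = n" using arg_cong[OF BA, of dim_col] A by simp
  ultimately have "B \<in> carrier_mat n n" by auto
  from det_mult[OF A this] AB show "det A \<noteq> 0" by auto
next
  assume "det A \<noteq> 0"
  from det_non_zero_imp_unit[OF A this] obtain B where
    "B \<in> carrier_mat n n" "A * B = 1\<^sub>m n" "B * A = 1\<^sub>m n"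
    by (auto simp: Units_def ring_mat_def)
  then show "invertible_mat A"
    using A by (auto simp: invertible_mat_def inverts_mat_def)
qed

lemma diag_prod_nonzero_iff:
  fixes A :: "'a::field mat"
  assumes "A \<in> carrier_mat n n"
  shows "prod_list (diag_mat A) \<noteq> 0 \<longleftrightarrow> (\<forall>i<n. A $$ (i, i) \<noteq> 0)"
  using assms by (auto simp: prod_list_zero_iff diag_mat_def)

lemma is_L_iff:
  "is_L n L \<longleftrightarrow> L \<in> carrier_mat n n \<and> (\<forall>i<n. \<forall>j<n. i < j \<longrightarrow> L $$ (i, j) = 0) \<and>
     (\<forall>i<n. L $$ (i, i) \<noteq> 0)"
proof (cases "L \<in> carrier_mat n n \<and> (\<forall>i<n. \<forall>j<n. i < j \<longrightarrow> L $$ (i, j) = 0)")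
  case True
  then have "det L = prod_list (diag_mat L)" by (intro det_lower_triangular[of n]) auto
  then show ?thesis
    using True invertible_mat_iff_det[of L n] diag_prod_nonzero_iff[of L n]
    by (auto simp: is_L_def lower_triangular_def)
qed (auto simp: is_L_def lower_triangular_def)

lemma is_U_iff:
  "is_U n U \<longleftrightarrow> U \<in> carrier_mat n n \<and> (\<forall>i<n. \<forall>j<n. j < i \<longrightarrow> U $$ (i, j) = 0) \<and>
     (\<forall>i<n. U $$ (i, i) \<noteq> 0)"
proof (cases "U \<in> carrier_mat n n \<and> upper_triangular U")
  case True
  then have "det U = prod_list (diag_mat U)" by (intro det_upper_triangular[of U n]) auto
  then show ?thesis
    using True invertible_mat_iff_det[of U n] diag_prod_nonzero_iff[of U n]
    by (auto simp: is_U_def upper_triangular_def)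
next
  case False
  then show ?thesis by (auto simp: is_U_def upper_triangular_def) 
qed

lemma is_L_transpose: "is_L n (A\<^sup>T) \<longleftrightarrow> is_U n A"
  by (cases "A \<in> carrier_mat n n") (auto simp: is_L_iff is_U_iff)

lemma is_L_one: "is_L n (1\<^sub>m n)" and is_U_one: "is_U n (1\<^sub>m n)"
  by (auto simp: is_L_iff is_U_iff)

lemma index_mult_sum:
  assumes "A \<in> carrier_mat m k" "B \<in> carrier_mat k n" "i < m" "j < n"
  shows "(A * B) $$ (i, j) = (\<Sum>l<k. A $$ (i, l) * B $$ (l, j))"
  using assms by (auto simp: scalar_prod_def atLeast0LessThan)

text \<open>
After \<open>k\<close> steps of forward substitution the first \<open>k\<close> rows of \<open>L X\<close> are those of the identity
matrix.  The rows of \<open>X\<close> that are still to be computed come from the identity matrix, so \<open>X\<close> is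
lower triangular all along.
\<close>

lemma lower_inverse_timed_correct:
  fixes L :: "'a::field mat"
  assumes L: "is_L n L"
  defines "X \<equiv> result (lower_inverse_timed L)"
  shows "is_L n X" and "inverse_mats L X"
proof -
  have cL: "L \<in> carrier_mat n n" using L by (auto simp: is_L_iff)
  then have n: "dim_row L = n" by auto
  define P where "P = (\<lambda>k (X :: 'a mat). X \<in> carrier_mat n n \<and>
    (\<forall>i<n. \<forall>j<n. i < j \<longrightarrow> X $$ (i, j) = 0) \<and>
    (\<forall>i<k. \<forall>j<n. (\<Sum>l\<le>i. L $$ (i, l) * X $$ (l, j)) = delta i j))"
  have P: "P n X"
    unfolding X_def lower_inverse_timed_def Let_def n result_bind result_one_timed
  proof (rule fold_timed_upt_invariant)
    show "P 0 (1\<^sub>m n)" by (auto simp: P_def)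
  next
    fix k and Z :: "'a mat"
    assume k: "k < n" and Z: "P k Z"
    have Lk: "L $$ (k, k) \<noteq> 0" using L k by (auto simp: is_L_iff)
    let ?Y = "result (make_mat n n (\<lambda>i j.
         if i = k then do {
           s \<leftarrow> sum_timed (\<lambda>l. fmul (L $$ (k, l)) (Z $$ (l, j))) k;
           t \<leftarrow> fsub (delta k j) s;
           fdiv t (L $$ (k, k))
         } else ret (Z $$ (i, j))))"
    have Y: "?Y $$ (i, j) = (if i = k then (delta k j - (\<Sum>l<k. L $$ (k, l) * Z $$ (l, j))) / L $$ (k, k)
        else Z $$ (i, j))" if "i < n" "j < n" for i j
      using that by auto
    have "?Y \<in> carrier_mat n n" by simp
    moreover have "?Y $$ (i, j) = 0" if "i < n" "j < n" "i < j" for i j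
    proof (cases "i = k")
      case True
      have "(\<Sum>l<k. L $$ (k, l) * Z $$ (l, j)) = 0"
        using Z that k True by (intro sum.neutral) (auto simp: P_def)
      then show ?thesis using True that by (subst Y) auto
    next
      case False
      then show ?thesis using that Z by (subst Y) (auto simp: P_def)
    qed
    moreover have "(\<Sum>l\<le>i. L $$ (i, l) * ?Y $$ (l, j)) = delta i j" if "i < Suc k" "j < n" for i j
    proof (cases "i = k")
      case False
      then have "i < k" using that by auto
      have "(\<Sum>l\<le>i. L $$ (i, l) * ?Y $$ (l, j)) = (\<Sum>l\<le>i. L $$ (i, l) * Z $$ (l, j))"
        using \<open>i < k\<close> k that by (intro sum.cong refl) (subst Y, auto)
      then show ?thesis using \<open>i < k\<close> Z that by (auto simp: P_def)
    next
      case True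
      have "(\<Sum>l<k. L $$ (k, l) * ?Y $$ (l, j)) = (\<Sum>l<k. L $$ (k, l) * Z $$ (l, j))"
        using k that by (intro sum.cong refl) (subst Y, auto)
      moreover have "{..k} = insert k {..<k}" by auto
      moreover have "L $$ (k, k) * ?Y $$ (k, j) = delta k j - (\<Sum>l<k. L $$ (k, l) * Z $$ (l, j))"
        using k that Lk by (subst Y) auto
      ultimately show ?thesis using True by (simp del: result_make_mat)
    qed
    ultimately show "P (Suc k) ?Y" by (auto simp: P_def simp del: result_make_mat)
  qed
  then have cX: "X \<in> carrier_mat n n" and Xlow: "\<And>i j. i < n \<Longrightarrow> j < n \<Longrightarrow> i < j \<Longrightarrow> X $$ (i, j) = 0"
    and inv: "\<And>i j. i < n \<Longrightarrow> j < n \<Longrightarrow> (\<Sum>l\<le>i. L $$ (i, l) * X $$ (l, j)) = delta i j"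
    by (auto simp: P_def)
  have "L * X = 1\<^sub>m n"
  proof (rule eq_matI)
    fix i j assume "i < dim_row (1\<^sub>m n)" "j < dim_col (1\<^sub>m n)"
    then have ij: "i < n" "j < n" by auto
    have "(\<Sum>l<n. L $$ (i, l) * X $$ (l, j)) = (\<Sum>l\<le>i. L $$ (i, l) * X $$ (l, j))"
      using L ij by (intro sum.mono_neutral_right) (auto simp: is_L_iff)
    then show "(L * X) $$ (i, j) = 1\<^sub>m n $$ (i, j)"
      using inv[OF ij] ij index_mult_sum[OF cL cX ij] by auto
  qed (use cL cX in auto)
  then show inv: "inverse_mats L X" using cL cX by (intro inverse_matsI)
  show "is_L n X"
    using inverse_mats_invertible[OF inverse_mats_sym[OF inv]] cX Xlow
    by (auto simp: is_L_def lower_triangular_def)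
qed

lemma inverse_mats_transpose:
  assumes "inverse_mats g h" "g \<in> carrier_mat n n"
  shows "inverse_mats (g\<^sup>T) (h\<^sup>T)"
proof -
  note D = inverse_matsD[OF assms(1) disjI1[OF assms(2)]]
  show ?thesis
  proof (rule inverse_matsI)
    show "g\<^sup>T * h\<^sup>T = 1\<^sub>m n"
      using D transpose_mult[OF D(2,1)] by simp
  qed (use D in auto)
qed

lemma upper_inverse_timed_correct:
  assumes U: "is_U n U"
  shows "inverse_mats U (result (upper_inverse_timed U))"
proof -
  have cU: "U \<in> carrier_mat n n" using U by (simp add: is_U_def)
  have "is_L n (U\<^sup>T)" using U by (simp add: is_L_transpose)
  from inverse_mats_transpose[OF lower_inverse_timed_correct(2)[OF this], of n] cU
  show ?thesis by (simp add: upper_inverse_timed_def)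
qed

lemma inverse_mats_mult:
  assumes "inverse_mats A A'" "inverse_mats B B'" "A \<in> carrier_mat n n" "B \<in> carrier_mat n n"
  shows "inverse_mats (A * B) (B' * A')"
proof -
  note a = inverse_matsD[OF assms(1) disjI1[OF assms(3)]]
  note b = inverse_matsD[OF assms(2) disjI1[OF assms(4)]]
  show ?thesis
  proof (rule inverse_matsI)
    have "(A * B) * (B' * A') = A * (B * (B' * A'))"
      using a b by (intro assoc_mult_mat) auto
    also have "B * (B' * A') = (B * B') * A'"
      using a b by (intro assoc_mult_mat[symmetric]) auto
    also have "A * \<dots> = 1\<^sub>m n" using a b by simp
    finally show "(A * B) * (B' * A') = 1\<^sub>m n" .
  qed (use a b in auto)
qed

section \<open>Reflection in the anti-diagonal\<close>

definition antitranspose :: "'a mat \<Rightarrow> 'a mat" where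
  "antitranspose A = mat (dim_col A) (dim_row A)
     (\<lambda>(i, j). A $$ (dim_row A - 1 - j, dim_col A - 1 - i))"

lemma result_antitranspose_timed [simp]: "result (antitranspose_timed A) = antitranspose A"
  by (simp add: antitranspose_timed_def antitranspose_def)

lemma antitranspose_dim [simp]:
  "dim_row (antitranspose A) = dim_col A" "dim_col (antitranspose A) = dim_row A"
  by (simp_all add: antitranspose_def)

lemma antitranspose_carrier [simp]:
  "antitranspose A \<in> carrier_mat n m \<longleftrightarrow> A \<in> carrier_mat m n"
  unfolding carrier_mat_def mem_Collect_eq antitranspose_dim by (rule conj_commute)

lemma antitranspose_index:
  assumes "A \<in> carrier_mat m n" "i < n" "j < m"
  shows "antitranspose A $$ (i, j) = A $$ (m - 1 - j, n - 1 - i)"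
  using assms by (auto simp: antitranspose_def)

lemma antitranspose_antitranspose [simp]: "antitranspose (antitranspose A) = A"
  by (intro eq_matI) (auto simp: antitranspose_def)

lemma antitranspose_mult:
  fixes A B :: "'a::comm_semiring_0 mat"
  assumes A: "A \<in> carrier_mat m k" and B: "B \<in> carrier_mat k n"
  shows "antitranspose (A * B) = antitranspose B * antitranspose A"
proof (rule eq_matI)
  fix i j assume "i < dim_row (antitranspose B * antitranspose A)"
    "j < dim_col (antitranspose B * antitranspose A)"
  then have ij: "i < n" "j < m" using A B by auto
  have "antitranspose (A * B) $$ (i, j) = (\<Sum>l<k. A $$ (m - 1 - j, l) * B $$ (l, n - 1 - i))"
    using A B ij by (subst antitranspose_index[of _ m n]) (auto simp: scalar_prod_def atLeast0LessThan)
  also have "\<dots> = (\<Sum>l<k. A $$ (m - 1 - j, k - Suc l) * B $$ (k - Suc l, n - 1 - i))"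
    by (rule sum.nat_diff_reindex[symmetric])
  also have "\<dots> = (\<Sum>l<k. antitranspose B $$ (i, l) * antitranspose A $$ (l, j))"
    using A B ij
    by (intro sum.cong refl)
       (auto simp: antitranspose_index[of B k n] antitranspose_index[of A m k] mult.commute)
  also have "\<dots> = (antitranspose B * antitranspose A) $$ (i, j)"
    using A B ij by (auto simp: scalar_prod_def atLeast0LessThan)
  finally show "antitranspose (A * B) $$ (i, j) = (antitranspose B * antitranspose A) $$ (i, j)" .
qed (use A B in auto)

lemma antitranspose_is_L: 
  assumes "is_L n A"
  shows "is_L n (antitranspose A)"
  using assms by (auto simp: is_L_iff antitranspose_index[of A n n])

lemma antitranspose_is_U: 
  assumes "is_U n A"
  shows "is_U n (antitranspose A)"
  using assms by (auto simp: is_U_iff antitranspose_index[of A n n])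

lemma is_P_iff:
  "is_P n P \<longleftrightarrow> P \<in> carrier_mat n n \<and>
     (\<exists>\<pi>. \<pi> permutes {..<n} \<and> (\<forall>i<n. \<forall>j<n. P $$ (i, j) = delta i (\<pi> j)))"
proof -
  have "P = perm_matrix n \<pi> \<longleftrightarrow> (\<forall>i<n. \<forall>j<n. P $$ (i, j) = delta i (\<pi> j))"
    if "P \<in> carrier_mat n n" for \<pi>
    using that by (auto simp: perm_matrix_def intro!: eq_matI)
  then show ?thesis
    unfolding is_P_def permutation_mat_def by auto
qed

lemma is_P_one: "is_P n (1\<^sub>m n)"
  unfolding is_P_iff by (auto intro!: exI[of _ id] permutes_id)

text \<open>
With \<open>\<rho>\<close> the reversal of \<open>{..<n}\<close>, the reflection of the matrix of \<open>\<pi>\<close> is the matrix of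
\<open>\<rho> \<pi>\<inverse> \<rho>\<close>: the reversal comes from the anti-diagonal and the inverse from the transposition.
\<close>

lemma antitranspose_is_P:
  assumes "is_P n A"
  shows "is_P n (antitranspose A)"
proof -
  from assms obtain \<pi> where A: "A \<in> carrier_mat n n" and \<pi>: "\<pi> permutes {..<n}"
    and ind: "\<And>i j. i < n \<Longrightarrow> j < n \<Longrightarrow> A $$ (i, j) = delta i (\<pi> j)"
    by (auto simp: is_P_iff)
  define \<rho> where "\<rho> = (\<lambda>k. if k < n then n - 1 - k else k)"
  have \<rho>\<rho>: "\<rho> (\<rho> k) = k" for k by (auto simp: \<rho>_def)
  have "bij_betw \<rho> {..<n} {..<n}"
    by (intro bij_betwI[of _ _ _ \<rho>]) (auto simp: \<rho>_def)
  then have \<rho>: "\<rho> permutes {..<n}"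
    by (intro bij_imp_permutes) (auto simp: \<rho>_def)
  have "antitranspose A $$ (i, j) = delta i ((\<rho> \<circ> inv_into UNIV \<pi> \<circ> \<rho>) j)" if "i < n" "j < n" for i j
  proof -
    have "n - 1 - j = \<pi> (n - 1 - i) \<longleftrightarrow> \<rho> j = \<pi> (\<rho> i)"
      using that by (simp add: \<rho>_def)
    also have "\<dots> \<longleftrightarrow> inv_into UNIV \<pi> (\<rho> j) = \<rho> i"
      using permutes_inverses[OF \<pi>] by metis
    also have "\<dots> \<longleftrightarrow> i = \<rho> (inv_into UNIV \<pi> (\<rho> j))"
      using \<rho>\<rho> by metis
    finally show ?thesis
      using that A ind[of "n - 1 - j" "n - 1 - i"] by (auto simp: antitranspose_index[of A n n])
  qed
  moreover have "(\<rho> \<circ> inv_into UNIV \<pi> \<circ> \<rho>) permutes {..<n}"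
    by (intro permutes_compose permutes_inv \<pi> \<rho>)
  ultimately show ?thesis using A unfolding is_P_iff by (auto intro!: exI[of _ "\<rho> \<circ> inv_into UNIV \<pi> \<circ> \<rho>"])
qed

lemma is_P_transpose_inverse:
  fixes P :: "'a::field mat"
  assumes "is_P n P"
  shows "inverse_mats P (P\<^sup>T)"
proof -
  from assms obtain \<pi> where P: "P \<in> carrier_mat n n" and \<pi>: "\<pi> permutes {..<n}"
    and ind: "\<And>i j. i < n \<Longrightarrow> j < n \<Longrightarrow> P $$ (i, j) = delta i (\<pi> j)"
    by (auto simp: is_P_iff)
  have lt: "\<pi> i < n \<longleftrightarrow> i < n" for i using permutes_in_image[OF \<pi>] by auto
  have "P\<^sup>T * P = 1\<^sub>m n"
  proof (rule eq_matI)
    fix i j assume "i < dim_row (1\<^sub>m n)" "j < dim_col (1\<^sub>m n)"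
    then have ij: "i < n" "j < n" by auto
    have "(P\<^sup>T * P) $$ (i, j) = (\<Sum>l<n. P $$ (l, i) * P $$ (l, j))"
      using ij P by (subst index_mult_sum[of _ n n _ n]) auto
    also have "\<dots> = (\<Sum>l<n. if l = \<pi> i then delta (\<pi> i) (\<pi> j) else 0)"
      using ij by (intro sum.cong refl) (auto simp: ind)
    also have "\<dots> = 1\<^sub>m n $$ (i, j)"
      using ij lt permutes_inj[OF \<pi>] by (auto simp: sum.delta inj_eq)
    finally show "(P\<^sup>T * P) $$ (i, j) = 1\<^sub>m n $$ (i, j)" .
  qed (use P in auto)
  then show ?thesis
    using P by (intro inverse_mats_sym[OF inverse_matsI]) auto
qed

text \<open>
The two transpositions, one in the shape \<open>E_U\<close> and one in the reflection, account for each other.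
\<close>

lemma EL_hat_shape_iff:
  fixes E :: "'a::field mat"
  shows "EL_hat_shape E \<longleftrightarrow> EL_shape (antitranspose E)"
proof -
  let ?m = "dim_row E" and ?n = "dim_col E"
  have 1: "(antidiag ?m * E) $$ (i, j) = E $$ (?m - 1 - i, j)" if "i < ?m" "j < ?n" for i j
  proof -
    have "(antidiag ?m * E) $$ (i, j) = (\<Sum>l<?m. antidiag ?m $$ (i, l) * E $$ (l, j))"
      using that by (intro index_mult_sum[of _ ?m ?m _ ?n]) (auto simp: antidiag_def)
    also have "\<dots> = (\<Sum>l<?m. if l = ?m - 1 - i then E $$ (l, j) else 0)"
      using that by (intro sum.cong refl) (auto simp: antidiag_def)
    finally have "(antidiag ?m * E) $$ (i, j) = (\<Sum>l<?m. if l = ?m - 1 - i then E $$ (l, j) else 0)" .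
    then show ?thesis using that by (auto simp: sum.delta)
  qed
  have 2: "(antidiag ?m * E * antidiag ?n) $$ (i, j) = E $$ (?m - 1 - i, ?n - 1 - j)"
    if "i < ?m" "j < ?n" for i j
  proof -
    have "(antidiag ?m * E * antidiag ?n) $$ (i, j) =
      (\<Sum>l<?n. (antidiag ?m * E) $$ (i, l) * antidiag ?n $$ (l, j))"
      using that by (intro index_mult_sum[of _ ?m ?n _ ?n]) (auto simp: antidiag_def)
    also have "\<dots> = (\<Sum>l<?n. if l = ?n - 1 - j then E $$ (?m - 1 - i, l) else 0)"
    proof (intro sum.cong refl)
      fix l assume l: "l \<in> {..<?n}"
      then have "(antidiag ?n :: 'a mat) $$ (l, j) = delta l (?n - 1 - j)"
        using that by (auto simp: antidiag_def)
      then show "(antidiag ?m * E) $$ (i, l) * antidiag ?n $$ (l, j) =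
          (if l = ?n - 1 - j then E $$ (?m - 1 - i, l) else 0)"
        using 1[of i l] that l by simp
    qed
    finally show ?thesis using that by (auto simp: sum.delta)
  qed
  have "(antidiag ?m * E * antidiag ?n)\<^sup>T = antitranspose E"
  proof (rule eq_matI)
    fix i j assume "i < dim_row (antitranspose E)" "j < dim_col (antitranspose E)"
    then have ij: "i < ?n" "j < ?m" by simp_all
    have "(antidiag ?m * E * antidiag ?n)\<^sup>T $$ (i, j) = (antidiag ?m * E * antidiag ?n) $$ (j, i)"
      using ij by (intro index_transpose_mat(1)) (simp_all add: antidiag_def)
    also have "\<dots> = antitranspose E $$ (i, j)"
      using ij by (simp only: 2) (simp add: antitranspose_def)
    finally show "(antidiag ?m * E * antidiag ?n)\<^sup>T $$ (i, j) = antitranspose E $$ (i, j)" .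
  qed (simp_all add: antidiag_def)
  then show ?thesis by (simp add: EL_hat_shape_def EU_shape_def)
qed

section \<open>Triangular factors on both sides of a pivot shape\<close>

lemma EL_shapeD:
  assumes E: "E \<in> carrier_mat m n" and shape: "EL_shape E"
  shows EL_shape_entry: "\<And>i j. i < m \<Longrightarrow> j < n \<Longrightarrow> E $$ (i, j) \<noteq> 0 \<Longrightarrow> E $$ (i, j) = 1"
    and EL_shape_row: "\<And>i j j'. i < m \<Longrightarrow> j < n \<Longrightarrow> j' < n \<Longrightarrow>
      E $$ (i, j) \<noteq> 0 \<Longrightarrow> E $$ (i, j') \<noteq> 0 \<Longrightarrow> j = j'"
    and EL_shape_col: "\<And>i i' j. i < m \<Longrightarrow> i' < m \<Longrightarrow> j < n \<Longrightarrow>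
      E $$ (i, j) \<noteq> 0 \<Longrightarrow> E $$ (i', j) \<noteq> 0 \<Longrightarrow> i = i'"
    and EL_shape_mono: "\<And>i i' j j'. i < m \<Longrightarrow> i' < m \<Longrightarrow> j < j' \<Longrightarrow> j' < n \<Longrightarrow>
      E $$ (i, j) \<noteq> 0 \<Longrightarrow> E $$ (i', j') \<noteq> 0 \<Longrightarrow> i < i'"
    and EL_shape_zero_col: "\<And>i j k. j \<le> k \<Longrightarrow> k < n \<Longrightarrow> \<forall>i<m. E $$ (i, j) = 0 \<Longrightarrow>
      i < m \<Longrightarrow> E $$ (i, k) = 0"
proof -
  note D = shape[unfolded EL_shape_def pivot_mat_def carrier_matD[OF E]]
  note 1 = D[THEN conjunct1, THEN conjunct1]
    and 2 = D[THEN conjunct1, THEN conjunct2, THEN conjunct1]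
    and 3 = D[THEN conjunct1, THEN conjunct2, THEN conjunct2]
    and 4 = D[THEN conjunct2, THEN conjunct1] and 5 = D[THEN conjunct2, THEN conjunct2]
  show "E $$ (i, j) = 1" if "i < m" "j < n" "E $$ (i, j) \<noteq> 0" for i j
    using 1 that by blast
  show "j = j'" if "i < m" "j < n" "j' < n" "E $$ (i, j) \<noteq> 0" "E $$ (i, j') \<noteq> 0" for i j j'
    using 2 that by blast
  show "i = i'" if "i < m" "i' < m" "j < n" "E $$ (i, j) \<noteq> 0" "E $$ (i', j) \<noteq> 0" for i i' j
    using 3 that by blast
  show "i < i'" if "i < m" "i' < m" "j < j'" "j' < n" "E $$ (i, j) \<noteq> 0" "E $$ (i', j') \<noteq> 0"
    for i i' j j'
    using 4 that order.strict_trans by blast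
  show "E $$ (i, k) = 0" if "j \<le> k" "k < n" "\<forall>i<m. E $$ (i, j) = 0" "i < m" for i j k
  proof (cases "j = k")
    case True
    then show ?thesis using that by blast
  next
    case False
    then have "j < k" "j < n" using that by linarith+
    then show ?thesis using 5 that by blast
  qed
qed

lemma result_find_nonzero [simp]: "result (find_nonzero f xs) = List.find (\<lambda>i. f i \<noteq> 0) xs"
  by (induction xs) auto

lemma result_left_factor_timed_pivot:
  assumes "EL_shape E" "a < dim_row E" "b < dim_row E" "j < dim_col E" "E $$ (b, j) \<noteq> 0"
  shows "result (left_factor_timed E M) $$ (a, b) = M $$ (a, j)"
proof -
  have uniq: "j' = j" if "j' < dim_col E" "E $$ (b, j') \<noteq> 0" for j'
    using EL_shape_row[of E "dim_row E" "dim_col E" b j' j] assms that by auto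
  obtain j' where j': "List.find (\<lambda>j. E $$ (b, j) \<noteq> 0) [0..<dim_col E] = Some j'"
    using assms by (cases "List.find (\<lambda>j. E $$ (b, j) \<noteq> 0) [0..<dim_col E]") 
      (auto simp: find_None_iff)
  have "j' = j" using j' uniq by (auto simp: find_Some_iff)
  with j' show ?thesis using assms by (simp add: left_factor_timed_def)
qed

lemma result_left_factor_timed_zero_row:
  assumes "a < dim_row E" "b < dim_row E" "\<And>j. j < dim_col E \<Longrightarrow> E $$ (b, j) = 0"
  shows "result (left_factor_timed E M) $$ (a, b) = delta a b"
proof -
  have "List.find (\<lambda>j. E $$ (b, j) \<noteq> 0) [0..<dim_col E] = None"
    using assms by (auto simp: find_None_iff)
  then show ?thesis using assms by (simp add: left_factor_timed_def)
qed

text \<open>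
Column \<open>j\<close> of \<open>M\<close> is a combination of those columns of \<open>L1\<close> whose indices are the pivot rows of the columns
from \<open>j\<close> on, since \<open>L2\<close> is lower triangular.  If \<open>j\<close> is a zero column of \<open>E\<close>, so are all later ones, and
the combination is empty.  If \<open>j\<close> has its pivot in row \<open>b\<close>, the columns \<open>b\<close> and beyond of \<open>L1\<close> are
involved, which vanish above row \<open>b\<close>; only the first of them contributes to row \<open>b\<close>, with a product of two
diagonal entries.  Column \<open>j\<close> of \<open>M\<close> can thus serve as column \<open>b\<close> of an invertible lower triangular matrix \<open>K\<close>.
\<close>

lemma left_factor_timed_correct:
  fixes E :: "'a::field mat"
  assumes E: "E \<in> carrier_mat m n" "EL_shape E" and L1: "is_L m L1" and L2: "is_L n L2"
    and M: "M = L1 * E * L2"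
  defines "K \<equiv> result (left_factor_timed E M)"
  shows "is_L m K" and "M = K * E"
proof -
  have dE [simp]: "dim_row E = m" "dim_col E = n" using E by auto
  have cL: "L1 \<in> carrier_mat m m" "L2 \<in> carrier_mat n n" using L1 L2 by (auto simp: is_L_iff)
  have cM: "M \<in> carrier_mat m n" using M cL E by auto
  have cK: "K \<in> carrier_mat m m" by (auto simp: K_def left_factor_timed_def)
  have Mx: "M $$ (a, j) = (\<Sum>l<n. \<Sum>c<m. L1 $$ (a, c) * E $$ (c, l) * L2 $$ (l, j))"
    if "a < m" "j < n" for a j
  proof -
    have "M $$ (a, j) = (\<Sum>l<n. (L1 * E) $$ (a, l) * L2 $$ (l, j))"
      unfolding M using that E cL by (intro index_mult_sum[of _ m n _ n]) auto
    also have "\<dots> = (\<Sum>l<n. (\<Sum>c<m. L1 $$ (a, c) * E $$ (c, l)) * L2 $$ (l, j))"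
      using that E cL by (intro sum.cong refl, subst index_mult_sum[of _ m m _ n]) auto
    finally show ?thesis by (simp add: sum_distrib_right)
  qed
  have term0: "L1 $$ (a, c) * E $$ (c, l) * L2 $$ (l, j) = 0"
    if "a < m" "c < m" "l < n" "j < n" "a < c \<or> l < j \<or> E $$ (c, l) = 0" for a c l j
    using that L1 L2 by (auto simp: is_L_iff)
  note one = EL_shape_entry[OF E] and rowuniq = EL_shape_row[OF E] and coluniq = EL_shape_col[OF E]
    and mono = EL_shape_mono[OF E] and zerocol = EL_shape_zero_col[OF E]
  have M_zerocol: "M $$ (a, j) = 0" if "a < m" "j < n" "\<forall>c<m. E $$ (c, j) = 0" for a j
    unfolding Mx[OF that(1,2)]
  proof (intro sum.neutral ballI)
    fix l c assume "l \<in> {..<n}" "c \<in> {..<m}"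
    then show "L1 $$ (a, c) * E $$ (c, l) * L2 $$ (l, j) = 0"
      using that zerocol[of j l c] by (intro term0) (auto simp: not_less[symmetric])
  qed
  have later: "b \<le> c" if "b < m" "c < m" "j \<le> l" "l < n" "E $$ (b, j) \<noteq> 0" "E $$ (c, l) \<noteq> 0" for b c j l
    using that coluniq mono[of b c j l] by (cases "j = l") auto
  have M_above: "M $$ (a, j) = 0" if "a < b" "b < m" "j < n" "E $$ (b, j) \<noteq> 0" for a b j
  proof -
    have "a < m" using that by auto
    show ?thesis
      unfolding Mx[OF \<open>a < m\<close> that(3)]
    proof (intro sum.neutral ballI)
      fix l c assume "l \<in> {..<n}" "c \<in> {..<m}"
      moreover from this have "b \<le> c" if "j \<le> l" "E $$ (c, l) \<noteq> 0"
        using later[of b c j l] that \<open>b < m\<close> \<open>E $$ (b, j) \<noteq> 0\<close> by simp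
      ultimately show "L1 $$ (a, c) * E $$ (c, l) * L2 $$ (l, j) = 0"
        using that \<open>a < m\<close>
        by (intro term0; cases "j \<le> l"; cases "E $$ (c, l) = 0") auto
    qed
  qed
  have M_pivot: "M $$ (b, j) \<noteq> 0" if "b < m" "j < n" "E $$ (b, j) \<noteq> 0" for b j
  proof -
    have z: "L1 $$ (b, c) * E $$ (c, l) * L2 $$ (l, j) = 0"
      if "c < m" "l < n" "(l, c) \<noteq> (j, b)" for c l
    proof (rule term0)
      show "b < c \<or> l < j \<or> E $$ (c, l) = 0"
        using later[of b c j l] that \<open>b < m\<close> \<open>j < n\<close> \<open>E $$ (b, j) \<noteq> 0\<close> rowuniq[of b j l]
        by (metis le_neq_implies_less linorder_le_less_linear)
    qed (use that \<open>b < m\<close> \<open>j < n\<close> in auto)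
    have "M $$ (b, j) = (\<Sum>(l, c)\<in>{..<n}\<times>{..<m}. L1 $$ (b, c) * E $$ (c, l) * L2 $$ (l, j))"
      unfolding Mx[OF that(1,2)] by (rule sum.cartesian_product)
    also have "\<dots> = (\<Sum>(l, c)\<in>{(j, b)}. L1 $$ (b, c) * E $$ (c, l) * L2 $$ (l, j))"
    proof (rule sum.mono_neutral_right)
      show "\<forall>x\<in>{..<n} \<times> {..<m} - {(j, b)}.
          (case x of (l, c) \<Rightarrow> L1 $$ (b, c) * E $$ (c, l) * L2 $$ (l, j)) = 0"
      proof (intro ballI)
        fix x assume x: "x \<in> {..<n} \<times> {..<m} - {(j, b)}"
        obtain l c where "x = (l, c)" by fastforce
        with x z[of c l] show "(case x of (l, c) \<Rightarrow> L1 $$ (b, c) * E $$ (c, l) * L2 $$ (l, j)) = 0"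
          by simp
      qed
    qed (use that in simp_all)
    finally show ?thesis using that one L1 L2 by (auto simp: is_L_iff)
  qed
  have K_pivot: "K $$ (a, b) = M $$ (a, j)" if "a < m" "b < m" "j < n" "E $$ (b, j) \<noteq> 0" for a b j
    using result_left_factor_timed_pivot[OF E(2), of a b j] that by (simp add: K_def)
  have K_zero: "K $$ (a, b) = delta a b" if "a < m" "b < m" "\<forall>j<n. E $$ (b, j) = 0" for a b
    using result_left_factor_timed_zero_row[of a E b] that by (simp add: K_def)
  \<comment> \<open>A zero row of \<open>E\<close> leaves the column of \<open>K\<close> free, and the unit vector keeps \<open>K\<close> invertible.\<close>
  show "is_L m K"
    unfolding is_L_iff
  proof (intro conjI allI impI)
    show "K \<in> carrier_mat m m" by (fact cK)
    show "K $$ (a, b) = 0" if "a < m" "b < m" "a < b" for a b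
      using K_pivot[of a b] K_zero[of a b] M_above[of a b] that by (cases "\<forall>j<n. E $$ (b, j) = 0") auto
    show "K $$ (a, a) \<noteq> 0" if "a < m" for a
      using K_pivot[of a a] K_zero[of a a] M_pivot[of a] that by (cases "\<forall>j<n. E $$ (a, j) = 0") auto
  qed
  show "M = K * E"
  proof (rule eq_matI)
    fix a j assume "a < dim_row (K * E)" "j < dim_col (K * E)"
    then have aj: "a < m" "j < n" using cK by auto
    have KE: "(K * E) $$ (a, j) = (\<Sum>b<m. K $$ (a, b) * E $$ (b, j))"
      using cK E aj by (intro index_mult_sum) auto
    show "M $$ (a, j) = (K * E) $$ (a, j)"
    proof (cases "\<exists>b<m. E $$ (b, j) \<noteq> 0")
      case True
      then obtain b where b: "b < m" "E $$ (b, j) \<noteq> 0" by auto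
      have "E $$ (b', j) = 0" if "b' < m" "b' \<noteq> b" for b'
        using coluniq b that aj by blast
      then have "(\<Sum>b<m. K $$ (a, b) * E $$ (b, j)) = K $$ (a, b) * E $$ (b, j)"
        using b by (subst sum.remove[of _ b]) auto
      then show ?thesis using KE one[OF b(1) aj(2) b(2)] K_pivot b aj by simp
    next
      case False
      then show ?thesis using KE M_zerocol aj by auto
    qed
  qed (use cM cK in auto)
qed

text \<open>
The procedures search rows and columns in opposite directions after the reflection; they agree because
the pivot that they look for is unique.
\<close>

lemma result_right_factor_timed:
  assumes E: "E \<in> carrier_mat m n" "EL_hat_shape E" and M: "M \<in> carrier_mat m n"
  shows "result (right_factor_timed E M) =
    antitranspose (result (left_factor_timed (antitranspose E) (antitranspose M)))" (is "?K = ?K'")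
proof (rule eq_matI)
  let ?F = "antitranspose E"
  have F: "EL_shape ?F" using E by (simp add: EL_hat_shape_iff)
  have dE [simp]: "dim_row E = m" "dim_col E = n" "dim_row M = m" "dim_col M = n" using E M by auto
  have dK: "result (left_factor_timed ?F N) \<in> carrier_mat n n" for N
    by (simp add: left_factor_timed_def)
  show "dim_row ?K = dim_row ?K'" "dim_col ?K = dim_col ?K'"
    by (simp_all add: right_factor_timed_def left_factor_timed_def)
  fix a b assume "a < dim_row ?K'" "b < dim_col ?K'"
  then have ab: "a < n" "b < n" by (simp_all add: left_factor_timed_def)
  show "?K $$ (a, b) = ?K' $$ (a, b)"
  proof (cases "List.find (\<lambda>i. E $$ (i, a) \<noteq> 0) [0..<m]")
    case None
    then have "?F $$ (n - 1 - a, j) = 0" if "j < m" for j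
      using that ab E(1) by (auto simp: find_None_iff antitranspose_index[of E m n])
    then have "result (left_factor_timed ?F (antitranspose M)) $$ (n - 1 - b, n - 1 - a) =
        delta (n - 1 - b) (n - 1 - a)"
      using ab by (intro result_left_factor_timed_zero_row) auto
    then show ?thesis
      using None ab antitranspose_index[OF dK ab] by (auto simp: right_factor_timed_def)
  next
    case (Some i)
    then have i: "i < m" "E $$ (i, a) \<noteq> 0" by (auto simp: find_Some_iff)
    then have "?F $$ (n - 1 - a, m - 1 - i) \<noteq> 0"
      using ab E(1) by (simp add: antitranspose_index[of E m n])
    then have "result (left_factor_timed ?F (antitranspose M)) $$ (n - 1 - b, n - 1 - a) =
        antitranspose M $$ (n - 1 - b, m - 1 - i)"
      using ab i F by (intro result_left_factor_timed_pivot) auto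
    then show ?thesis
      using Some ab i antitranspose_index[OF dK ab] M
      by (simp add: right_factor_timed_def antitranspose_index[of M m n])
  qed
qed

lemma right_factor_timed_correct:
  fixes E :: "'a::field mat"
  assumes E: "E \<in> carrier_mat m n" "EL_hat_shape E" and L1: "is_L m L1" and L2: "is_L n L2"
    and M: "M = L1 * E * L2"
  defines "K \<equiv> result (right_factor_timed E M)"
  shows "is_L n K" and "M = E * K"
proof -
  let ?at = antitranspose
  have cL: "L1 \<in> carrier_mat m m" "L2 \<in> carrier_mat n n" using L1 L2 by (auto simp: is_L_iff)
  have cM: "M \<in> carrier_mat m n" using M cL E by auto
  have K: "K = ?at (result (left_factor_timed (?at E) (?at M)))"
    unfolding K_def using E cM by (rule result_right_factor_timed)
  have M': "?at M = ?at L2 * ?at E * ?at L1"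
    unfolding M using cL E(1)
    by (simp add: antitranspose_mult[of _ m n _ n] antitranspose_mult[of _ m m _ n]
        assoc_mult_mat[of _ n n _ m _ m])
  have "?at E \<in> carrier_mat n m" "EL_shape (?at E)" using E by (simp_all add: EL_hat_shape_iff)
  note * = left_factor_timed_correct[OF this antitranspose_is_L[OF L2] antitranspose_is_L[OF L1] M']
  show K_L: "is_L n K" unfolding K using *(1) by (rule antitranspose_is_L)
  have "K \<in> carrier_mat n n" using K_L by (simp add: is_L_iff)
  from antitranspose_mult[OF E(1) this] have "?at (E * K) = ?at K * ?at E" .
  also have "\<dots> = ?at M" using *(2) K by simp
  finally show "M = E * K" by (metis antitranspose_antitranspose)
qed

section \<open>Gaussian elimination\<close>

text \<open>
The first \<open>i\<close> rows of \<open>W\<close> are finished, and \<open>p\<close> sends each of their pivot columns \<open>0..<r\<close> to its row.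
That these columns vanish in the other rows, and that \<open>L\<close> and \<open>U\<close> still agree with the identity matrix
beyond the finished part, is what allows a step to change one column of \<open>L\<close> and one row of \<open>U\<close>
without disturbing the product.
\<close>

definition leup_invariant :: "'a::field mat \<Rightarrow> nat \<Rightarrow> 'a leup_state \<Rightarrow> bool" where
  "leup_invariant A i = (\<lambda>(L, W, U, P, r). let m = dim_row A; n = dim_col A in
     is_L m L \<and> W \<in> carrier_mat m n \<and> is_U n U \<and> is_P n P \<and> A = L * W * U * P \<and> r \<le> n \<and>
     (\<forall>a<m. \<forall>b<m. i \<le> b \<longrightarrow> L $$ (a, b) = delta a b) \<and>
     (\<forall>a<n. \<forall>b<n. r \<le> a \<longrightarrow> U $$ (a, b) = delta a b) \<and>
     (\<exists>p. strict_mono_on {..<r} p \<and> (\<forall>k<r. p k < i) \<and>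
        (\<forall>a<i. \<forall>b<n. W $$ (a, b) = (if b < r \<and> a = p b then 1 else 0))) \<and>
     (\<forall>a<m. \<forall>b<r. i \<le> a \<longrightarrow> W $$ (a, b) = 0))"

text \<open>
A step inserts two pairs of factors into the product \<open>L W U P\<close>.  The column exchange \<open>S\<close> satisfies
\<open>S S = 1\<close>, and \<open>S U S\<close> remains triangular because the exchange concerns columns from \<open>r\<close> on and trivial rows.  The
elimination is \<open>W1 = G W2 V\<close>, where \<open>G\<close> differs from the identity in the column \<open>i\<close> below
the diagonal and \<open>V\<close> in the row \<open>r\<close>.  As \<open>L\<close> and \<open>U\<close> are trivial there, multiplication by \<open>G\<close> and \<open>V\<close>
merely inserts this column and this row into them.
\<close>

lemma leup_invariant_step:
  fixes A :: "'a::field mat"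
  assumes inv: "leup_invariant A i st" and i: "i < dim_row A"
  shows "leup_invariant A (Suc i) (result (leup_step i st))"
proof -
  obtain L W U P r where st: "st = (L, W, U, P, r)" by (cases st) auto
  define m n where "m = dim_row A" and "n = dim_col A"
  have im: "i < m" using i by (simp add: m_def)
  note I = inv[unfolded leup_invariant_def st Let_def prod.case, folded m_def n_def]
  note I4 = I[THEN conjunct2, THEN conjunct2, THEN conjunct2, THEN conjunct2]
  note I8 = I4[THEN conjunct2, THEN conjunct2, THEN conjunct2, THEN conjunct2]
  note L = I[THEN conjunct1] and W = I[THEN conjunct2, THEN conjunct1]
    and U = I[THEN conjunct2, THEN conjunct2, THEN conjunct1]
    and P = I[THEN conjunct2, THEN conjunct2, THEN conjunct2, THEN conjunct1]
    and A = I4[THEN conjunct1] and rn = I4[THEN conjunct2, THEN conjunct1]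
    and Lid = I4[THEN conjunct2, THEN conjunct2, THEN conjunct1, rule_format]
    and Uid = I4[THEN conjunct2, THEN conjunct2, THEN conjunct2, THEN conjunct1, rule_format]
    and W0 = I8[THEN conjunct2, rule_format]
  from I8[THEN conjunct1] obtain p where p: "strict_mono_on {..<r} p" "\<And>k. k < r \<Longrightarrow> p k < i"
    and Wp: "\<And>a b. a < i \<Longrightarrow> b < n \<Longrightarrow> W $$ (a, b) = (if b < r \<and> a = p b then 1 else 0)"
    by auto
  have cL: "L \<in> carrier_mat m m" and cU: "U \<in> carrier_mat n n" and cP: "P \<in> carrier_mat n n"
    using L U P by (auto simp: is_L_iff is_U_iff is_P_iff)
  have dW: "dim_row W = m" "dim_col W = n" using W by auto
  show ?thesis
  proof (cases "List.find (\<lambda>j. W $$ (i, j) \<noteq> 0) [r..<n]")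
    case None
    then have res: "result (leup_step i st) = st"
      by (simp add: st leup_step_def Let_def dW)
    have "W $$ (i, b) = 0" if "b < n" for b
      using None W0[OF im, of b] that by (cases "b < r") (auto simp: find_None_iff)
    then have "W $$ (a, b) = (if b < r \<and> a = p b then 1 else 0)" if "a < Suc i" "b < n" for a b
      using that Wp[of a b] p(2)[of b] by (cases "a = i") auto
    moreover have "\<And>k. k < r \<Longrightarrow> p k < Suc i" using p(2) less_SucI by blast
    ultimately have "\<exists>p. strict_mono_on {..<r} p \<and> (\<forall>k<r. p k < Suc i) \<and>
        (\<forall>a<Suc i. \<forall>b<n. W $$ (a, b) = (if b < r \<and> a = p b then 1 else 0))"
      using p(1) by blast
    then show ?thesis
      unfolding res unfolding leup_invariant_def st Let_def prod.case m_def[symmetric] n_def[symmetric]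
      using L W U P A rn Lid Uid W0 by auto
  next
    case (Some c)
    then have c: "r \<le> c" "c < n" "W $$ (i, c) \<noteq> 0" by (auto simp: find_Some_iff)
    define s where "s = Transposition.transpose r c"
    have ss: "s (s b) = b" for b by (simp add: s_def)
    have s_n: "s b < n \<longleftrightarrow> b < n" and s_r: "s b < r \<longleftrightarrow> b < r" for b
      using c by (auto simp: s_def transpose_def)
    have s_id: "s b = b" if "b < r" for b
      using c that by (auto simp: s_def transpose_def)
    have s_eq: "s a = s b \<longleftrightarrow> a = b" for a b using ss by metis
    have sr: "s r = c" by (simp add: s_def)
    have s_perm: "s permutes {..<n}"
      unfolding s_def using c by (intro permutes_swap_id) auto
    define W1 where "W1 = mat m n (\<lambda>(a, b). W $$ (a, s b))"
    define U1 where "U1 = mat n n (\<lambda>(a, b). U $$ (s a, s b))"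
    define P1 where "P1 = mat n n (\<lambda>(a, b). P $$ (s a, b))"
    define L2 where "L2 = mat m m (\<lambda>(a, b). 
      if b = i \<and> i < a then W1 $$ (a, r) / W1 $$ (i, r) else L $$ (a, b))"
    define U2 where "U2 = mat n n (\<lambda>(a, b). if a = r \<and> r \<le> b then W1 $$ (i, b) else U1 $$ (a, b))"
    define W2 where "W2 = mat m n (\<lambda>(a, b).
      if a < i then W1 $$ (a, b) else if a = i then delta r b
      else W1 $$ (a, b) - L2 $$ (a, i) * W1 $$ (i, b))"
    have res: "result (leup_step i st) = (L2, W2, U2, P1, Suc r)"
      using Some unfolding W2_def L2_def U2_def P1_def W1_def U1_def s_def
      by (simp add: st leup_step_def Let_def dW if_distrib[of result] split_beta cong: if_cong)
    have carr [simp]: "W1 \<in> carrier_mat m n" "U1 \<in> carrier_mat n n" "P1 \<in> carrier_mat n n"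
      "L2 \<in> carrier_mat m m" "U2 \<in> carrier_mat n n" "W2 \<in> carrier_mat m n"
      by (simp_all add: W1_def U1_def P1_def L2_def U2_def W2_def)
    have dims [simp]: "dim_row W1 = m" "dim_col W1 = n" "dim_row U1 = n" "dim_col U1 = n"
      "dim_row P1 = n" "dim_col P1 = n"
      "dim_row L2 = m" "dim_col L2 = m" "dim_row U2 = n" "dim_col U2 = n"
      "dim_row W2 = m" "dim_col W2 = n"
      by (simp_all add: W1_def U1_def P1_def L2_def U2_def W2_def)
    have W1: "W1 $$ (a, b) = W $$ (a, s b)" if "a < m" "b < n" for a b
      using that by (simp add: W1_def)
    have U1: "U1 $$ (a, b) = U $$ (s a, s b)" if "a < n" "b < n" for a b
      using that by (simp add: U1_def)
    have piv: "W1 $$ (i, r) \<noteq> 0" using c im by (simp add: W1 sr)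
    have U1id: "U1 $$ (a, b) = delta a b" if "a < n" "b < n" "r \<le> a" for a b
    proof -
      have "r \<le> s a" using s_r[of a] that by linarith
      then show ?thesis using that Uid s_n by (simp add: U1 s_eq)
    qed
    have W1_0: "W1 $$ (a, b) = 0" if "a < m" "b < r" "i \<le> a" for a b
      using that W0 rn by (simp add: W1 s_id)

    \<comment> \<open>The exchange of the columns \<open>r\<close> and \<open>c\<close>.\<close>
    define S :: "'a mat" where "S = mat n n (\<lambda>(a, b). delta a (s b))"
    have S: "S \<in> carrier_mat n n" by (simp add: S_def)
    have mult_S: "B * S = mat k n (\<lambda>(a, b). B $$ (a, s b))" if "B \<in> carrier_mat k n" for B k
    proof (rule eq_matI)
      fix a b assume "a < dim_row (mat k n (\<lambda>(a, b). B $$ (a, s b)))"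
        "b < dim_col (mat k n (\<lambda>(a, b). B $$ (a, s b)))"
      then have ab: "a < k" "b < n" by auto
      have "(B * S) $$ (a, b) = (\<Sum>l<n. B $$ (a, l) * S $$ (l, b))"
        by (rule index_mult_sum[OF that S ab])
      also have "\<dots> = (\<Sum>l<n. if l = s b then B $$ (a, l) else 0)"
        using ab by (intro sum.cong refl) (simp add: S_def)
      finally show "(B * S) $$ (a, b) = mat k n (\<lambda>(a, b). B $$ (a, s b)) $$ (a, b)"
        using ab s_n by simp
    qed (use that S in auto)
    have S_mult: "S * B = mat n k (\<lambda>(a, b). B $$ (s a, b))" if "B \<in> carrier_mat n k" for B k
    proof (rule eq_matI)
      fix a b assume "a < dim_row (mat n k (\<lambda>(a, b). B $$ (s a, b)))"
        "b < dim_col (mat n k (\<lambda>(a, b). B $$ (s a, b)))"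
      then have ab: "a < n" "b < k" by auto
      have sa: "(a = s l) \<longleftrightarrow> l = s a" for l using ss by metis
      have "(S * B) $$ (a, b) = (\<Sum>l<n. S $$ (a, l) * B $$ (l, b))"
        by (rule index_mult_sum[OF S that ab])
      also have "\<dots> = (\<Sum>l<n. if l = s a then B $$ (l, b) else 0)"
        using ab sa by (intro sum.cong refl) (simp add: S_def)
      finally show "(S * B) $$ (a, b) = mat n k (\<lambda>(a, b). B $$ (s a, b)) $$ (a, b)"
        using ab s_n by simp
    qed (use that S in auto)
    have SS: "S * (S * B) = B" if "B \<in> carrier_mat n k" for B k
    proof -
      have "S * (S * B) = mat n k (\<lambda>(a, b). (S * B) $$ (s a, b))"
        using that S by (intro S_mult) auto
      also have "\<dots> = B" using that s_n ss by (intro eq_matI) (auto simp: S_mult[OF that])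
      finally show ?thesis .
    qed
    have W1_S: "W1 = W * S" by (simp add: mult_S[OF W] W1_def)
    have P1_S: "P1 = S * P" by (simp add: S_mult[OF cP] P1_def)
    have U1_S: "U1 = S * (U * S)"
      using cU S by (subst S_mult[of _ n]) (auto simp: mult_S[OF cU] U1_def s_n intro!: eq_matI)
    have swap: "W1 * (U1 * P1) = W * (U * P)"
    proof -
      have "W1 * (U1 * P1) = W * (S * (S * (U * (S * (S * P)))))"
        unfolding W1_S U1_S P1_S using W S cU cP
        by (simp add: assoc_mult_mat[of _ m n _ n _ n] assoc_mult_mat[of _ n n _ n _ n])
      then show ?thesis using S cU cP by (simp add: SS[of _ n])
    qed

    \<comment> \<open>The elimination below the pivot at row \<open>i\<close> and column \<open>r\<close>.\<close>
    define G where "G = mat m m (\<lambda>(a, b). 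
      if b = i \<and> i < a then W1 $$ (a, r) / W1 $$ (i, r) else delta a b)"
    define V where "V = mat n n (\<lambda>(a, b). 
      if a = r then (if r \<le> b then W1 $$ (i, b) else 0) else delta a b)"
    have G: "G \<in> carrier_mat m m" and V: "V \<in> carrier_mat n n" by (simp_all add: G_def V_def)
    have L2_G: "L2 = L * G"
    proof (rule eq_matI)
      fix a b assume "a < dim_row (L * G)" "b < dim_col (L * G)"
      then have ab: "a < m" "b < m" using cL G by auto
      have "(L * G) $$ (a, b) = (\<Sum>l<m. L $$ (a, l) * G $$ (l, b))"
        using cL G ab by (rule index_mult_sum)
      also have "\<dots> = L2 $$ (a, b)"
      proof (cases "b = i")
        case True
        have "(\<Sum>l<m. L $$ (a, l) * G $$ (l, b)) = (\<Sum>l<m. if l = a then G $$ (a, i) else 0)"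
        proof (intro sum.cong refl)
          fix l assume "l \<in> {..<m}"
          then show "L $$ (a, l) * G $$ (l, b) = (if l = a then G $$ (a, i) else 0)"
            using ab True Lid[of a l] by (cases "i \<le> l") (auto simp: G_def)
        qed
        then show ?thesis using ab True Lid[of a i] by (auto simp: G_def L2_def)
      next
        case False
        have "(\<Sum>l<m. L $$ (a, l) * G $$ (l, b)) = (\<Sum>l<m. if l = b then L $$ (a, b) else 0)"
          using False ab by (intro sum.cong refl) (auto simp: G_def)
        then show ?thesis using False ab by (simp add: L2_def)
      qed
      finally show "L2 $$ (a, b) = (L * G) $$ (a, b)" by simp
    qed (use cL G carr in auto)
    have U2_V: "U2 = V * U1"
    proof (rule eq_matI)
      fix a b assume "a < dim_row (V * U1)" "b < dim_col (V * U1)"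
      then have ab: "a < n" "b < n" using V carr by auto
      have "(V * U1) $$ (a, b) = (\<Sum>l<n. V $$ (a, l) * U1 $$ (l, b))"
        using V carr(2) ab by (rule index_mult_sum)
      also have "\<dots> = U2 $$ (a, b)"
      proof (cases "a = r")
        case True
        have "(\<Sum>l<n. V $$ (a, l) * U1 $$ (l, b)) = (\<Sum>l<n. if l = b then V $$ (r, b) else 0)"
        proof (intro sum.cong refl)
          fix l assume "l \<in> {..<n}"
          then show "V $$ (a, l) * U1 $$ (l, b) = (if l = b then V $$ (r, b) else 0)"
            using ab True U1id[of l b] by (cases "r \<le> l") (auto simp: V_def)
        qed
        then show ?thesis using ab True U1id[of r b] by (auto simp: V_def U2_def)
      next
        case False
        have "(\<Sum>l<n. V $$ (a, l) * U1 $$ (l, b)) = (\<Sum>l<n. if l = a then U1 $$ (a, b) else 0)"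
          using False ab by (intro sum.cong refl) (auto simp: V_def)
        then show ?thesis using False ab by (simp add: U2_def)
      qed
      finally show "U2 $$ (a, b) = (V * U1) $$ (a, b)" by simp
    qed (use V carr in auto)
    have W2r: "W2 $$ (a, r) = 0" if "a < m" "a \<noteq> i" for a
      using that c im piv Wp[of a c] by (auto simp: W2_def L2_def W1 sr)
    have W2V: "(W2 * V) $$ (a, b) = (if a = i then W1 $$ (i, b) else W2 $$ (a, b))"
      if ab: "a < m" "b < n" for a b
    proof -
      have "(W2 * V) $$ (a, b) = (\<Sum>l<n. W2 $$ (a, l) * V $$ (l, b))"
        using carr(6) V ab by (rule index_mult_sum)
      also have "\<dots> = (if a = i then W1 $$ (i, b) else W2 $$ (a, b))"
      proof (cases "a = i")
        case True
        have "(\<Sum>l<n. W2 $$ (a, l) * V $$ (l, b)) = (\<Sum>l<n. if l = r then V $$ (r, b) else 0)"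
          using True ab by (intro sum.cong refl) (auto simp: W2_def)
        then show ?thesis using True c ab W1_0[OF im, of b] by (auto simp: V_def)
      next
        case False
        have "(\<Sum>l<n. W2 $$ (a, l) * V $$ (l, b)) = (\<Sum>l<n. if l = b then W2 $$ (a, b) else 0)"
        proof (intro sum.cong refl)
          fix l assume "l \<in> {..<n}"
          then show "W2 $$ (a, l) * V $$ (l, b) = (if l = b then W2 $$ (a, b) else 0)"
            using ab False W2r[of a] by (cases "l = r") (auto simp: V_def)
        qed
        then show ?thesis using False ab by simp
      qed
      finally show ?thesis .
    qed
    have W1_G: "W1 = G * (W2 * V)"
    proof (rule eq_matI)
      fix a b assume "a < dim_row (G * (W2 * V))" "b < dim_col (G * (W2 * V))"
      then have ab: "a < m" "b < n" using G V by auto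
      have cQ: "W2 * V \<in> carrier_mat m n" using V by auto
      have "(G * (W2 * V)) $$ (a, b) = (\<Sum>l<m. G $$ (a, l) * (W2 * V) $$ (l, b))"
        using G cQ ab by (rule index_mult_sum)
      also have "\<dots> = (\<Sum>l<m. (if l = a then (W2 * V) $$ (a, b) else 0) +
          (if l = i then (if i < a then L2 $$ (a, i) * (W2 * V) $$ (i, b) else 0) else 0))"
        using ab im by (intro sum.cong refl) (auto simp: G_def L2_def)
      also have "\<dots> = (W2 * V) $$ (a, b) + (if i < a then L2 $$ (a, i) * (W2 * V) $$ (i, b) else 0)"
        using ab im by (simp add: sum.distrib)
      also have "\<dots> = W1 $$ (a, b)"
        using ab im by (auto simp: W2V) (auto simp: W2_def)
      finally show "W1 $$ (a, b) = (G * (W2 * V)) $$ (a, b)" by simp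
    qed (use G V carr in auto)
    have "A = L * (W1 * (U1 * P1))"
      unfolding A swap using cL W cU cP
      by (simp add: assoc_mult_mat[of _ m n _ n _ n] assoc_mult_mat[of _ m m _ n _ n])
    also have "W1 * (U1 * P1) = G * ((W2 * V) * (U1 * P1))"
      by (subst W1_G, rule assoc_mult_mat) (use G V carr(2,3,6) in auto)
    also have "(W2 * V) * (U1 * P1) = W2 * (V * (U1 * P1))"
      by (rule assoc_mult_mat) (use V carr(2,3,6) in auto)
    also have "V * (U1 * P1) = U2 * P1"
      unfolding U2_V by (rule assoc_mult_mat[symmetric]) (use V carr(2,3) in auto)
    also have "L * (G * (W2 * (U2 * P1))) = L2 * (W2 * (U2 * P1))"
      unfolding L2_G by (rule assoc_mult_mat[symmetric]) (use cL G carr(3,5,6) in auto)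
    also have "\<dots> = L2 * W2 * (U2 * P1)"
      by (rule assoc_mult_mat[symmetric]) (use carr(3-6) in auto)
    also have "\<dots> = L2 * W2 * U2 * P1"
      by (rule assoc_mult_mat[symmetric]) (use carr(3-6) in auto)
    finally have A2: "A = L2 * W2 * U2 * P1" .

    have "is_L m L2" using L unfolding is_L_iff by (auto simp: L2_def)
    moreover have "is_U n U2"
      unfolding is_U_iff
    proof (intro conjI allI impI)
      show "U2 $$ (a, b) = 0" if "a < n" "b < n" "b < a" for a b
      proof (cases "r \<le> a")
        case True
        then show ?thesis using that U1id[of a b] by (auto simp: U2_def)
      next
        case False
        then show ?thesis using that U by (auto simp: U2_def U1 s_id is_U_iff)
      qed
      show "U2 $$ (a, a) \<noteq> 0" if "a < n" for a
        using that piv U s_n by (auto simp: U2_def U1 is_U_iff)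
    qed simp
    moreover have "is_P n P1"
    proof -
      from P obtain \<pi> where \<pi>: "\<pi> permutes {..<n}"
        and ind: "\<And>i j. i < n \<Longrightarrow> j < n \<Longrightarrow> P $$ (i, j) = delta i (\<pi> j)"
        by (auto simp: is_P_iff)
      have "P1 $$ (a, b) = delta a ((s \<circ> \<pi>) b)" if "a < n" "b < n" for a b
      proof -
        have "s a = \<pi> b \<longleftrightarrow> a = s (\<pi> b)" using ss by metis
        then show ?thesis using that ind s_n by (simp add: P1_def)
      qed
      moreover have "(s \<circ> \<pi>) permutes {..<n}" by (intro permutes_compose \<pi> s_perm)
      ultimately show ?thesis unfolding is_P_iff using carr(3) by blast
    qed
    moreover have "Suc r \<le> n" using c by linarith
    moreover have "L2 $$ (a, b) = delta a b" if "a < m" "b < m" "Suc i \<le> b" for a b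
      using that Lid[of a b] by (auto simp: L2_def)
    moreover have "U2 $$ (a, b) = delta a b" if "a < n" "b < n" "Suc r \<le> a" for a b
      using that U1id[of a b] by (auto simp: U2_def)
    moreover have "\<exists>p. strict_mono_on {..<Suc r} p \<and> (\<forall>k<Suc r. p k < Suc i) \<and>
        (\<forall>a<Suc i. \<forall>b<n. W2 $$ (a, b) = (if b < Suc r \<and> a = p b then 1 else 0))"
    proof (intro exI[of _ "p(r := i)"] conjI allI impI)
      show "strict_mono_on {..<Suc r} (p(r := i))"
        using p by (auto simp: strict_mono_on_def less_Suc_eq)
      show "(p(r := i)) k < Suc i" if "k < Suc r" for k
        using that p(2)[of k] by auto
      show "W2 $$ (a, b) = (if b < Suc r \<and> a = (p(r := i)) b then 1 else 0)"
        if "a < Suc i" "b < n" for a b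
      proof (cases "a = i")
        case True
        then show ?thesis using that im p(2)[of b] by (auto simp: W2_def)
      next
        case False
        then have "a < i" using that by auto
        then show ?thesis
          using that im s_n s_r[of b] s_id[of b] by (auto simp: W2_def W1 Wp)
      qed
    qed
    moreover have "W2 $$ (a, b) = 0" if "a < m" "b < Suc r" "Suc i \<le> a" for a b
    proof (cases "b = r")
      case True
      then show ?thesis using that by (auto intro: W2r)
    next
      case False
      then show ?thesis using that c im W1_0[of a b] W1_0[of i b] by (auto simp: W2_def)
    qed
    ultimately show ?thesis
      unfolding res unfolding leup_invariant_def Let_def prod.case m_def[symmetric] n_def[symmetric]
      using A2 carr(6) by blast
  qed
qed

lemma EL_shapeI:
  assumes E: "E \<in> carrier_mat m n" and p: "strict_mono_on {..<r} p"
    and rn: "r \<le> n" and pm: "\<And>k. k < r \<Longrightarrow> p k < m"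
    and ind: "\<And>a b. a < m \<Longrightarrow> b < n \<Longrightarrow> E $$ (a, b) = (if b < r \<and> a = p b then 1 else 0)"
  shows "EL_shape (E :: 'a::field mat)"
proof -
  have p_eq: "b = b'" if "b < r" "b' < r" "p b = p b'" for b b'
    using strict_mono_on_imp_inj_on[OF p] that by (auto simp: inj_on_def)
  have nz: "E $$ (a, b) \<noteq> 0 \<longleftrightarrow> b < r \<and> a = p b" if "a < m" "b < n" for a b
    using ind[OF that] by simp
  have "pivot_mat E"
    unfolding pivot_mat_def using E p_eq nz ind by auto
  moreover have "i1 < i2" if "i1 < m" "i2 < m" "j1 < n" "j2 < n" "E $$ (i1, j1) \<noteq> 0"
    "E $$ (i2, j2) \<noteq> 0" "j1 < j2" for i1 i2 j1 j2
    using that p nz by (auto simp: strict_mono_on_def)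
  moreover have "E $$ (i, k) = 0" if "j < n" "k < n" "j < k" "\<forall>i<m. E $$ (i, j) = 0" "i < m" for i j k
  proof -
    have "\<not> j < r" using nz[of "p j" j] pm[of j] that by auto
    then show ?thesis using that nz[of i k] by auto
  qed
  ultimately show ?thesis unfolding EL_shape_def using E by auto
qed

lemma leup_timed_correct:
  fixes A :: "'a::field mat"
  assumes "result (leup_timed A) = (L, E, U, P)"
  shows "is_LEUP A L E U P"
proof -
  let ?m = "dim_row A" and ?n = "dim_col A"
  let ?st0 = "(1\<^sub>m ?m, A, 1\<^sub>m ?n, 1\<^sub>m ?n, 0) :: 'a leup_state"
  have "leup_invariant A 0 ?st0"
    by (auto simp: leup_invariant_def is_L_one is_U_one is_P_one Let_def strict_mono_on_def)
  then have "leup_invariant A ?m (result (fold_timed leup_step [0..<?m] ?st0))"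
    by (rule fold_timed_upt_invariant) (rule leup_invariant_step)
  moreover obtain r where "result (fold_timed leup_step [0..<?m] ?st0) = (L, E, U, P, r)"
    using assms by (cases "result (fold_timed leup_step [0..<?m] ?st0)")
      (auto simp: leup_timed_def)
  ultimately have inv: "leup_invariant A ?m (L, E, U, P, r)" by simp
  then obtain p where *: "is_L ?m L" "E \<in> carrier_mat ?m ?n" "is_U ?n U" "is_P ?n P"
    "A = L * E * U * P" "r \<le> ?n" "strict_mono_on {..<r} p" "\<forall>k<r. p k < ?m"
    "\<forall>a<?m. \<forall>b<?n. E $$ (a, b) = (if b < r \<and> a = p b then 1 else 0)"
    unfolding leup_invariant_def Let_def prod.case by blast
  then have "EL_shape E" by (intro EL_shapeI[of E ?m ?n r p]) auto
  with * show ?thesis by (simp add: is_LEUP_def)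
qed

lemma puel_timed_correct:
  fixes A :: "'a::field mat"
  assumes "result (puel_timed A) = (P, U, E, L)"
  shows "is_PUEL A P U E L"
proof -
  let ?m = "dim_row A" and ?n = "dim_col A"
  obtain L0 E0 U0 P0 where r: "result (leup_timed (antitranspose A)) = (L0, E0, U0, P0)"
    by (cases "result (leup_timed (antitranspose A))") auto
  then have eqs: "P = antitranspose P0" "U = antitranspose U0" "E = antitranspose E0"
    "L = antitranspose L0"
    using assms by (auto simp: puel_timed_def)
  from leup_timed_correct[OF r] have *: "is_L ?n L0" "E0 \<in> carrier_mat ?n ?m" "EL_shape E0"
    "is_U ?m U0" "is_P ?m P0" "antitranspose A = L0 * E0 * U0 * P0"
    by (auto simp: is_LEUP_def)
  have c: "L0 \<in> carrier_mat ?n ?n" "U0 \<in> carrier_mat ?m ?m" "P0 \<in> carrier_mat ?m ?m"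
    using * by (auto simp: is_L_iff is_U_iff is_P_iff)
  have "A = antitranspose (L0 * E0 * U0 * P0)"
    by (metis *(6) antitranspose_antitranspose)
  also have "\<dots> = P * (U * (E * L))"
    using c *(2) unfolding eqs
    by (simp add: antitranspose_mult[of _ ?n ?m _ ?m] antitranspose_mult[of _ ?n ?n _ ?m])
  also have "\<dots> = P * U * E * L"
    using c *(2) unfolding eqs
    by (simp add: assoc_mult_mat[of _ ?m ?m _ ?m _ ?n] assoc_mult_mat[of _ ?m ?m _ ?n _ ?n])
  finally show ?thesis
    using * unfolding is_PUEL_def eqs
    by (simp add: EL_hat_shape_iff antitranspose_is_L antitranspose_is_U antitranspose_is_P)
qed

section \<open>Changes of basis and runs of the algorithm\<close>

lemma change_basis_simps [simp]:
  "nedges (change_basis v g h R) = nedges R" "vdim (change_basis v g h R) = vdim R"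
  "dir (change_basis v g h R) = dir R"
  "src (change_basis v g h R) = src R" "tgt (change_basis v g h R) = tgt R"
  by (simp_all add: change_basis_def src_def[abs_def] tgt_def[abs_def])

lemma edge_mat_change_basis:
  "edge_mat (change_basis v g h R) i =
     (if i < nedges R \<and> tgt R i = v then g * edge_mat R i
      else if i < nedges R \<and> src R i = v then edge_mat R i * h
      else edge_mat R i)"
  by (simp add: change_basis_def)

lemma src_neq_tgt [simp]: "src R i \<noteq> tgt R i" "tgt R i \<noteq> src R i"
  by (auto simp: src_def tgt_def split: direction.splits)

lemma src_le [simp]: "i < nedges R \<Longrightarrow> src R i \<le> nedges R"
  and tgt_le [simp]: "i < nedges R \<Longrightarrow> tgt R i \<le> nedges R"
  by (auto simp: src_def tgt_def split: direction.splits)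

lemma zigzag_repD:
  "zigzag_rep R \<Longrightarrow> i < nedges R \<Longrightarrow> edge_mat R i \<in> carrier_mat (vdim R (tgt R i)) (vdim R (src R i))"
  by (simp add: zigzag_rep_def)

lemma invertible_one_mat: "invertible_mat (1\<^sub>m n :: 'a::field mat)"
  using invertible_mat_iff_det[of "1\<^sub>m n :: 'a mat" n] by simp

text \<open>
The isomorphism is \<open>g\<close> at the vertex \<open>v\<close> and the identity elsewhere.
\<close>

lemma change_basis_isomorphic:
  fixes R :: "'a::field zigzag"
  assumes R: "zigzag_rep R" and g: "g \<in> carrier_mat (vdim R v) (vdim R v)" and gh: "inverse_mats g h"
  shows "isomorphic R (change_basis v g h R)"
proof -
  let ?S = "change_basis v g h R"
  note gh' = inverse_matsD[OF gh disjI1[OF g]]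
  have rep: "zigzag_rep ?S"
    unfolding zigzag_rep_def
  proof (intro allI impI)
    fix i assume "i < nedges ?S"
    then show "edge_mat ?S i \<in> carrier_mat (vdim ?S (tgt ?S i)) (vdim ?S (src ?S i))"
      using zigzag_repD[OF R, of i] gh'
      by (auto simp: edge_mat_change_basis intro: mult_carrier_mat)
  qed
  define f where "f w = (if w = v then g else 1\<^sub>m (vdim R w))" for w
  have f: "f w \<in> carrier_mat (vdim R w) (vdim R w)" "invertible_mat (f w)" for w
    using g inverse_mats_invertible[OF gh] invertible_one_mat by (auto simp: f_def)
  have "edge_mat ?S i * f (src R i) = f (tgt R i) * edge_mat R i" if i: "i < nedges R" for i
  proof -
    note M = zigzag_repD[OF R i]
    consider "tgt R i = v" "src R i \<noteq> v" | "src R i = v" "tgt R i \<noteq> v" | "src R i \<noteq> v" "tgt R i \<noteq> v"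
      using src_neq_tgt by metis
    then show ?thesis
    proof cases
      case 1
      then show ?thesis using M gh' i by (simp add: edge_mat_change_basis f_def)
    next
      case 2
      have "edge_mat R i * h * g = edge_mat R i * (h * g)"
        using M gh' 2 by (intro assoc_mult_mat) auto
      then show ?thesis using M gh' i 2 by (simp add: edge_mat_change_basis f_def)
    next
      case 3
      then show ?thesis using M i by (simp add: edge_mat_change_basis f_def)
    qed
  qed
  then show ?thesis
    unfolding isomorphic_def using R rep f by auto
qed

lemma isomorphic_refl:
  fixes R :: "'a::field zigzag"
  assumes "zigzag_rep R"
  shows "isomorphic R R"
proof -
  have "edge_mat R i * 1\<^sub>m (vdim R (src R i)) = 1\<^sub>m (vdim R (tgt R i)) * edge_mat R i"
    if "i < nedges R" for i
    using zigzag_repD[OF assms that] by simp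
  then show ?thesis
    unfolding isomorphic_def using assms invertible_one_mat
    by (auto intro!: exI[of _ "\<lambda>w. 1\<^sub>m (vdim R w)"])
qed

lemma isomorphic_zigzag_rep: "isomorphic R S \<Longrightarrow> zigzag_rep S"
  by (simp add: isomorphic_def)

lemma isomorphic_trans:
  fixes R :: "'a::field zigzag"
  assumes RS: "isomorphic R S" and ST: "isomorphic S T"
  shows "isomorphic R T"
proof -
  let ?n = "nedges R"
  from RS obtain f where n: "nedges S = ?n" and d: "\<And>i. i \<le> ?n \<Longrightarrow> vdim S i = vdim R i"
    and dir: "\<And>i. i < ?n \<Longrightarrow> dir S i = dir R i"
    and f: "\<And>i. i \<le> ?n \<Longrightarrow> f i \<in> carrier_mat (vdim R i) (vdim R i) \<and> invertible_mat (f i)"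
    and fe: "\<And>i. i < ?n \<Longrightarrow> edge_mat S i * f (src R i) = f (tgt R i) * edge_mat R i"
    and reps: "zigzag_rep R" "zigzag_rep S"
    by (auto simp: isomorphic_def)
  from ST obtain g where n': "nedges T = ?n" and d': "\<And>i. i \<le> ?n \<Longrightarrow> vdim T i = vdim R i"
    and dir': "\<And>i. i < ?n \<Longrightarrow> dir T i = dir R i"
    and g: "\<And>i. i \<le> ?n \<Longrightarrow> g i \<in> carrier_mat (vdim R i) (vdim R i) \<and> invertible_mat (g i)"
    and ge: "\<And>i. i < ?n \<Longrightarrow> edge_mat T i * g (src S i) = g (tgt S i) * edge_mat S i"
    and rep: "zigzag_rep T"
    using n d dir by (auto simp: isomorphic_def)
  have "g i * f i \<in> carrier_mat (vdim R i) (vdim R i) \<and> invertible_mat (g i * f i)" if "i \<le> ?n" for i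
  proof -
    have c: "g i \<in> carrier_mat (vdim R i) (vdim R i)" "f i \<in> carrier_mat (vdim R i) (vdim R i)"
      "invertible_mat (g i)" "invertible_mat (f i)"
      using f g that by auto
    then show ?thesis
      using det_mult[OF c(1,2)] invertible_mat_iff_det[OF c(1)] invertible_mat_iff_det[OF c(2)]
        invertible_mat_iff_det[OF mult_carrier_mat[OF c(1,2)]] by auto
  qed
  moreover have "edge_mat T i * (g (src R i) * f (src R i)) = g (tgt R i) * f (tgt R i) * edge_mat R i"
    if i: "i < ?n" for i
  proof -
    have st: "src S i = src R i" "tgt S i = tgt R i" "src T i = src R i" "tgt T i = tgt R i"
      using dir dir' i by (auto simp: src_def tgt_def)
    let ?s = "vdim R (src R i)" and ?t = "vdim R (tgt R i)"
    have c: "edge_mat R i \<in> carrier_mat ?t ?s" "edge_mat S i \<in> carrier_mat ?t ?s"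
      "edge_mat T i \<in> carrier_mat ?t ?s"
      using zigzag_repD[OF reps(1) i] zigzag_repD[OF reps(2), of i] zigzag_repD[OF rep, of i]
        i n n' d d' st by simp_all
    have c': "f (src R i) \<in> carrier_mat ?s ?s" "f (tgt R i) \<in> carrier_mat ?t ?t"
      "g (src R i) \<in> carrier_mat ?s ?s" "g (tgt R i) \<in> carrier_mat ?t ?t"
      using f g i by simp_all
    have "edge_mat T i * (g (src R i) * f (src R i)) = (edge_mat T i * g (src R i)) * f (src R i)"
      using c c' by (intro assoc_mult_mat[symmetric]) auto
    also have "edge_mat T i * g (src R i) = g (tgt R i) * edge_mat S i"
      using ge[OF i] st by simp
    also have "g (tgt R i) * edge_mat S i * f (src R i) = g (tgt R i) * (edge_mat S i * f (src R i))"
      using c c' by (intro assoc_mult_mat) auto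
    also have "edge_mat S i * f (src R i) = f (tgt R i) * edge_mat R i" by (rule fe[OF i])
    also have "g (tgt R i) * (f (tgt R i) * edge_mat R i) = g (tgt R i) * f (tgt R i) * edge_mat R i"
      using c c' by (intro assoc_mult_mat[symmetric]) auto
    finally show ?thesis .
  qed
  ultimately show ?thesis
    unfolding isomorphic_def using reps rep n' d' dir' by (auto intro!: exI[of _ "\<lambda>i. g i * f i"])
qed

definition edge_shape :: "'a::field zigzag \<Rightarrow> nat \<Rightarrow> 'a mat \<Rightarrow> bool" where
  "edge_shape R i E \<longleftrightarrow> E \<in> carrier_mat (vdim R (tgt R i)) (vdim R (src R i)) \<and>
     (case dir R i of Leftward \<Rightarrow> EL_shape E | Rightward \<Rightarrow> EL_hat_shape E)"

text \<open>
The form of an edge between the two passes.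
\<close>

definition half_reduced :: "'a::field zigzag \<Rightarrow> nat \<Rightarrow> 'a mat \<Rightarrow> bool" where
  "half_reduced R i E \<longleftrightarrow> edge_shape R i E \<and>
     (\<exists>L. case dir R i of
        Leftward \<Rightarrow> is_L (dim_row E) L \<and> edge_mat R i = L * E
      | Rightward \<Rightarrow> is_L (dim_col E) L \<and> edge_mat R i = E * L)"

lemma first_pass_rel_correct:
  fixes R :: "'a::field zigzag"
  assumes R: "zigzag_rep R" and i: "i < nedges R" and step: "first_pass_rel i E R R'"
  shows "isomorphic R R'" "nedges R' = nedges R" "vdim R' = vdim R" "dir R' = dir R"
    "half_reduced R' i E" "\<And>j. j < i \<Longrightarrow> edge_mat R' j = edge_mat R j"
proof -
  note M = zigzag_repD[OF R i]
  have "isomorphic R R' \<and> nedges R' = nedges R \<and> vdim R' = vdim R \<and> dir R' = dir R \<and>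
    half_reduced R' i E \<and> (\<forall>j<i. edge_mat R' j = edge_mat R j)"
  proof (cases "dir R i")
    case Leftward
    then have st: "src R i = Suc i" "tgt R i = i" by (simp_all add: src_def tgt_def)
    from step Leftward obtain L U P h where LEUP: "is_LEUP (edge_mat R i) L E U P"
      and h: "inverse_mats (U * P) h" and R': "R' = change_basis (Suc i) (U * P) h R"
      by (auto simp: first_pass_rel_def)
    let ?m = "vdim R i" and ?n = "vdim R (Suc i)"
    from LEUP M have c: "L \<in> carrier_mat ?m ?m" "E \<in> carrier_mat ?m ?n" "U \<in> carrier_mat ?n ?n"
      "P \<in> carrier_mat ?n ?n" "is_L ?m L" "EL_shape E" "edge_mat R i = L * E * U * P"
      by (auto simp: is_LEUP_def is_L_def is_U_def is_P_def st)
    have UP: "U * P \<in> carrier_mat ?n ?n" using c by auto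
    note h' = inverse_matsD[OF h disjI1[OF UP]]
    have "edge_mat R i = (L * E) * (U * P)"
      unfolding c(7) using c by (intro assoc_mult_mat[of _ ?m ?n _ ?n _ ?n]) auto
    then have "edge_mat R i * h = (L * E) * (U * P) * h" by simp
    also have "\<dots> = (L * E) * ((U * P) * h)" using c h' UP by (intro assoc_mult_mat) auto
    finally have "edge_mat R i * h = L * E" using h' c by simp
    then have "edge_mat R' i = L * E" using i by (simp add: R' edge_mat_change_basis st)
    moreover have "edge_mat R' j = edge_mat R j" if "j < i" for j
      using that by (auto simp: R' edge_mat_change_basis src_def tgt_def split: direction.splits)
    moreover have "isomorphic R R'"
      unfolding R' using R UP h by (rule change_basis_isomorphic)
    ultimately show ?thesis
      using c Leftward st by (auto simp: half_reduced_def edge_shape_def R')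
  next
    case Rightward
    then have st: "src R i = i" "tgt R i = Suc i" by (simp_all add: src_def tgt_def)
    from step Rightward obtain L U P g where PUEL: "is_PUEL (edge_mat R i) P U E L"
      and g: "inverse_mats g (P * U)" and R': "R' = change_basis (Suc i) g (P * U) R"
      by (auto simp: first_pass_rel_def)
    let ?m = "vdim R (Suc i)" and ?n = "vdim R i"
    from PUEL M have c: "L \<in> carrier_mat ?n ?n" "E \<in> carrier_mat ?m ?n" "U \<in> carrier_mat ?m ?m"
      "P \<in> carrier_mat ?m ?m" "is_L ?n L" "EL_hat_shape E" "edge_mat R i = P * U * E * L"
      by (auto simp: is_PUEL_def is_L_def is_U_def is_P_def st)
    have PU: "P * U \<in> carrier_mat ?m ?m" using c by auto
    note g' = inverse_matsD[OF g disjI2[OF PU]]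
    have "edge_mat R i = (P * U) * (E * L)"
      unfolding c(7) using c by (intro assoc_mult_mat[of _ ?m ?m _ ?n _ ?n]) auto
    then have "g * edge_mat R i = g * ((P * U) * (E * L))" by simp
    also have "\<dots> = (g * (P * U)) * (E * L)"
      using c g' PU by (intro assoc_mult_mat[symmetric]) auto
    finally have "g * edge_mat R i = E * L" using g' c by simp
    then have "edge_mat R' i = E * L" using i by (simp add: R' edge_mat_change_basis st)
    moreover have "edge_mat R' j = edge_mat R j" if "j < i" for j
      using that by (auto simp: R' edge_mat_change_basis src_def tgt_def split: direction.splits)
    moreover have "isomorphic R R'"
      unfolding R' using R g'(1) g by (rule change_basis_isomorphic)
    ultimately show ?thesis
      using c Rightward st by (auto simp: half_reduced_def edge_shape_def R')
  qed
  then show "isomorphic R R'" "nedges R' = nedges R" "vdim R' = vdim R" "dir R' = dir R"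
    "half_reduced R' i E" "\<And>j. j < i \<Longrightarrow> edge_mat R' j = edge_mat R j"
    by blast+
qed

lemma second_pass_rel_correct:
  fixes R :: "'a::field zigzag"
  assumes R: "zigzag_rep R" and i: "i < nedges R" and E: "edge_shape R i E"
    and step: "second_pass_rel i E R R'"
  shows "isomorphic R R'" "nedges R' = nedges R" "vdim R' = vdim R" "dir R' = dir R"
    "edge_mat R' i = E" "\<And>j. Suc j \<noteq> i \<Longrightarrow> j \<noteq> i \<Longrightarrow> edge_mat R' j = edge_mat R j"
proof -
  let ?s = "vdim R (src R i)" and ?t = "vdim R (tgt R i)"
  have cE: "E \<in> carrier_mat ?t ?s" using E by (simp add: edge_shape_def)
  from step obtain L1 L2 where M: "edge_mat R i = L1 * E * L2"
    and s: "case dir R i of Leftward \<Rightarrow> \<exists>K g. is_L (dim_row E) K \<and> L1 * E * L2 = K * E \<and>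
            inverse_mats g K \<and> R' = change_basis i g K R
        | Rightward \<Rightarrow> \<exists>K h. is_L (dim_col E) K \<and> L1 * E * L2 = E * K \<and> inverse_mats K h \<and>
            R' = change_basis i K h R"
    by (auto simp: second_pass_rel_def)
  have "isomorphic R R' \<and> nedges R' = nedges R \<and> vdim R' = vdim R \<and> dir R' = dir R \<and>
    edge_mat R' i = E \<and> (\<forall>j. Suc j \<noteq> i \<longrightarrow> j \<noteq> i \<longrightarrow> edge_mat R' j = edge_mat R j)"
  proof (cases "dir R i")
    case Leftward
    then have st: "src R i = Suc i" "tgt R i = i" by (simp_all add: src_def tgt_def)
    from s Leftward M obtain K g where K: "is_L (dim_row E) K" and MK: "edge_mat R i = K * E"
      and g: "inverse_mats g K" and R': "R' = change_basis i g K R" by auto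
    have cK: "K \<in> carrier_mat ?t ?t" using K cE by (auto simp: is_L_def)
    note g' = inverse_matsD[OF g disjI2[OF cK]]
    have "g * edge_mat R i = (g * K) * E"
      unfolding MK using g' cE by (intro assoc_mult_mat[symmetric]) auto
    then have "edge_mat R' i = E" using i g' cE by (simp add: R' edge_mat_change_basis st)
    moreover have "edge_mat R' j = edge_mat R j" if "Suc j \<noteq> i" "j \<noteq> i" for j
      using that by (auto simp: R' edge_mat_change_basis src_def tgt_def split: direction.splits)
    moreover have "isomorphic R R'"
      unfolding R' using R g'(1)[unfolded st] g by (rule change_basis_isomorphic)
    ultimately show ?thesis by (auto simp: R')
  next
    case Rightward
    then have st: "src R i = i" "tgt R i = Suc i" by (simp_all add: src_def tgt_def)
    from s Rightward M obtain K h where K: "is_L (dim_col E) K" and MK: "edge_mat R i = E * K"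
      and h: "inverse_mats K h" and R': "R' = change_basis i K h R" by auto
    have cK: "K \<in> carrier_mat ?s ?s" using K cE by (auto simp: is_L_def)
    note h' = inverse_matsD[OF h disjI1[OF cK]]
    have "edge_mat R i * h = E * (K * h)"
      unfolding MK using h' cE by (intro assoc_mult_mat) auto
    then have "edge_mat R' i = E" using i h' cE by (simp add: R' edge_mat_change_basis st)
    moreover have "edge_mat R' j = edge_mat R j" if "Suc j \<noteq> i" "j \<noteq> i" for j
      using that by (auto simp: R' edge_mat_change_basis src_def tgt_def split: direction.splits)
    moreover have "isomorphic R R'"
      unfolding R' using R h'(1)[unfolded st] h by (rule change_basis_isomorphic)
    ultimately show ?thesis by (auto simp: R')
  qed
  then show "isomorphic R R'" "nedges R' = nedges R" "vdim R' = vdim R" "dir R' = dir R"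
    "edge_mat R' i = E" "\<And>j. Suc j \<noteq> i \<Longrightarrow> j \<noteq> i \<Longrightarrow> edge_mat R' j = edge_mat R j"
    by blast+
qed

definition same_quiver :: "'a zigzag \<Rightarrow> 'a zigzag \<Rightarrow> bool" where
  "same_quiver R S \<longleftrightarrow> nedges S = nedges R \<and> vdim S = vdim R \<and> dir S = dir R"

lemma same_quiver_refl: "same_quiver R R"
  by (simp add: same_quiver_def)

lemma same_quiver_simps:
  assumes "same_quiver R S"
  shows "nedges S = nedges R" "vdim S = vdim R" "dir S = dir R" "src S = src R" "tgt S = tgt R"
    "edge_shape S = edge_shape R"
  using assms
  by (auto simp: same_quiver_def fun_eq_iff src_def tgt_def edge_shape_def)

lemma half_reduced_cong:
  assumes "same_quiver R S" "edge_mat S i = edge_mat R i"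
  shows "half_reduced S i E \<longleftrightarrow> half_reduced R i E"
  using assms same_quiver_simps[OF assms(1)] by (simp add: half_reduced_def split: direction.split)

lemma first_pass_correct:
  fixes R :: "'a::field zigzag"
  assumes R: "zigzag_rep R" and X0: "X 0 = R"
    and step: "\<And>i. i < nedges R \<Longrightarrow> first_pass_rel i (E i) (X i) (X (Suc i))"
    and "k \<le> nedges R"
  shows "isomorphic R (X k) \<and> same_quiver R (X k) \<and> (\<forall>j<k. half_reduced (X k) j (E j))"
  using \<open>k \<le> nedges R\<close>
proof (induction k)
  case 0
  then show ?case using R by (simp add: X0 isomorphic_refl same_quiver_refl)
next
  case (Suc k)
  then have IH: "isomorphic R (X k)" "same_quiver R (X k)" "\<And>j. j < k \<Longrightarrow> half_reduced (X k) j (E j)"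
    by auto
  have rep: "zigzag_rep (X k)" using IH(1) by (rule isomorphic_zigzag_rep)
  have k: "k < nedges (X k)" using Suc.prems IH(2) by (simp add: same_quiver_simps)
  have "first_pass_rel k (E k) (X k) (X (Suc k))" using Suc.prems by (intro step) simp
  note c = first_pass_rel_correct[OF rep k this]
  have q: "same_quiver (X k) (X (Suc k))" using c by (simp add: same_quiver_def)
  have "half_reduced (X (Suc k)) j (E j)" if "j < Suc k" for j
    using that c(5) IH(3)[of j] half_reduced_cong[OF q, of j] c(6)[of j] by (cases "j = k") auto
  then show ?case
    using isomorphic_trans[OF IH(1) c(1)] IH(2) q by (auto simp: same_quiver_def)
qed

text \<open>
Once the second pass has reached the edge \<open>k\<close>, the edges from \<open>k\<close> on carry their shape matrices,
since a change of basis at vertex \<open>k\<close> affects edges \<open>k\<close> and \<open>k - 1\<close> only.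
\<close>

lemma rightward_initial_run_correct:
  fixes R :: "'a::field zigzag"
  assumes R: "zigzag_rep R" and run: "rightward_initial_run R B"
  shows "isomorphic R B" "\<And>j. j < nedges B \<Longrightarrow> edge_shape B j (edge_mat B j)"
proof -
  let ?n = "nedges R"
  from run obtain E X Y where X0: "X 0 = R"
    and fp: "\<And>i. i < ?n \<Longrightarrow> first_pass_rel i (E i) (X i) (X (Suc i))"
    and Yn: "Y ?n = X ?n"
    and sp: "\<And>i. i < ?n \<Longrightarrow> second_pass_rel i (E i) (Y (Suc i)) (Y i)"
    and B: "Y 0 = B"
    by (auto simp: rightward_initial_run_def)
  from first_pass_correct[OF R X0 fp order_refl]
  have X: "isomorphic R (X ?n)" "same_quiver R (X ?n)" "\<And>j. j < ?n \<Longrightarrow> edge_shape R j (E j)"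
    by (auto simp: half_reduced_def same_quiver_simps)
  have "isomorphic R (Y k) \<and> same_quiver R (Y k) \<and> (\<forall>j. k \<le> j \<and> j < ?n \<longrightarrow> edge_mat (Y k) j = E j)"
    if "k \<le> ?n" for k
    using that
  proof (induction k rule: inc_induct)
    case base
    then show ?case using X Yn by auto
  next
    case (step k)
    then have IH: "isomorphic R (Y (Suc k))" "same_quiver R (Y (Suc k))"
      "\<And>j. k < j \<Longrightarrow> j < ?n \<Longrightarrow> edge_mat (Y (Suc k)) j = E j" by auto
    have "edge_shape (Y (Suc k)) k (E k)" "k < nedges (Y (Suc k))"
      using X(3) step IH(2) by (simp_all add: same_quiver_simps)
    note c = second_pass_rel_correct[OF isomorphic_zigzag_rep[OF IH(1)] this(2,1) sp[OF step(2)]]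
    have "edge_mat (Y k) j = E j" if "k \<le> j" "j < ?n" for j
      using that c(5,6) IH(3) by (cases "j = k") auto
    then show ?case
      using isomorphic_trans[OF IH(1) c(1)] IH(2) c(2-4) by (auto simp: same_quiver_def)
  qed
  from this[of 0] have *: "isomorphic R B" "same_quiver R B" "\<And>j. j < ?n \<Longrightarrow> edge_mat B j = E j"
    by (simp_all add: B)
  show "isomorphic R B" by (fact *(1))
  show "edge_shape B j (edge_mat B j)" if "j < nedges B" for j
    using that X(3) * by (simp add: same_quiver_simps)
qed

text \<open>
The definition of a pivot matrix is symmetric under reflection, which swaps the conditions on rows and columns.
\<close>

lemma edge_shape_pivot:
  assumes "edge_shape R i E"
  shows "pivot_mat E"
proof (cases "dir R i")
  case Leftward
  then show ?thesis using assms by (simp add: edge_shape_def EL_shape_def)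
next
  case Rightward
  let ?F = "antitranspose E"
  let ?m = "dim_row E" and ?n = "dim_col E"
  have F: "EL_shape ?F" "?F \<in> carrier_mat ?n ?m"
    using assms Rightward by (auto simp: edge_shape_def EL_hat_shape_iff)
  have nz: "E $$ (i, j) = ?F $$ (?n - 1 - j, ?m - 1 - i)" if "i < ?m" "j < ?n" for i j
    using that by (subst antitranspose_index[of E ?m ?n]) auto
  show ?thesis
    unfolding pivot_mat_def
  proof (intro conjI allI impI; (elim conjE)?)
    show "E $$ (i, j) = 1" if "i < ?m" "j < ?n" "E $$ (i, j) \<noteq> 0" for i j
      using EL_shape_entry[OF F(2,1), of "?n - 1 - j" "?m - 1 - i"] nz that by simp
    show "j = j'" if "i < ?m" "j < ?n" "j' < ?n" "E $$ (i, j) \<noteq> 0" "E $$ (i, j') \<noteq> 0" for i j j'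
      using EL_shape_col[OF F(2,1), of "?n - 1 - j" "?n - 1 - j'" "?m - 1 - i"] nz that by simp
    show "i = i'" if "i < ?m" "i' < ?m" "j < ?n" "E $$ (i, j) \<noteq> 0" "E $$ (i', j) \<noteq> 0" for i i' j
      using EL_shape_row[OF F(2,1), of "?n - 1 - j" "?m - 1 - i" "?m - 1 - i'"] nz that by simp
  qed
qed

section \<open>Pivot matrices and barcodes\<close>

lemma offset_Suc: "offset R (Suc i) = offset R i + vdim R i"
  by (simp add: offset_def)

lemma offset_mono: "i \<le> j \<Longrightarrow> offset R i \<le> offset R j"
  by (induction rule: dec_induct) (auto simp: offset_Suc)

lemma vertex_of_bounds:
  assumes "a < total_dim R"
  shows "vertex_of R a \<le> nedges R" "offset R (vertex_of R a) \<le> a" "a < offset R (Suc (vertex_of R a))"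
    "a - offset R (vertex_of R a) < vdim R (vertex_of R a)"
proof -
  have *: "a < offset R (Suc (nedges R))" using assms by (simp add: total_dim_def)
  show "vertex_of R a \<le> nedges R" unfolding vertex_of_def by (rule Least_le) (rule *)
  show upper: "a < offset R (Suc (vertex_of R a))"
    unfolding vertex_of_def by (rule LeastI[of _ "nedges R"]) (rule *)
  show lower: "offset R (vertex_of R a) \<le> a"
  proof (cases "vertex_of R a")
    case 0
    then show ?thesis by (simp add: offset_def)
  next
    case (Suc w)
    then have "\<not> a < offset R (Suc w)"
      unfolding vertex_of_def using not_less_Least[of w "\<lambda>i. a < offset R (Suc i)"] by simp
    then show ?thesis by (simp add: Suc)
  qed
  show "a - offset R (vertex_of R a) < vdim R (vertex_of R a)"
    using upper lower by (simp add: offset_Suc)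
qed

lemma vertex_of_eqI:
  assumes "offset R i \<le> a" "a < offset R (Suc i)"
  shows "vertex_of R a = i"
  unfolding vertex_of_def
proof (rule Least_equality)
  fix j assume j: "a < offset R (Suc j)"
  show "i \<le> j"
  proof (rule ccontr)
    assume "\<not> i \<le> j"
    then have "offset R (Suc j) \<le> offset R i" by (intro offset_mono) simp
    then show False using j assms by simp
  qed
qed (rule assms)

lemma companion_carrier: "companion R \<in> carrier_mat (total_dim R) (total_dim R)"
  by (simp add: companion_def)

lemma edge_unique: "tgt R i = tgt R j \<Longrightarrow> src R i = src R j \<Longrightarrow> i = j"
  by (auto simp: src_def tgt_def split: direction.splits)

lemma companion_edge:
  assumes "a < total_dim R" "b < total_dim R" "i < nedges R"
    and "vertex_of R a = tgt R i" "vertex_of R b = src R i"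
  shows "companion R $$ (a, b) = edge_mat R i $$ (a - offset R (tgt R i), b - offset R (src R i))"
proof -
  have "(vertex_of R a = tgt R j \<and> vertex_of R b = src R j) \<longleftrightarrow> j = i" for j
    using assms edge_unique[of R i j] by auto
  then show ?thesis using assms(1-3) by (simp add: companion_def)
qed

lemma companion_no_edge:
  assumes "a < total_dim R" "b < total_dim R"
    and "\<And>i. i < nedges R \<Longrightarrow> vertex_of R a = tgt R i \<Longrightarrow> vertex_of R b \<noteq> src R i"
  shows "companion R $$ (a, b) = 0"
proof -
  have "(if vertex_of R a = tgt R i \<and> vertex_of R b = src R i
      then edge_mat R i $$ (a - offset R (tgt R i), b - offset R (src R i)) else 0) = 0"
    if "i < nedges R" for i
    using assms(3)[OF that] by presburger
  then show ?thesis using assms(1,2) by (simp add: companion_def)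
qed

text \<open>
Orientation is forgotten: a link points from a coordinate at vertex \<open>i\<close> to one at vertex \<open>i + 1\<close>, whichever
way the edge between them is directed.
\<close>

definition link :: "'a::comm_monoid_add zigzag \<Rightarrow> nat \<Rightarrow> nat \<Rightarrow> bool" where
  "link R x y \<longleftrightarrow> x < total_dim R \<and> y < total_dim R \<and> vertex_of R y = Suc (vertex_of R x) \<and>
     (case dir R (vertex_of R x) of
        Leftward \<Rightarrow> companion R $$ (x, y) \<noteq> 0
      | Rightward \<Rightarrow> companion R $$ (y, x) \<noteq> 0)"

lemma link_edge:
  assumes "link R x y"
  defines "i \<equiv> vertex_of R x"
  shows "i < nedges R"
    and "x = offset R i + (x - offset R i)" "x - offset R i < vdim R i"
    and "y = offset R (Suc i) + (y - offset R (Suc i))" "y - offset R (Suc i) < vdim R (Suc i)"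
    and "dir R i = Leftward \<Longrightarrow> edge_mat R i $$ (x - offset R i, y - offset R (Suc i)) \<noteq> 0"
    and "dir R i = Rightward \<Longrightarrow> edge_mat R i $$ (y - offset R (Suc i), x - offset R i) \<noteq> 0"
proof -
  have xy: "x < total_dim R" "y < total_dim R" "vertex_of R y = Suc i"
    using assms by (auto simp: link_def)
  show i: "i < nedges R" using vertex_of_bounds(1)[OF xy(2)] xy(3) by simp
  show "x = offset R i + (x - offset R i)" "x - offset R i < vdim R i"
    using vertex_of_bounds[OF xy(1)] by (simp_all add: i_def)
  show "y = offset R (Suc i) + (y - offset R (Suc i))" "y - offset R (Suc i) < vdim R (Suc i)"
    using vertex_of_bounds[OF xy(2)] by (simp_all add: xy(3))
  have vx: "vertex_of R x = i" by (simp add: i_def)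
  show "edge_mat R i $$ (x - offset R i, y - offset R (Suc i)) \<noteq> 0" if "dir R i = Leftward"
  proof -
    have "companion R $$ (x, y) \<noteq> 0" using assms(1) that by (simp add: link_def vx)
    then show ?thesis
      using companion_edge[OF xy(1,2) i] that by (simp add: vx xy(3) src_def tgt_def)
  qed
  show "edge_mat R i $$ (y - offset R (Suc i), x - offset R i) \<noteq> 0" if "dir R i = Rightward"
  proof -
    have "companion R $$ (y, x) \<noteq> 0" using assms(1) that by (simp add: link_def vx)
    then show ?thesis
      using companion_edge[OF xy(2,1) i] that by (simp add: vx xy(3) src_def tgt_def)
  qed
qed

lemma pivot_matD:
  assumes "pivot_mat E" "E \<in> carrier_mat m n"
  shows "\<And>i j. i < m \<Longrightarrow> j < n \<Longrightarrow> E $$ (i, j) \<noteq> 0 \<Longrightarrow> E $$ (i, j) = 1"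
    and "\<And>i j j'. i < m \<Longrightarrow> j < n \<Longrightarrow> j' < n \<Longrightarrow> E $$ (i, j) \<noteq> 0 \<Longrightarrow> E $$ (i, j') \<noteq> 0 \<Longrightarrow> j = j'"
    and "\<And>i i' j. i < m \<Longrightarrow> i' < m \<Longrightarrow> j < n \<Longrightarrow> E $$ (i, j) \<noteq> 0 \<Longrightarrow> E $$ (i', j) \<noteq> 0 \<Longrightarrow> i = i'"
proof -
  note D = assms(1)[unfolded pivot_mat_def carrier_matD[OF assms(2)]]
  show "E $$ (i, j) = 1" if "i < m" "j < n" "E $$ (i, j) \<noteq> 0" for i j
    using D[THEN conjunct1] that by blast
  show "j = j'" if "i < m" "j < n" "j' < n" "E $$ (i, j) \<noteq> 0" "E $$ (i, j') \<noteq> 0" for i j j'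
    using D[THEN conjunct2, THEN conjunct1] that by blast
  show "i = i'" if "i < m" "i' < m" "j < n" "E $$ (i, j) \<noteq> 0" "E $$ (i', j) \<noteq> 0" for i i' j
    using D[THEN conjunct2, THEN conjunct2] that by blast
qed

lemma link_functional:
  assumes R: "zigzag_rep R" and piv: "\<And>i. i < nedges R \<Longrightarrow> pivot_mat (edge_mat R i)"
    and l: "link R x y" "link R x y'"
  shows "y = y'"
proof -
  let ?i = "vertex_of R x"
  note e = link_edge[OF l(1)] and e' = link_edge[OF l(2)]
  note P = pivot_matD[OF piv[OF e(1)] zigzag_repD[OF R e(1)]]
  have "y - offset R (Suc ?i) = y' - offset R (Suc ?i)"
  proof (cases "dir R ?i")
    case Leftward
    then show ?thesis
      using P(2)[of "x - offset R ?i" "y - offset R (Suc ?i)" "y' - offset R (Suc ?i)"] e e'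
      by (simp add: src_def tgt_def)
  next
    case Rightward
    then show ?thesis
      using P(3)[of "y - offset R (Suc ?i)" "y' - offset R (Suc ?i)" "x - offset R ?i"] e e'
      by (simp add: src_def tgt_def)
  qed
  then show ?thesis using e(4) e'(4) by linarith
qed

lemma link_injective:
  assumes R: "zigzag_rep R" and piv: "\<And>i. i < nedges R \<Longrightarrow> pivot_mat (edge_mat R i)"
    and l: "link R x y" "link R x' y"
  shows "x = x'"
proof -
  let ?i = "vertex_of R x"
  have i': "vertex_of R x' = ?i" using l by (simp add: link_def)
  note e = link_edge[OF l(1)] and e' = link_edge[OF l(2), unfolded i']
  note P = pivot_matD[OF piv[OF e(1)] zigzag_repD[OF R e(1)]]
  have "x - offset R ?i = x' - offset R ?i"
  proof (cases "dir R ?i")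
    case Leftward
    then show ?thesis
      using P(3)[of "x - offset R ?i" "x' - offset R ?i" "y - offset R (Suc ?i)"] e e'
      by (simp add: src_def tgt_def)
  next
    case Rightward
    then show ?thesis
      using P(2)[of "y - offset R (Suc ?i)" "x - offset R ?i" "x' - offset R ?i"] e e'
      by (simp add: src_def tgt_def)
  qed
  then show ?thesis using e(2) e'(2) by linarith
qed

lemma companion_eq_link:
  assumes R: "zigzag_rep R" and piv: "\<And>i. i < nedges R \<Longrightarrow> pivot_mat (edge_mat R i)"
    and xy: "x < total_dim R" "y < total_dim R"
  shows "companion R $$ (x, y) =
    (if link R x y \<and> dir R (vertex_of R x) = Leftward \<or>
        link R y x \<and> dir R (vertex_of R y) = Rightward then 1 else 0)"
proof (cases "companion R $$ (x, y) = 0")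
  case True
  then show ?thesis by (auto simp: link_def)
next
  case False
  then obtain i where i: "i < nedges R" "vertex_of R x = tgt R i" "vertex_of R y = src R i"
    using companion_no_edge[OF xy] by blast
  have e: "companion R $$ (x, y) = edge_mat R i $$ (x - offset R (tgt R i), y - offset R (src R i))"
    by (rule companion_edge[OF xy i])
  have "companion R $$ (x, y) = 1"
    using pivot_matD(1)[OF piv[OF i(1)] zigzag_repD[OF R i(1)],
        of "x - offset R (tgt R i)" "y - offset R (src R i)"]
      vertex_of_bounds(4)[OF xy(1)] vertex_of_bounds(4)[OF xy(2)] i(2,3) e False by simp
  then show ?thesis
    using i xy by (cases "dir R i") (auto simp: link_def src_def tgt_def)
qed

text \<open>
A finite set with a partial injection that raises the level by one splits into chains.  The elements are
added in the order of their levels.  A new element has no successor yet, and its predecessor, if there is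
one, is the last element of its chain, as no other element may follow it there; so either some chain is
extended at its end, or a new chain is opened.
\<close>

lemma chain_decomposition:
  fixes l :: "nat \<Rightarrow> nat \<Rightarrow> bool" and v :: "nat \<Rightarrow> nat"
  assumes "finite S"
    and level: "\<And>x y. l x y \<Longrightarrow> v y = Suc (v x)"
    and func: "\<And>x y y'. l x y \<Longrightarrow> l x y' \<Longrightarrow> y = y'"
    and inj: "\<And>x x' y. l x y \<Longrightarrow> l x' y \<Longrightarrow> x = x'"
  shows "\<exists>cs. distinct (concat cs) \<and> set (concat cs) = S \<and>
    (\<forall>c\<in>set cs. c \<noteq> [] \<and> (\<forall>k. Suc k < length c \<longrightarrow> l (c ! k) (c ! Suc k))) \<and>
    (\<forall>x\<in>S. \<forall>y\<in>S. l x y \<longrightarrow> (\<exists>c\<in>set cs. x \<in> set c \<and> y \<in> set c))"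
    (is "\<exists>cs. ?P S cs")
  using \<open>finite S\<close>
proof (induction S rule: finite_ranking_induct[where f = v])
  case empty
  show ?case by (intro exI[of _ "[]"]) auto
next
  case (insert y S)
  then obtain cs where cs: "?P S cs" by blast
  then have dist: "distinct (concat cs)" and S: "set (concat cs) = S" by simp_all
  from cs have chain: "\<And>c k. c \<in> set cs \<Longrightarrow> Suc k < length c \<Longrightarrow> l (c ! k) (c ! Suc k)"
    and ne: "\<And>c. c \<in> set cs \<Longrightarrow> c \<noteq> []"
    and conn: "\<And>a b. a \<in> S \<Longrightarrow> b \<in> S \<Longrightarrow> l a b \<Longrightarrow> \<exists>c\<in>set cs. a \<in> set c \<and> b \<in> set c"
    by blast+
  have no_succ: "\<not> l y b" if "b \<in> insert y S" for b
    using that level[of y b] insert.hyps(2)[of b] by auto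
  show ?case
  proof (cases "y \<in> S \<or> (\<forall>x\<in>S. \<not> l x y)")
    case True
    show ?thesis
    proof (cases "y \<in> S")
      case True
      then have "insert y S = S" by auto
      then show ?thesis using insert.IH by simp
    next
      case False
      then have "\<forall>x\<in>S. \<not> l x y" using True by simp
      then have conn': "\<exists>c\<in>set (cs @ [[y]]). a \<in> set c \<and> b \<in> set c"
        if "a \<in> insert y S" "b \<in> insert y S" "l a b" for a b
        using conn[of a b] no_succ that by auto
      have "distinct (concat (cs @ [[y]]))" "set (concat (cs @ [[y]])) = insert y S"
        using dist S False by auto
      moreover have "\<forall>c\<in>set (cs @ [[y]]). c \<noteq> [] \<and> (\<forall>k. Suc k < length c \<longrightarrow> l (c ! k) (c ! Suc k))"
        using ne chain by simp
      ultimately have "?P (insert y S) (cs @ [[y]])" using conn' by blast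
      then show ?thesis by blast
    qed
  next
    case False
    then obtain x where x: "x \<in> S" "l x y" "y \<notin> S" by auto
    then obtain c where c: "c \<in> set cs" "x \<in> set c" using S by auto
    then obtain k where k: "k < length c" "c ! k = x" by (auto simp: in_set_conv_nth)
    \<comment> \<open>An element after \<open>x\<close> in its chain would have to be \<open>y\<close>, which is new.\<close>
    have last: "Suc k = length c"
    proof (rule ccontr)
      assume "Suc k \<noteq> length c"
      then have "Suc k < length c" using k by simp
      then have "l x (c ! Suc k)" using chain[OF c(1)] k by auto
      then have "c ! Suc k = y" using func x(2) by blast
      then have "y \<in> S" using \<open>Suc k < length c\<close> c(1) S nth_mem by fastforce
      then show False using x by simp
    qed
    obtain as bs where cs: "cs = as @ c # bs" using split_list[OF c(1)] by auto
    let ?cs = "as @ (c @ [y]) # bs"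
    have "distinct (concat ?cs)" using dist S x(3) unfolding cs by auto
    moreover have "set (concat ?cs) = insert y S" using S unfolding cs by auto
    moreover have "c' \<noteq> []" if "c' \<in> set ?cs" for c'
      using that ne unfolding cs by auto
    moreover have "l (c' ! j) (c' ! Suc j)" if c': "c' \<in> set ?cs" and j: "Suc j < length c'" for c' j
    proof (cases "c' = c @ [y]")
      case True
      show ?thesis
      proof (cases "Suc j < length c")
        case True
        then show ?thesis using chain[OF c(1) True] \<open>c' = c @ [y]\<close> by (simp add: nth_append)
      next
        case False
        then have "j = k" using j last \<open>c' = c @ [y]\<close> by simp
        then show ?thesis using k last x(2) \<open>c' = c @ [y]\<close> by (simp add: nth_append)
      qed
    next
      case False
      then have "c' \<in> set cs" using c' unfolding cs by auto
      then show ?thesis using chain j by blast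
    qed
    moreover have "\<exists>c'\<in>set ?cs. a \<in> set c' \<and> b \<in> set c'"
      if ab: "a \<in> insert y S" "b \<in> insert y S" "l a b" for a b
    proof (cases "b = y")
      case True
      then have "a = x" using inj ab(3) x(2) by blast
      then show ?thesis using c True by auto
    next
      case False
      have "a \<noteq> y" using no_succ ab by blast
      then obtain c' where "c' \<in> set cs" "a \<in> set c'" "b \<in> set c'"
        using conn[of a b] ab False by auto
      then show ?thesis unfolding cs by auto
    qed
    ultimately have "?P (insert y S) ?cs" by blast
    then show ?thesis by blast
  qed
qed

text \<open>
If \<open>f\<close> vanishes between different classes of a partition, then listing the elements class by class
makes the matrix of \<open>f\<close> block diagonal.
\<close>

lemma diag_block_mat_classes:
  assumes "\<And>c. c \<in> set cs \<Longrightarrow> A c = mat (length c) (length c) (\<lambda>(p, q). f (c ! p) (c ! q))"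
    and "distinct (concat cs)"
    and "\<And>x y. x \<in> set (concat cs) \<Longrightarrow> y \<in> set (concat cs) \<Longrightarrow> f x y \<noteq> (0 :: 'a::zero) \<Longrightarrow>
      \<exists>c\<in>set cs. x \<in> set c \<and> y \<in> set c"
  shows "diag_block_mat (map A cs) = mat (length (concat cs)) (length (concat cs))
    (\<lambda>(x, y). f (concat cs ! x) (concat cs ! y))"
  using assms
proof (induction cs)
  case Nil
  then show ?case by (intro eq_matI) auto
next
  case (Cons c cs)
  let ?xs = "concat cs"
  have disj: "set c \<inter> set ?xs = {}" using Cons.prems(2) by auto
  have IH: "diag_block_mat (map A cs) = mat (length ?xs) (length ?xs) (\<lambda>(x, y). f (?xs ! x) (?xs ! y))"
  proof (rule Cons.IH)
    fix x y assume xy: "x \<in> set ?xs" "y \<in> set ?xs" "f x y \<noteq> 0"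
    then obtain c' where "c' \<in> set (c # cs)" "x \<in> set c'" "y \<in> set c'"
      using Cons.prems(3)[of x y] by auto
    then show "\<exists>c\<in>set cs. x \<in> set c \<and> y \<in> set c" using xy disj by auto
  qed (use Cons.prems in auto)
  have off: "f x y = 0" "f y x = 0" if xy: "x \<in> set c" "y \<in> set ?xs" for x y
  proof -
    have "\<not> (\<exists>c'\<in>set (c # cs). x \<in> set c' \<and> y \<in> set c')" using xy disj by auto
    then show "f x y = 0" "f y x = 0" using Cons.prems(3)[of x y] Cons.prems(3)[of y x] xy by auto
  qed
  have A: "A c = mat (length c) (length c) (\<lambda>(p, q). f (c ! p) (c ! q))"
    by (rule Cons.prems) simp
  have off': "f (c ! i) (?xs ! j) = 0" "f (?xs ! j) (c ! i) = 0" if "i < length c" "j < length ?xs" for i j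
    using off[OF nth_mem[OF that(1)] nth_mem[OF that(2)]] by auto
  show ?case
    unfolding list.map diag_block_mat.simps Let_def IH A
    by (rule eq_matI) (auto simp: nth_append off')
qed

lemma permute_conjugate:
  fixes C :: "'a::comm_semiring_1 mat"
  assumes \<pi>: "\<pi> permutes {..<N}" and C: "C \<in> carrier_mat N N"
  defines "P \<equiv> perm_matrix N \<pi>"
  shows "P * mat N N (\<lambda>(x, y). C $$ (\<pi> x, \<pi> y)) * P\<^sup>T = C"
proof (rule eq_matI)
  let ?T = "mat N N (\<lambda>(x, y). C $$ (\<pi> x, \<pi> y))"
  let ?\<rho> = "inv_into UNIV \<pi>"
  have P: "P \<in> carrier_mat N N" by (simp add: P_def perm_matrix_def)
  have T: "?T \<in> carrier_mat N N" by simp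
  fix i j assume "i < dim_row C" "j < dim_col C"
  then have ij: "i < N" "j < N" using C by auto
  have \<rho>: "?\<rho> k < N \<longleftrightarrow> k < N" for k
    using permutes_in_image[OF permutes_inv[OF \<pi>]] by auto
  have eq: "k = \<pi> l \<longleftrightarrow> l = ?\<rho> k" for k l
    using permutes_inverses[OF \<pi>] by metis
  have PT: "(P * ?T) $$ (i, l) = C $$ (i, \<pi> l)" if l: "l < N" for l
  proof -
    have "(P * ?T) $$ (i, l) = (\<Sum>k<N. P $$ (i, k) * ?T $$ (k, l))"
      using P T ij(1) l by (intro index_mult_sum)
    also have "\<dots> = (\<Sum>k<N. if k = ?\<rho> i then ?T $$ (k, l) else 0)"
      using ij by (intro sum.cong refl) (auto simp: P_def perm_matrix_def eq)
    also have "\<dots> = C $$ (i, \<pi> l)"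
      using ij l \<rho> permutes_inverses[OF \<pi>] by simp
    finally show ?thesis .
  qed
  have "(P * ?T * P\<^sup>T) $$ (i, j) = (\<Sum>l<N. (P * ?T) $$ (i, l) * P\<^sup>T $$ (l, j))"
    using P T ij by (intro index_mult_sum[of _ N N _ N]) auto
  also have "\<dots> = (\<Sum>l<N. if l = ?\<rho> j then C $$ (i, \<pi> l) else 0)"
    using ij PT by (intro sum.cong refl) (auto simp: P_def perm_matrix_def eq)
  also have "\<dots> = C $$ (i, j)"
    using ij \<rho> permutes_inverses[OF \<pi>] by simp
  finally show "(P * ?T * P\<^sup>T) $$ (i, j) = C $$ (i, j)" .
qed (use C in \<open>auto simp: P_def perm_matrix_def\<close>)

text \<open>
The direct sum of the spaces of an interval representation has one coordinate for each of the
vertices \<open>b, \<dots>, d\<close>, in this order.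
\<close>

lemma interval_companion:
  assumes bd: "b \<le> d" "d \<le> n"
  shows "companion (interval_rep n dr (b, d)) = (mat (Suc d - b) (Suc d - b) (\<lambda>(p, q).
    if q = Suc p \<and> dr (b + p) = Leftward \<or> p = Suc q \<and> dr (b + q) = Rightward then 1 else 0)
      :: 'a::field mat)"
proof -
  let ?I = "interval_rep n dr (b, d) :: 'a zigzag"
  have [simp]: "nedges ?I = n" "dir ?I = dr" "vdim ?I i = (if b \<le> i \<and> i \<le> d then 1 else 0)" for i
    by (simp_all add: interval_rep_def Let_def)
  have off: "offset ?I i = min i (Suc d) - b" for i
    by (induction i) (auto simp: offset_Suc, simp add: offset_def)
  have tot: "total_dim ?I = Suc d - b" using bd by (simp add: total_dim_def off)
  have vert: "vertex_of ?I p = b + p" if "p < Suc d - b" for p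
    using that by (intro vertex_of_eqI) (auto simp: off)
  have "companion ?I $$ (p, q) =
      (if q = Suc p \<and> dr (b + p) = Leftward \<or> p = Suc q \<and> dr (b + q) = Rightward then 1 else 0)"
    if pq: "p < Suc d - b" "q < Suc d - b" for p q
  proof -
    have le: "b + p \<le> d" "b + q \<le> d" using pq by linarith+
    have entry: "companion ?I $$ (p, q) = 1" if i: "i < n" "b + p = tgt ?I i" "b + q = src ?I i" for i
    proof -
      have "companion ?I $$ (p, q) = edge_mat ?I i $$ (p - offset ?I (b + p), q - offset ?I (b + q))"
        using companion_edge[of p ?I q i] pq i by (simp add: tot vert)
      moreover have "b \<le> i" "Suc i \<le> d"
        using i pq by (auto simp: src_def tgt_def split: direction.splits)
      moreover from this have "edge_mat ?I i = 1\<^sub>m 1" by (simp add: interval_rep_def Let_def)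
      ultimately show ?thesis using pq by (simp add: off)
    qed
    show ?thesis
    proof (cases "\<exists>i<n. b + p = tgt ?I i \<and> b + q = src ?I i")
      case True
      then obtain i where i: "i < n" "b + p = tgt ?I i" "b + q = src ?I i" by auto
      then have "q = Suc p \<and> dr (b + p) = Leftward \<or> p = Suc q \<and> dr (b + q) = Rightward"
        by (auto simp: src_def tgt_def split: direction.splits)
      then show ?thesis using entry[OF i] by simp
    next
      case False
      then have "companion ?I $$ (p, q) = 0"
        using pq by (intro companion_no_edge) (auto simp: tot vert)
      moreover have "\<not> (q = Suc p \<and> dr (b + p) = Leftward)"
      proof
        assume "q = Suc p \<and> dr (b + p) = Leftward"
        then show False using False[simplified, rule_format, of "b + p"] le bd
          by (auto simp: src_def tgt_def)
      qed
      moreover have "\<not> (p = Suc q \<and> dr (b + q) = Rightward)"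
      proof
        assume "p = Suc q \<and> dr (b + q) = Rightward"
        then show False using False[simplified, rule_format, of "b + q"] le bd
          by (auto simp: src_def tgt_def)
      qed
      ultimately show ?thesis by auto
    qed
  qed
  then show ?thesis
    using companion_carrier[of ?I] by (intro eq_matI) (simp_all add: tot)
qed

text \<open>
The chains of linked coordinates are the bars; a chain runs through consecutive vertices, so two of its
elements are linked exactly if they are neighbours in it.  The permutation \<open>\<pi>\<close> lists the coordinates chain by
chain.
\<close>

lemma pivot_barcode_form:
  fixes R :: "'a::field zigzag"
  assumes R: "zigzag_rep R" and piv: "\<And>i. i < nedges R \<Longrightarrow> pivot_mat (edge_mat R i)"
  shows "barcode_form R"
proof -
  define N where "N = total_dim R"
  define v where "v = vertex_of R"
  have vn: "v x \<le> nedges R" if "x < N" for x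
    using that vertex_of_bounds(1)[of x R] by (simp add: v_def N_def)
  have lev: "v y = Suc (v x)" if "link R x y" for x y
    using that by (simp add: link_def v_def)
  have chains: "\<exists>cs. distinct (concat cs) \<and> set (concat cs) = {..<N} \<and>
    (\<forall>c\<in>set cs. c \<noteq> [] \<and> (\<forall>k. Suc k < length c \<longrightarrow> link R (c ! k) (c ! Suc k))) \<and>
    (\<forall>x\<in>{..<N}. \<forall>y\<in>{..<N}. link R x y \<longrightarrow> (\<exists>c\<in>set cs. x \<in> set c \<and> y \<in> set c))"
    by (rule chain_decomposition[where v = v])
      (use lev link_functional[OF R piv] link_injective[OF R piv] in blast)+
  obtain cs where dist: "distinct (concat cs)" and set: "set (concat cs) = {..<N}"
    and ne: "\<And>c. c \<in> set cs \<Longrightarrow> c \<noteq> []"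
    and chain: "\<And>c k. c \<in> set cs \<Longrightarrow> Suc k < length c \<Longrightarrow> link R (c ! k) (c ! Suc k)"
    and conn: "\<And>x y. x < N \<Longrightarrow> y < N \<Longrightarrow> link R x y \<Longrightarrow> \<exists>c\<in>set cs. x \<in> set c \<and> y \<in> set c"
    using chains by auto
  define bar where "bar c = (v (hd c), v (last c))" for c
  define bars where "bars = map bar cs"
  have len: "length (concat cs) = N"
    using distinct_card[OF dist] set by simp
  have cN: "x < N" if "c \<in> set cs" "x \<in> set c" for c x
    using that set by auto
  have vk: "v (c ! k) = v (hd c) + k" if c: "c \<in> set cs" and "k < length c" for c k
    using that(2)
  proof (induction k)
    case 0
    then show ?case by (simp add: hd_conv_nth)
  next
    case (Suc k)
    then show ?case using lev[OF chain[OF c Suc.prems]] by simp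
  qed
  have vl: "v (last c) = v (hd c) + (length c - 1)" if "c \<in> set cs" for c
    using vk[OF that, of "length c - 1"] ne[OF that] by (simp add: last_conv_nth)
  have upt: "[v (hd c)..<Suc (v (last c))] = map v c" if "c \<in> set cs" for c
    using ne[OF that] vl[OF that] vk[OF that] by (intro nth_equalityI) (auto simp del: upt_Suc)
  have "concat (map (\<lambda>(b, d). [b..<Suc d]) bars) = concat (map (map v) cs)"
    unfolding bars_def map_map
    by (intro arg_cong[of _ _ concat] map_cong refl) (simp add: bar_def upt del: upt_Suc)
  then have labels: "concat (map (\<lambda>(b, d). [b..<Suc d]) bars) = map v (concat cs)"
    by (simp add: map_concat)
  define \<pi> where "\<pi> x = (if x < N then concat cs ! x else x)" for x
  have "bij_betw \<pi> {..<N} {..<N}"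
    using bij_betw_nth[OF dist refl refl] unfolding len set
    by (rule bij_betw_cong[THEN iffD1, rotated]) (simp add: \<pi>_def)
  then have \<pi>: "\<pi> permutes {..<N}" by (intro bij_imp_permutes) (auto simp: \<pi>_def)

  let ?A = "\<lambda>c. companion (interval_rep (nedges R) (dir R) (bar c)) :: 'a mat"
  have A: "?A c = mat (length c) (length c) (\<lambda>(p, q). companion R $$ (c ! p, c ! q))"
    if c: "c \<in> set cs" for c
  proof -
    have bd: "v (hd c) \<le> v (last c)" "v (last c) \<le> nedges R"
      using vl[OF c] vn[OF cN[OF c last_in_set[OF ne[OF c]]]] by linarith+
    have l: "Suc (v (last c)) - v (hd c) = length c" using vl[OF c] ne[OF c] by (cases c) auto
    have lk: "link R (c ! p) (c ! q) \<longleftrightarrow> q = Suc p" if "p < length c" "q < length c" for p q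
    proof
      assume "link R (c ! p) (c ! q)"
      from lev[OF this] show "q = Suc p" using vk[OF c that(1)] vk[OF c that(2)] by simp
    qed (use chain[OF c] that in auto)
    have "companion R $$ (c ! p, c ! q) = (if q = Suc p \<and> dir R (v (hd c) + p) = Leftward \<or>
        p = Suc q \<and> dir R (v (hd c) + q) = Rightward then 1 else 0)"
      if pq: "p < length c" "q < length c" for p q
    proof -
      have "c ! p < total_dim R" "c ! q < total_dim R"
        using cN[OF c nth_mem] pq by (auto simp: N_def)
      note companion_eq_link[OF R piv this]
      then show ?thesis
        unfolding lk[OF pq] lk[OF pq(2,1)] using vk[OF c pq(1)] vk[OF c pq(2)] by (simp add: v_def)
    qed
    then show ?thesis
      unfolding bar_def interval_companion[OF bd] l by (intro eq_matI) auto
  qed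
  have "diag_block_mat (map ?A cs) = mat (length (concat cs)) (length (concat cs))
      (\<lambda>(x, y). companion R $$ (concat cs ! x, concat cs ! y))"
  proof (rule diag_block_mat_classes[OF A dist])
    fix x y assume "x \<in> set (concat cs)" "y \<in> set (concat cs)" and nz: "companion R $$ (x, y) \<noteq> 0"
    then have xy: "x < N" "y < N" using set by auto
    then have "link R x y \<or> link R y x"
      using nz companion_eq_link[OF R piv, of x y] by (auto simp: N_def split: if_splits)
    then show "\<exists>c\<in>set cs. x \<in> set c \<and> y \<in> set c" using conn xy by blast
  qed
  also have "\<dots> = mat N N (\<lambda>(x, y). companion R $$ (\<pi> x, \<pi> y))"
    unfolding len by (intro eq_matI) (auto simp: \<pi>_def)
  finally have T: "diag_block_mat (map (\<lambda>I. companion (interval_rep (nedges R) (dir R) I)) bars) =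
      mat N N (\<lambda>(x, y). companion R $$ (\<pi> x, \<pi> y))"
    by (simp add: bars_def o_def)
  have "companion R = perm_matrix N \<pi> *
      diag_block_mat (map (\<lambda>I. companion (interval_rep (nedges R) (dir R) I)) bars) *
      (perm_matrix N \<pi>)\<^sup>T"
    unfolding T by (rule permute_conjugate[OF \<pi>, symmetric]) (simp add: N_def companion_carrier)
  moreover have "\<forall>(b, d)\<in>set bars. b \<le> d \<and> d \<le> nedges R"
  proof (intro ballI)
    fix I assume "I \<in> set bars"
    then obtain c where c: "c \<in> set cs" and I: "I = (v (hd c), v (last c))"
      by (auto simp: bars_def bar_def)
    show "case I of (b, d) \<Rightarrow> b \<le> d \<and> d \<le> nedges R"
      unfolding I prod.case
      using vl[OF c] vn[OF cN[OF c last_in_set[OF ne[OF c]]]] by linarith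
  qed
  moreover have "vertex_of R (\<pi> x) = map v (concat cs) ! x" if "x < N" for x
    using that len by (simp add: \<pi>_def v_def)
  ultimately show ?thesis
    unfolding barcode_form_def Let_def N_def[symmetric]
    using \<pi> len by (intro exI[of _ bars] exI[of _ \<pi>]) (simp add: labels del: upt_Suc)
qed

section \<open>The counted algorithm is a run\<close>

lemma set_edge_simps [simp]:
  "nedges (set_edge i A R) = nedges R" "vdim (set_edge i A R) = vdim R"
  "dir (set_edge i A R) = dir R" "src (set_edge i A R) = src R" "tgt (set_edge i A R) = tgt R"
  "edge_mat (set_edge i A R) j = (if j = i then A else edge_mat R j)"
  by (simp_all add: set_edge_def src_def[abs_def] tgt_def[abs_def])

lemma result_pass_to_edge:
  assumes "tgt R e = v \<Longrightarrow> dim_col g = dim_row (edge_mat R e)"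
    and "tgt R e \<noteq> v \<Longrightarrow> dim_col (edge_mat R e) = dim_row h"
  shows "result (pass_to_edge e v g h R) =
    set_edge e (if tgt R e = v then g * edge_mat R e else edge_mat R e * h) R"
  using assms by (simp add: pass_to_edge_def)

text \<open>
The procedures store new matrices at two edges only, whereas \<open>change_basis\<close> is defined on all edges at
once; the two agree because \<open>i\<close> and \<open>i + 1\<close> are the only edges at vertex \<open>i + 1\<close>.
\<close>

lemma change_basis_right_edges:
  fixes R :: "'a::field zigzag"
  assumes R: "zigzag_rep R" and i: "i < nedges R"
    and g: "g \<in> carrier_mat (vdim R (Suc i)) (vdim R (Suc i))"
    and h: "h \<in> carrier_mat (vdim R (Suc i)) (vdim R (Suc i))"
    and A: "A = edge_mat (change_basis (Suc i) g h R) i"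
  shows "result (if Suc i < nedges R then pass_to_edge (Suc i) (Suc i) g h (set_edge i A R)
      else ret (set_edge i A R)) = change_basis (Suc i) g h R" (is "result ?l = ?r")
proof -
  let ?M = "if tgt R (Suc i) = Suc i then g * edge_mat R (Suc i) else edge_mat R (Suc i) * h"
  have l: "result ?l = (if Suc i < nedges R then set_edge (Suc i) ?M (set_edge i A R) else set_edge i A R)"
  proof (cases "Suc i < nedges R")
    case True
    have "result (pass_to_edge (Suc i) (Suc i) g h (set_edge i A R)) = set_edge (Suc i) ?M (set_edge i A R)"
      using zigzag_repD[OF R True] g h
      by (subst result_pass_to_edge) (auto simp: src_def tgt_def split: direction.splits)
    then show ?thesis using True by simp
  qed simp
  have "edge_mat (result ?l) = edge_mat ?r"
  proof
    fix j
    consider "j = i" | "j = Suc i" | "j \<noteq> i" "j \<noteq> Suc i" by blast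
    then show "edge_mat (result ?l) j = edge_mat ?r j"
    proof cases
      case 1
      then show ?thesis unfolding l by (auto simp: A)
    next
      case 2
      then show ?thesis unfolding l
        by (auto simp: edge_mat_change_basis src_def tgt_def split: direction.splits)
    next
      case 3
      then have "tgt R j \<noteq> Suc i" "src R j \<noteq> Suc i"
        by (auto simp: src_def tgt_def split: direction.splits)
      then show ?thesis using 3 unfolding l by (auto simp: edge_mat_change_basis)
    qed
  qed
  moreover have "nedges (result ?l) = nedges ?r" "vdim (result ?l) = vdim ?r" "dir (result ?l) = dir ?r"
    unfolding l by simp_all
  ultimately show ?thesis by (intro zigzag.equality) simp_all
qed

lemma change_basis_left_edges:
  fixes R :: "'a::field zigzag"
  assumes R: "zigzag_rep R" and i: "i < nedges R"
    and g: "g \<in> carrier_mat (vdim R i) (vdim R i)"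
    and h: "h \<in> carrier_mat (vdim R i) (vdim R i)"
    and A: "A = edge_mat (change_basis i g h R) i"
  shows "result (if 0 < i then pass_to_edge (i - 1) i g h (set_edge i A R)
      else ret (set_edge i A R)) = change_basis i g h R" (is "result ?l = ?r")
proof -
  let ?M = "if tgt R (i - 1) = i then g * edge_mat R (i - 1) else edge_mat R (i - 1) * h"
  have l: "result ?l = (if 0 < i then set_edge (i - 1) ?M (set_edge i A R) else set_edge i A R)"
  proof (cases "0 < i")
    case True
    then have i1: "i - 1 < nedges R" using i by simp
    have "result (pass_to_edge (i - 1) i g h (set_edge i A R)) = set_edge (i - 1) ?M (set_edge i A R)"
      using zigzag_repD[OF R i1] g h True
      by (subst result_pass_to_edge) (auto simp: src_def tgt_def split: direction.splits)
    then show ?thesis using True by simp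
  qed simp
  have "edge_mat (result ?l) = edge_mat ?r"
  proof
    fix j
    consider "j = i" | "Suc j = i" | "j \<noteq> i" "Suc j \<noteq> i" by blast
    then show "edge_mat (result ?l) j = edge_mat ?r j"
    proof cases
      case 1
      then show ?thesis unfolding l by (auto simp: A)
    next
      case 2
      then show ?thesis unfolding l using i
        by (auto simp: edge_mat_change_basis src_def tgt_def split: direction.splits)
    next
      case 3
      then have "tgt R j \<noteq> i" "src R j \<noteq> i"
        by (auto simp: src_def tgt_def split: direction.splits)
      then show ?thesis using 3 unfolding l by (auto simp: edge_mat_change_basis)
    qed
  qed
  moreover have "nedges (result ?l) = nedges ?r" "vdim (result ?l) = vdim ?r" "dir (result ?l) = dir ?r"
    unfolding l by simp_all
  ultimately show ?thesis by (intro zigzag.equality) simp_all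
qed

lemma first_pass_step_correct:
  fixes R :: "'a::field zigzag"
  assumes R: "zigzag_rep R" and i: "i < nedges R"
  shows "\<exists>E R'. result (first_pass_step i (R, Es)) = (R', Es(i := E)) \<and> first_pass_rel i E R R'"
proof (cases "dir R i")
  case Leftward
  then have st: "src R i = Suc i" "tgt R i = i" by (simp_all add: src_def tgt_def)
  note M = zigzag_repD[OF R i, unfolded st]
  let ?m = "vdim R i" and ?n = "vdim R (Suc i)"
  obtain L E U P where r: "result (leup_timed (edge_mat R i)) = (L, E, U, P)"
    by (cases "result (leup_timed (edge_mat R i))") auto
  note LEUP = leup_timed_correct[OF r]
  from LEUP M have c: "L \<in> carrier_mat ?m ?m" "E \<in> carrier_mat ?m ?n" "U \<in> carrier_mat ?n ?n"
    "P \<in> carrier_mat ?n ?n" "is_U ?n U" "is_P ?n P" "edge_mat R i = L * E * U * P"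
    by (auto simp: is_LEUP_def is_L_def is_U_def is_P_def)
  let ?U' = "result (upper_inverse_timed U)"
  have U': "inverse_mats U ?U'" using c(5) by (rule upper_inverse_timed_correct)
  have inv: "inverse_mats (U * P) (P\<^sup>T * ?U')"
    by (rule inverse_mats_mult[OF U' is_P_transpose_inverse[OF c(6)] c(3,4)])
  have UP: "U * P \<in> carrier_mat ?n ?n" using c by auto
  note h = inverse_matsD[OF inv disjI1[OF UP]]
  let ?R' = "change_basis (Suc i) (U * P) (P\<^sup>T * ?U') R"
  have rel: "first_pass_rel i E R ?R'"
    using Leftward LEUP inv by (auto simp: first_pass_rel_def)
  have "edge_mat R i = (L * E) * (U * P)"
    unfolding c(7) using c by (intro assoc_mult_mat[of _ ?m ?n _ ?n _ ?n]) auto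
  then have "edge_mat R i * (P\<^sup>T * ?U') = (L * E) * (U * P) * (P\<^sup>T * ?U')" by simp
  also have "\<dots> = (L * E) * ((U * P) * (P\<^sup>T * ?U'))" using c h UP by (intro assoc_mult_mat) auto
  finally have "edge_mat R i * (P\<^sup>T * ?U') = L * E" using h c by simp
  then have A: "L * E = edge_mat ?R' i"
    using i by (simp add: edge_mat_change_basis st)
  have d: "dim_col L = dim_row E" "dim_col U = dim_row P" "dim_row P = dim_row ?U'"
    using c inverse_matsD[OF U' disjI1[OF c(3)]] by auto
  have "result (first_pass_step i (R, Es)) = (?R', Es(i := E))"
    using change_basis_right_edges[OF R i UP h(2) A]
    by (simp add: first_pass_step_def Let_def Leftward r d split: if_splits)
  then show ?thesis using rel by blast
next
  case Rightward
  then have st: "src R i = i" "tgt R i = Suc i" by (simp_all add: src_def tgt_def)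
  note M = zigzag_repD[OF R i, unfolded st]
  let ?m = "vdim R (Suc i)" and ?n = "vdim R i"
  obtain P U E L where r: "result (puel_timed (edge_mat R i)) = (P, U, E, L)"
    by (cases "result (puel_timed (edge_mat R i))") auto
  note PUEL = puel_timed_correct[OF r]
  from PUEL M have c: "L \<in> carrier_mat ?n ?n" "E \<in> carrier_mat ?m ?n" "U \<in> carrier_mat ?m ?m"
    "P \<in> carrier_mat ?m ?m" "is_U ?m U" "is_P ?m P" "edge_mat R i = P * U * E * L"
    by (auto simp: is_PUEL_def is_L_def is_U_def is_P_def)
  let ?U' = "result (upper_inverse_timed U)"
  have U': "inverse_mats U ?U'" using c(5) by (rule upper_inverse_timed_correct)
  have inv: "inverse_mats (?U' * P\<^sup>T) (P * U)"
    by (rule inverse_mats_sym[OF inverse_mats_mult[OF is_P_transpose_inverse[OF c(6)] U' c(4,3)]])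
  have PU: "P * U \<in> carrier_mat ?m ?m" using c by auto
  note g = inverse_matsD[OF inv disjI2[OF PU]]
  let ?R' = "change_basis (Suc i) (?U' * P\<^sup>T) (P * U) R"
  have rel: "first_pass_rel i E R ?R'"
    using Rightward PUEL inv by (auto simp: first_pass_rel_def)
  have "edge_mat R i = (P * U) * (E * L)"
    unfolding c(7) using c by (intro assoc_mult_mat[of _ ?m ?m _ ?n _ ?n]) auto
  then have "(?U' * P\<^sup>T) * edge_mat R i = (?U' * P\<^sup>T) * ((P * U) * (E * L))" by simp
  also have "\<dots> = ((?U' * P\<^sup>T) * (P * U)) * (E * L)"
    using c g PU by (intro assoc_mult_mat[symmetric]) auto
  finally have "(?U' * P\<^sup>T) * edge_mat R i = E * L" using g c by simp
  then have A: "E * L = edge_mat ?R' i"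
    using i by (simp add: edge_mat_change_basis st)
  have d: "dim_col E = dim_row L" "dim_col P = dim_row U" "dim_col ?U' = dim_col P"
    using c inverse_matsD[OF U' disjI1[OF c(3)]] by auto
  have "result (first_pass_step i (R, Es)) = (?R', Es(i := E))"
    using change_basis_right_edges[OF R i g(1) PU A]
    by (simp add: first_pass_step_def Let_def Rightward r d split: if_splits)
  then show ?thesis using rel by blast
qed

text \<open>
The form of an edge when the second pass reaches it.
\<close>

definition two_sided_reduced :: "'a::field zigzag \<Rightarrow> nat \<Rightarrow> 'a mat \<Rightarrow> bool" where
  "two_sided_reduced R i E \<longleftrightarrow> edge_shape R i E \<and>
     (\<exists>L1 L2. is_L (dim_row E) L1 \<and> is_L (dim_col E) L2 \<and> edge_mat R i = L1 * E * L2)"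

lemma half_reduced_two_sided:
  assumes "half_reduced R i E"
  shows "two_sided_reduced R i E"
proof -
  from assms obtain L where L: "case dir R i of
        Leftward \<Rightarrow> is_L (dim_row E) L \<and> edge_mat R i = L * E
      | Rightward \<Rightarrow> is_L (dim_col E) L \<and> edge_mat R i = E * L" and s: "edge_shape R i E"
    by (auto simp: half_reduced_def)
  show ?thesis
  proof (cases "dir R i")
    case Leftward
    then have "is_L (dim_row E) L" "edge_mat R i = L * E * 1\<^sub>m (dim_col E)"
      using L by (auto simp: is_L_def)
    then show ?thesis using s is_L_one unfolding two_sided_reduced_def by blast
  next
    case Rightward
    then have "is_L (dim_col E) L" "edge_mat R i = 1\<^sub>m (dim_row E) * E * L"
      using L by auto
    then show ?thesis using s is_L_one unfolding two_sided_reduced_def by blast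
  qed
qed

text \<open>
Edge \<open>j\<close> has its triangular factor at vertex \<open>j\<close> and absorbs the new one at vertex \<open>j + 1\<close>, hence on the
other side of \<open>E\<close>, whichever way it is directed.
\<close>

lemma half_reduced_change_basis:
  fixes R :: "'a::field zigzag"
  assumes i: "Suc j < nedges R" and red: "half_reduced R j E"
    and g: "is_L (vdim R (Suc j)) g" and h: "is_L (vdim R (Suc j)) h"
  shows "two_sided_reduced (change_basis (Suc j) g h R) j E"
proof (cases "dir R j")
  case Leftward
  then have st: "src R j = Suc j" "tgt R j = j" by (simp_all add: src_def tgt_def)
  from red Leftward obtain L where L: "is_L (dim_row E) L" "edge_mat R j = L * E"
    and s: "edge_shape R j E" by (auto simp: half_reduced_def)
  then have "dim_col E = vdim R (Suc j)" by (auto simp: edge_shape_def st)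
  moreover have "edge_mat (change_basis (Suc j) g h R) j = L * E * h"
    using i L by (simp add: edge_mat_change_basis st)
  ultimately show ?thesis
    using L(1) s h unfolding two_sided_reduced_def by (auto simp: edge_shape_def)
next
  case Rightward
  then have st: "src R j = j" "tgt R j = Suc j" by (simp_all add: src_def tgt_def)
  from red Rightward obtain L where L: "is_L (dim_col E) L" "edge_mat R j = E * L"
    and s: "edge_shape R j E" by (auto simp: half_reduced_def)
  then have E: "E \<in> carrier_mat (vdim R (Suc j)) (vdim R j)" by (auto simp: edge_shape_def st)
  have "edge_mat (change_basis (Suc j) g h R) j = g * (E * L)"
    using i L by (simp add: edge_mat_change_basis st)
  also have "\<dots> = g * E * L"
    using E g L(1) by (intro assoc_mult_mat[symmetric]) (auto simp: is_L_def)
  finally show ?thesis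
    using L(1) s g E unfolding two_sided_reduced_def by (auto simp: edge_shape_def)
qed

lemma second_pass_step_correct:
  fixes R :: "'a::field zigzag"
  assumes R: "zigzag_rep R" and i: "i < nedges R" and red: "two_sided_reduced R i (Es i)"
  defines "R' \<equiv> result (second_pass_step Es i R)"
  shows "second_pass_rel i (Es i) R R'"
    and "\<And>j E'. Suc j = i \<Longrightarrow> half_reduced R j E' \<Longrightarrow> two_sided_reduced R' j E'"
proof -
  let ?E = "Es i" and ?s = "vdim R (src R i)" and ?t = "vdim R (tgt R i)"
  from red obtain L1 L2 where E: "?E \<in> carrier_mat ?t ?s" and L1: "is_L ?t L1" and L2: "is_L ?s L2"
    and M: "edge_mat R i = L1 * ?E * L2"
    and s: "case dir R i of Leftward \<Rightarrow> EL_shape ?E | Rightward \<Rightarrow> EL_hat_shape ?E"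
    by (auto simp: two_sided_reduced_def edge_shape_def)
  have "\<exists>g h. is_L (vdim R i) g \<and> is_L (vdim R i) h \<and> R' = change_basis i g h R \<and>
    second_pass_rel i ?E R R'"
  proof (cases "dir R i")
    case Leftward
    then have st: "src R i = Suc i" "tgt R i = i" by (simp_all add: src_def tgt_def)
    have EL: "EL_shape ?E" using s Leftward by simp
    define K where "K = result (left_factor_timed ?E (edge_mat R i))"
    have K: "is_L (vdim R i) K" "edge_mat R i = K * ?E"
      using left_factor_timed_correct[OF E EL L1 L2 M] by (simp_all add: K_def st)
    define g where "g = result (lower_inverse_timed K)"
    have g: "is_L (vdim R i) g" "inverse_mats g K"
      using lower_inverse_timed_correct[OF K(1)] inverse_mats_sym by (auto simp: g_def)
    have c: "g \<in> carrier_mat (vdim R i) (vdim R i)" "K \<in> carrier_mat (vdim R i) (vdim R i)"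
      using g K by (auto simp: is_L_def)
    have "g * edge_mat R i = (g * K) * ?E"
      unfolding K(2) using c E by (intro assoc_mult_mat[symmetric]) (auto simp: st)
    then have A: "?E = edge_mat (change_basis i g K R) i"
      using inverse_matsD[OF g(2) disjI1[OF c(1)]] E i by (simp add: edge_mat_change_basis st)
    have R': "R' = change_basis i g K R"
      using change_basis_left_edges[OF R i c A]
      by (simp add: R'_def second_pass_step_def Let_def Leftward K_def[symmetric] g_def[symmetric] split: if_splits)
    moreover have "second_pass_rel i ?E R R'"
    proof -
      have "is_L (dim_row ?E) L1" "is_L (dim_col ?E) L2" "is_L (dim_row ?E) K"
        using L1 L2 K(1) E by (simp_all add: st)
      then show ?thesis
        unfolding second_pass_rel_def Leftward direction.case
        using M K(2) g(2) R' by metis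
    qed
    ultimately show ?thesis using g K by blast
  next
    case Rightward
    then have st: "src R i = i" "tgt R i = Suc i" by (simp_all add: src_def tgt_def)
    have EL: "EL_hat_shape ?E" using s Rightward by simp
    define K where "K = result (right_factor_timed ?E (edge_mat R i))"
    have K: "is_L (vdim R i) K" "edge_mat R i = ?E * K"
      using right_factor_timed_correct[OF E EL L1 L2 M] by (simp_all add: K_def st)
    define h where "h = result (lower_inverse_timed K)"
    have h: "is_L (vdim R i) h" "inverse_mats K h"
      using lower_inverse_timed_correct[OF K(1)] by (auto simp: h_def)
    have c: "K \<in> carrier_mat (vdim R i) (vdim R i)" "h \<in> carrier_mat (vdim R i) (vdim R i)"
      using h K by (auto simp: is_L_def)
    have "edge_mat R i * h = ?E * (K * h)"
      unfolding K(2) using c E by (intro assoc_mult_mat) (auto simp: st)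
    then have A: "?E = edge_mat (change_basis i K h R) i"
      using inverse_matsD[OF h(2) disjI1[OF c(1)]] E i by (simp add: edge_mat_change_basis st)
    have R': "R' = change_basis i K h R"
      using change_basis_left_edges[OF R i c A]
      by (simp add: R'_def second_pass_step_def Let_def Rightward K_def[symmetric] h_def[symmetric] split: if_splits)
    moreover have "second_pass_rel i ?E R R'"
    proof -
      have "is_L (dim_row ?E) L1" "is_L (dim_col ?E) L2" "is_L (dim_col ?E) K"
        using L1 L2 K(1) E by (simp_all add: st)
      then show ?thesis
        unfolding second_pass_rel_def Rightward direction.case
        using M K(2) h(2) R' by metis
    qed
    ultimately show ?thesis using h K by blast
  qed
  then obtain g h where gh: "is_L (vdim R i) g" "is_L (vdim R i) h" "R' = change_basis i g h R"
    and rel: "second_pass_rel i ?E R R'" by blast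
  show "second_pass_rel i ?E R R'" by (fact rel)
  show "two_sided_reduced R' j E'" if "Suc j = i" "half_reduced R j E'" for j E'
    using half_reduced_change_basis[of j R E' g h] that gh i by simp
qed

text \<open>
The sequences of intermediate representations that witness a run.
\<close>

definition first_pass_state :: "'a::field zigzag \<Rightarrow> nat \<Rightarrow> 'a zigzag \<times> (nat \<Rightarrow> 'a mat)" where
  "first_pass_state R k = result (fold_timed first_pass_step [0..<k] (R, \<lambda>_. 0\<^sub>m 0 0))"

definition second_pass_state :: "'a::field zigzag \<Rightarrow> nat \<Rightarrow> 'a zigzag" where
  "second_pass_state R k = (case first_pass_state R (nedges R) of (R1, Es) \<Rightarrow>
     result (fold_timed (second_pass_step Es) (rev [k..<nedges R]) R1))"

lemma first_pass_state_Suc: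
  "first_pass_state R (Suc k) = result (first_pass_step k (first_pass_state R k))"
  by (simp add: first_pass_state_def)

lemma second_pass_state_step:
  assumes "k < nedges R"
  shows "second_pass_state R k =
    result (second_pass_step (snd (first_pass_state R (nedges R))) k (second_pass_state R (Suc k)))"
  using assms by (simp add: second_pass_state_def split_beta upt_conv_Cons)

lemma result_rightward_initial: "result (rightward_initial R) = second_pass_state R 0"
  by (simp add: rightward_initial_def second_pass_state_def first_pass_state_def split_beta)

lemma first_pass_state_correct:
  fixes R :: "'a::field zigzag"
  assumes R: "zigzag_rep R" and "k \<le> nedges R"
  shows "zigzag_rep (fst (first_pass_state R k)) \<and> same_quiver R (fst (first_pass_state R k)) \<and>
    (\<forall>j<k. first_pass_rel j (snd (first_pass_state R k) j)
       (fst (first_pass_state R j)) (fst (first_pass_state R (Suc j))))"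
  using assms(2)
proof (induction k)
  case 0
  then show ?case using R by (simp add: first_pass_state_def same_quiver_refl)
next
  case (Suc k)
  obtain S Es where S: "first_pass_state R k = (S, Es)" by fastforce
  with Suc have IH: "zigzag_rep S" "same_quiver R S"
    "\<And>j. j < k \<Longrightarrow> first_pass_rel j (Es j) (fst (first_pass_state R j)) (fst (first_pass_state R (Suc j)))"
    by auto
  have k: "k < nedges S" using Suc.prems IH(2) by (simp add: same_quiver_simps)
  obtain E S' where S': "first_pass_state R (Suc k) = (S', Es(k := E))" and rel: "first_pass_rel k E S S'"
    using first_pass_step_correct[OF IH(1) k, of Es] by (auto simp: first_pass_state_Suc S)
  note c = first_pass_rel_correct[OF IH(1) k rel]
  have "same_quiver R S'" using IH(2) c by (simp add: same_quiver_def)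
  moreover have "first_pass_rel j ((Es(k := E)) j) (fst (first_pass_state R j)) (fst (first_pass_state R (Suc j)))"
    if "j < Suc k" for j
    using that IH(3)[of j] rel S S' by (cases "j = k") auto
  ultimately show ?case using isomorphic_zigzag_rep[OF c(1)] S' by simp
qed

text \<open>
Just before edge \<open>j\<close> is treated, that edge has absorbed at most one lower triangular factor, and the
edges to its left are as the first pass left them.
\<close>

lemma second_pass_state_correct:
  fixes R :: "'a::field zigzag"
  assumes R: "zigzag_rep R" and "k \<le> nedges R"
  defines "E \<equiv> snd (first_pass_state R (nedges R))"
  shows "zigzag_rep (second_pass_state R k) \<and> same_quiver R (second_pass_state R k) \<and>
    (\<forall>j. Suc j < k \<longrightarrow> half_reduced (second_pass_state R k) j (E j)) \<and>
    (\<forall>j. Suc j = k \<longrightarrow> two_sided_reduced (second_pass_state R k) j (E j)) \<and>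
    (\<forall>i. k \<le> i \<and> i < nedges R \<longrightarrow>
       second_pass_rel i (E i) (second_pass_state R (Suc i)) (second_pass_state R i))"
  using assms(2)
proof (induction k rule: inc_induct)
  case base
  let ?n = "nedges R"
  have start: "second_pass_state R ?n = fst (first_pass_state R ?n)"
    by (simp add: second_pass_state_def split_beta)
  note fp = first_pass_state_correct[OF R order_refl]
  have half: "half_reduced (fst (first_pass_state R ?n)) j (E j)" if "j < ?n" for j
    using first_pass_correct[OF R, of "\<lambda>k. fst (first_pass_state R k)" E ?n] fp that
    by (auto simp: first_pass_state_def[of R 0] E_def)
  have "two_sided_reduced (fst (first_pass_state R ?n)) j (E j)" if "Suc j = ?n" for j
    by (rule half_reduced_two_sided, rule half) (use that in linarith)
  moreover have "half_reduced (fst (first_pass_state R ?n)) j (E j)" if "Suc j < ?n" for j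
    by (rule half) (use that in linarith)
  ultimately show ?case unfolding start using fp by auto
next
  case (step k)
  let ?S = "second_pass_state R (Suc k)" and ?S' = "second_pass_state R k"
  from step have IH: "zigzag_rep ?S" "same_quiver R ?S"
    "\<And>j. j < k \<Longrightarrow> half_reduced ?S j (E j)" "two_sided_reduced ?S k (E k)"
    "\<And>i. k < i \<Longrightarrow> i < nedges R \<Longrightarrow>
       second_pass_rel i (E i) (second_pass_state R (Suc i)) (second_pass_state R i)"
    by auto
  have k: "k < nedges ?S" using step IH(2) by (simp add: same_quiver_simps)
  have S': "?S' = result (second_pass_step E k ?S)"
    unfolding E_def using step by (intro second_pass_state_step) simp
  note sp = second_pass_step_correct[where Es = E, OF IH(1) k IH(4), folded S']
  have "edge_shape ?S k (E k)" using IH(4) by (simp add: two_sided_reduced_def)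
  note c = second_pass_rel_correct[OF IH(1) k this sp(1)]
  have q: "same_quiver ?S ?S'" using c by (simp add: same_quiver_def)
  have "half_reduced ?S' j (E j)" if "Suc j < k" for j
    using that IH(3)[of j] half_reduced_cong[OF q, of j] c(6)[of j] by simp
  moreover have "two_sided_reduced ?S' j (E j)" if "Suc j = k" for j
    using sp(2)[OF that IH(3)] that by simp
  moreover have "second_pass_rel i (E i) (second_pass_state R (Suc i)) (second_pass_state R i)"
    if "k \<le> i" "i < nedges R" for i
    using that sp(1) IH(5)[of i] by (cases "i = k") auto
  moreover have "same_quiver R ?S'" using IH(2) q by (simp add: same_quiver_def)
  ultimately show ?case using isomorphic_zigzag_rep[OF c(1)] by blast
qed

lemma rightward_initial_is_run:
  fixes R :: "'a::field zigzag"
  assumes R: "zigzag_rep R"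
  shows "rightward_initial_run R (result (rightward_initial R))"
proof -
  let ?n = "nedges R"
  have "fst (first_pass_state R 0) = R" by (simp add: first_pass_state_def)
  moreover have "second_pass_state R ?n = fst (first_pass_state R ?n)"
    by (simp add: second_pass_state_def split_beta)
  moreover note first_pass_state_correct[OF R order_refl] second_pass_state_correct[OF R le0]
  ultimately show ?thesis
    unfolding rightward_initial_run_def result_rightward_initial
    by (intro exI[of _ "snd (first_pass_state R ?n)"] exI[of _ "\<lambda>k. fst (first_pass_state R k)"]
        exI[of _ "second_pass_state R"]) auto
qed

section \<open>Number of operations\<close>

lemma cost_make_mat_le:
  assumes "m \<le> d" "n \<le> d" "\<And>i j. i < m \<Longrightarrow> j < n \<Longrightarrow> cost (f i j) \<le> c"
  shows "cost (make_mat m n f) \<le> (c + 1) * d\<^sup>2"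
proof -
  have "cost (make_mat m n f) \<le> (\<Sum>i<m. \<Sum>j<n. c + 1)"
    unfolding make_mat_def timed.sel using assms(3) by (intro sum_mono) simp
  also have "\<dots> = (c + 1) * (m * n)" by (simp add: algebra_simps)
  also have "\<dots> \<le> (c + 1) * d\<^sup>2"
    unfolding power2_eq_square using assms by (intro mult_le_mono) simp_all
  finally show ?thesis .
qed

lemma cost_sum_timed_le:
  assumes "\<And>k. k < n \<Longrightarrow> cost (f k) \<le> c"
  shows "cost (sum_timed f n) \<le> n * (c + 1)"
  using assms
proof (induction n)
  case (Suc n)
  then have "cost (sum_timed f n) \<le> n * (c + 1)" "cost (f n) \<le> c" by simp_all
  then show ?case by simp
qed simp

lemma cost_find_nonzero_le: "cost (find_nonzero f xs) \<le> length xs"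
  by (induction xs) auto

lemma cost_fold_timed_upt_le:
  assumes "P s" "\<And>k s. k < n \<Longrightarrow> P s \<Longrightarrow> P (result (f k s)) \<and> cost (f k s) \<le> c"
  shows "cost (fold_timed f [0..<n] s) \<le> n * c"
proof -
  have "P (result (fold_timed f [0..<k] s)) \<and> cost (fold_timed f [0..<k] s) \<le> k * c" if "k \<le> n" for k
    using that
  proof (induction k)
    case (Suc k)
    then show ?case using assms(2)[of k "result (fold_timed f [0..<k] s)"] by simp
  qed (use assms(1) in simp)
  then show ?thesis by simp
qed

lemma power2_le_power3: "d\<^sup>2 \<le> (d :: nat) ^ 3"
  by (cases "d = 0") (auto intro: power_increasing)

lemma le_power2: "d \<le> (d :: nat)\<^sup>2"
  by (cases "d = 0") (auto simp: power2_eq_square)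

lemma cost_make_mat_ret_le:
  assumes "m \<le> d" "n \<le> d"
  shows "cost (make_mat m n (\<lambda>i j. ret (f i j))) \<le> d\<^sup>2"
  using cost_make_mat_le[OF assms, of "\<lambda>i j. ret (f i j)" 0] by simp

lemma cost_rearrange_le:
  assumes "dim_row A \<le> d" "dim_col A \<le> d"
  shows "cost (copy_timed A) \<le> d\<^sup>2" "cost (transpose_timed A) \<le> d\<^sup>2"
    "cost (antitranspose_timed A) \<le> d\<^sup>2"
  using assms
  by (simp_all add: cost_make_mat_ret_le copy_timed_def transpose_timed_def antitranspose_timed_def)

lemma cost_one_le: "n \<le> d \<Longrightarrow> cost (one_timed n) \<le> d\<^sup>2"
  by (simp add: cost_make_mat_ret_le one_timed_def)

lemma cost_mult_le:
  assumes "dim_row A \<le> d" "dim_col A \<le> d" "dim_col B \<le> d"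
  shows "cost (mult_timed A B) \<le> 3 * d ^ 3"
proof -
  have "cost (mult_timed A B) \<le> (2 * d + 1) * d\<^sup>2"
    unfolding mult_timed_def
  proof (rule cost_make_mat_le)
    fix i j
    have "cost (sum_timed (\<lambda>k. fmul (A $$ (i, k)) (B $$ (k, j))) (dim_col A)) \<le> dim_col A * (1 + 1)"
      by (intro cost_sum_timed_le) simp
    then show "cost (sum_timed (\<lambda>k. fmul (A $$ (i, k)) (B $$ (k, j))) (dim_col A)) \<le> 2 * d"
      using assms(2) by simp
  qed (use assms in simp_all)
  also have "\<dots> = 2 * d ^ 3 + d\<^sup>2" by (simp add: power2_eq_square power3_eq_cube algebra_simps)
  finally show ?thesis using power2_le_power3[of d] by simp
qed

text \<open>
Forward substitution rewrites the whole matrix for each new row, but computes only in that row; a uniform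
bound on the cost of an entry would give a total of order \<open>n\<^sup>4\<close>.
\<close>

lemma cost_make_mat_row_le:
  assumes "k < n" "\<And>j. cost (f k j) \<le> c" "\<And>i j. i \<noteq> k \<Longrightarrow> cost (f i j) = 0"
  shows "cost (make_mat n n f) \<le> n * c + n\<^sup>2"
proof -
  have "cost (make_mat n n f) \<le> (\<Sum>i<n. (if i = k then n * c else 0) + n)"
    unfolding make_mat_def timed.sel
  proof (rule sum_mono)
    fix i
    have "(\<Sum>j<n. cost (f i j) + 1) \<le> (\<Sum>j<n. (if i = k then c else 0) + 1)"
      using assms(2,3) by (intro sum_mono) simp
    also have "\<dots> = (if i = k then n * c else 0) + n" by simp
    finally show "(\<Sum>j<n. cost (f i j) + 1) \<le> (if i = k then n * c else 0) + n" .
  qed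
  also have "\<dots> = n * c + n\<^sup>2" using assms(1) by (simp add: sum.distrib power2_eq_square)
  finally show ?thesis .
qed

lemma cost_lower_inverse_le:
  fixes L :: "'a::field mat"
  assumes "dim_row L \<le> d"
  shows "cost (lower_inverse_timed L) \<le> 4 * d ^ 3"
proof -
  let ?n = "dim_row L"
  define step where "step = (\<lambda>k (X :: 'a mat). make_mat ?n ?n (\<lambda>i j.
         if i = k then do {
           s \<leftarrow> sum_timed (\<lambda>l. fmul (L $$ (k, l)) (X $$ (l, j))) k;
           t \<leftarrow> fsub (delta k j) s;
           fdiv t (L $$ (k, k))
         } else ret (X $$ (i, j))))"
  have "cost (step k X) \<le> 3 * d\<^sup>2" if k: "k < ?n" for k X
  proof -
    have "cost (step k X) \<le> ?n * (2 * ?n) + ?n\<^sup>2"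
      unfolding step_def
    proof (rule cost_make_mat_row_le[OF k])
      fix j
      have "cost (sum_timed (\<lambda>l. fmul (L $$ (k, l)) (X $$ (l, j))) k) \<le> k * (1 + 1)"
        by (intro cost_sum_timed_le) simp
      then show "cost (if k = k then do {
           s \<leftarrow> sum_timed (\<lambda>l. fmul (L $$ (k, l)) (X $$ (l, j))) k;
           t \<leftarrow> fsub (delta k j) s;
           fdiv t (L $$ (k, k))
         } else ret (X $$ (k, j))) \<le> 2 * ?n"
        using k by simp
    qed simp
    also have "\<dots> = 3 * ?n\<^sup>2" by (simp add: power2_eq_square)
    also have "\<dots> \<le> 3 * d\<^sup>2" using assms by simp
    finally show ?thesis .
  qed
  then have "cost (fold_timed step [0..<?n] (result (one_timed ?n))) \<le> ?n * (3 * d\<^sup>2)"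
    by (intro cost_fold_timed_upt_le[where P = "\<lambda>_. True"]) simp_all
  also have "\<dots> \<le> d * (3 * d\<^sup>2)" using assms by (intro mult_le_mono) simp_all
  also have "\<dots> = 3 * d ^ 3" by (simp add: power2_eq_square power3_eq_cube)
  finally have fold: "cost (fold_timed step [0..<?n] (result (one_timed ?n))) \<le> 3 * d ^ 3" .
  have "cost (lower_inverse_timed L) =
      cost (one_timed ?n :: 'a mat timed) + cost (fold_timed step [0..<?n] (result (one_timed ?n)))"
    by (simp only: lower_inverse_timed_def Let_def cost_bind step_def)
  also have "\<dots> \<le> d\<^sup>2 + 3 * d ^ 3" using cost_one_le[OF assms] fold by (rule add_le_mono)
  also have "\<dots> \<le> 4 * d ^ 3" using power2_le_power3[of d] by simp
  finally show ?thesis .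
qed

lemma cost_upper_inverse_le:
  assumes U: "is_U n U" and n: "n \<le> d"
  shows "cost (upper_inverse_timed U) \<le> 6 * d ^ 3"
proof -
  have cU: "dim_row U = n" "dim_col U = n" using U by (auto simp: is_U_def)
  have "is_L n (result (lower_inverse_timed (U\<^sup>T)))"
    using U by (intro lower_inverse_timed_correct) (simp add: is_L_transpose)
  then have "dim_row (result (lower_inverse_timed (U\<^sup>T))) \<le> d"
    "dim_col (result (lower_inverse_timed (U\<^sup>T))) \<le> d"
    using n by (auto simp: is_L_def)
  note c = cost_rearrange_le(2)[OF this]
  have "cost (transpose_timed U) \<le> d\<^sup>2" using cU n by (intro cost_rearrange_le(2)) auto
  moreover have "cost (lower_inverse_timed (U\<^sup>T)) \<le> 4 * d ^ 3"
    using cU n by (intro cost_lower_inverse_le) simp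
  ultimately show ?thesis
    using c power2_le_power3[of d] by (simp add: upper_inverse_timed_def)
qed

text \<open>
A step builds six matrices.  Their entries cost one operation each, except that those of \<open>L\<close> may involve a
division and those of \<open>W\<close> a multiplication and a subtraction; this makes nine operations, and
the search for the pivot accounts for the tenth.
\<close>

lemma cost_leup_step_le:
  assumes W: "W \<in> carrier_mat m n" "m \<le> d" "n \<le> d"
  shows "cost (leup_step i (L, W, U, P, r)) \<le> 10 * d\<^sup>2"
    and "fst (snd (result (leup_step i (L, W, U, P, r)))) \<in> carrier_mat m n"
proof -
  have dW: "dim_row W = m" "dim_col W = n" using W by auto
  have find: "cost (find_nonzero (\<lambda>j. W $$ (i, j)) [r..<n]) \<le> d\<^sup>2"
    using cost_find_nonzero_le[of "\<lambda>j. W $$ (i, j)" "[r..<n]"] W(3) le_power2[of d] by simp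
  have mm: "cost (make_mat m n f) \<le> (c + 1) * d\<^sup>2" "cost (make_mat n n f) \<le> (c + 1) * d\<^sup>2"
    "cost (make_mat m m f) \<le> (c + 1) * d\<^sup>2" if "\<And>i j. cost (f i j) \<le> c" for f :: "nat \<Rightarrow> nat \<Rightarrow> 'a timed" and c
    using cost_make_mat_le[of m d n f c] cost_make_mat_le[of n d n f c]
      cost_make_mat_le[of m d m f c] that W by simp_all
  show "cost (leup_step i (L, W, U, P, r)) \<le> 10 * d\<^sup>2"
  proof (cases "List.find (\<lambda>j. W $$ (i, j) \<noteq> 0) [r..<n]")
    case None
    then show ?thesis using find by (simp add: leup_step_def dW)
  next
    case (Some c)
    define s where "s = Transposition.transpose r c"
    define w1 where "w1 = make_mat m n (\<lambda>a b. ret (W $$ (a, s b)))"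
    define u1 where "u1 = make_mat n n (\<lambda>a b. ret (U $$ (s a, s b)))"
    define p1 where "p1 = make_mat n n (\<lambda>a b. ret (P $$ (s a, b)))"
    define l2 where "l2 = make_mat m m (\<lambda>a b. if b = i \<and> i < a
      then fdiv (result w1 $$ (a, r)) (result w1 $$ (i, r)) else ret (L $$ (a, b)))"
    define u2 where "u2 = make_mat n n (\<lambda>a b.
      if a = r \<and> r \<le> b then ret (result w1 $$ (i, b)) else ret (result u1 $$ (a, b)))"
    define w2 where "w2 = make_mat m n (\<lambda>a b.
      if a < i then ret (result w1 $$ (a, b))
      else if a = i then ret (delta r b)
      else do { t \<leftarrow> fmul (result l2 $$ (a, i)) (result w1 $$ (i, b)); fsub (result w1 $$ (a, b)) t })"
    have "cost (leup_step i (L, W, U, P, r)) = cost (find_nonzero (\<lambda>j. W $$ (i, j)) [r..<n]) +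
        (cost w1 + (cost u1 + (cost p1 + (cost l2 + (cost u2 + cost w2)))))"
      using Some unfolding w2_def u2_def l2_def p1_def u1_def w1_def s_def
      by (simp only: leup_step_def Let_def dW cost_bind result_find_nonzero prod.case option.case
          cost_ret add_0_right)
    moreover have "cost w1 \<le> (0 + 1) * d\<^sup>2" unfolding w1_def by (rule mm) simp
    moreover have "cost u1 \<le> (0 + 1) * d\<^sup>2" unfolding u1_def by (rule mm) simp
    moreover have "cost p1 \<le> (0 + 1) * d\<^sup>2" unfolding p1_def by (rule mm) simp
    moreover have "cost l2 \<le> (1 + 1) * d\<^sup>2" unfolding l2_def by (rule mm) simp
    moreover have "cost u2 \<le> (0 + 1) * d\<^sup>2" unfolding u2_def by (rule mm) simp
    moreover have "cost w2 \<le> (2 + 1) * d\<^sup>2" unfolding w2_def by (rule mm) simp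
    ultimately show ?thesis using find by simp
  qed
  show "fst (snd (result (leup_step i (L, W, U, P, r)))) \<in> carrier_mat m n"
    using W by (auto simp: leup_step_def Let_def dW split: option.splits)
qed

lemma cost_leup_le:
  fixes A :: "'a::field mat"
  assumes A: "dim_row A \<le> d" "dim_col A \<le> d"
  shows "cost (leup_timed A) \<le> 14 * d ^ 3"
proof -
  let ?m = "dim_row A" and ?n = "dim_col A"
  let ?st0 = "(1\<^sub>m ?m, A, 1\<^sub>m ?n, 1\<^sub>m ?n, 0) :: 'a leup_state"
  have "cost (fold_timed leup_step [0..<?m] ?st0) \<le> ?m * (10 * d\<^sup>2)"
  proof (rule cost_fold_timed_upt_le[where P = "\<lambda>st. fst (snd st) \<in> carrier_mat ?m ?n"])
    fix k and st :: "'a leup_state"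
    assume st: "fst (snd st) \<in> carrier_mat ?m ?n"
    obtain L W U P r where "st = (L, W, U, P, r)" by (cases st) auto
    then show "fst (snd (result (leup_step k st))) \<in> carrier_mat ?m ?n \<and>
        cost (leup_step k st) \<le> 10 * d\<^sup>2"
      using cost_leup_step_le[of W ?m ?n d k L U P r] st A by simp
  qed simp
  also have "\<dots> \<le> d * (10 * d\<^sup>2)" using A by (intro mult_le_mono) simp_all
  also have "\<dots> = 10 * d ^ 3" by (simp add: power2_eq_square power3_eq_cube)
  finally have fold: "cost (fold_timed leup_step [0..<?m] ?st0) \<le> 10 * d ^ 3" .
  have "cost (leup_timed A) = cost (one_timed ?m :: 'a mat timed) + (cost (copy_timed A) +
      (cost (one_timed ?n :: 'a mat timed) + (cost (one_timed ?n :: 'a mat timed) +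
        cost (fold_timed leup_step [0..<?m] ?st0))))"
    by (simp add: leup_timed_def split_beta)
  then show ?thesis
    using fold cost_one_le[OF A(1), where ?'a = 'a] cost_one_le[OF A(2), where ?'a = 'a]
      cost_rearrange_le(1)[OF A] power2_le_power3[of d] by linarith
qed

lemma cost_puel_le:
  fixes A :: "'a::field mat"
  assumes A: "dim_row A \<le> d" "dim_col A \<le> d"
  shows "cost (puel_timed A) \<le> 19 * d ^ 3"
proof -
  obtain L0 E0 U0 P0 where r: "result (leup_timed (antitranspose A)) = (L0, E0, U0, P0)"
    by (cases "result (leup_timed (antitranspose A))") auto
  let ?m = "dim_row A" and ?n = "dim_col A"
  from leup_timed_correct[OF r] have c: "L0 \<in> carrier_mat ?n ?n" "E0 \<in> carrier_mat ?n ?m"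
    "U0 \<in> carrier_mat ?m ?m" "P0 \<in> carrier_mat ?m ?m"
    by (simp_all add: is_LEUP_def is_L_def is_U_def is_P_def)
  have "cost (antitranspose_timed L0) \<le> d\<^sup>2" "cost (antitranspose_timed E0) \<le> d\<^sup>2"
    "cost (antitranspose_timed U0) \<le> d\<^sup>2" "cost (antitranspose_timed P0) \<le> d\<^sup>2"
    by (rule cost_rearrange_le(3); use c A in simp)+
  moreover have "cost (antitranspose_timed A) \<le> d\<^sup>2" using A by (rule cost_rearrange_le(3))
  moreover have "cost (leup_timed (antitranspose A)) \<le> 14 * d ^ 3"
    using A by (intro cost_leup_le) simp_all
  ultimately show ?thesis
    using power2_le_power3[of d] by (simp add: puel_timed_def r)
qed

lemma cost_pass_to_edge_le:
  assumes R: "zigzag_rep R" and e: "e < nedges R" and d: "\<And>w. w \<le> nedges R \<Longrightarrow> vdim R w \<le> d"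
    and g: "g \<in> carrier_mat k k" "h \<in> carrier_mat k k" "k \<le> d"
  shows "cost (pass_to_edge e v g h R) \<le> 3 * d ^ 3"
proof -
  have "dim_row (edge_mat R e) \<le> d" "dim_col (edge_mat R e) \<le> d"
    using zigzag_repD[OF R e] d[OF tgt_le[OF e]] d[OF src_le[OF e]] by auto
  then show ?thesis
    using g by (auto simp: pass_to_edge_def intro!: cost_mult_le)
qed

lemma cost_first_pass_step_le:
  fixes R :: "'a::field zigzag"
  assumes R: "zigzag_rep R" and i: "i < nedges R" and d: "\<And>w. w \<le> nedges R \<Longrightarrow> vdim R w \<le> d"
  shows "cost (first_pass_step i (R, Es)) \<le> 38 * d ^ 3"
proof -
  have dv: "vdim R i \<le> d" "vdim R (Suc i) \<le> d" using d i by simp_all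
  have pass: "cost (if Suc i < nedges R then pass_to_edge (Suc i) (Suc i) g h (set_edge i A R)
      else ret (set_edge i A R)) \<le> 3 * d ^ 3"
    if "g \<in> carrier_mat (vdim R (Suc i)) (vdim R (Suc i))"
      "h \<in> carrier_mat (vdim R (Suc i)) (vdim R (Suc i))" for g h A
  proof (cases "Suc i < nedges R")
    case True
    have "cost (pass_to_edge (Suc i) (Suc i) g h (set_edge i A R)) =
        cost (pass_to_edge (Suc i) (Suc i) g h R)"
      by (simp add: pass_to_edge_def)
    then show ?thesis using cost_pass_to_edge_le[OF R True d that dv(2)] True by simp
  qed simp
  show ?thesis
  proof (cases "dir R i")
    case Leftward
    then have st: "src R i = Suc i" "tgt R i = i" by (simp_all add: src_def tgt_def)
    note M = zigzag_repD[OF R i, unfolded st]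
    let ?m = "vdim R i" and ?n = "vdim R (Suc i)"
    obtain L E U P where r: "result (leup_timed (edge_mat R i)) = (L, E, U, P)"
      by (cases "result (leup_timed (edge_mat R i))") auto
    from leup_timed_correct[OF r] M have c: "L \<in> carrier_mat ?m ?m" "E \<in> carrier_mat ?m ?n"
      "U \<in> carrier_mat ?n ?n" "P \<in> carrier_mat ?n ?n" "is_U ?n U"
      by (auto simp: is_LEUP_def is_L_def is_U_def is_P_def)
    let ?U' = "result (upper_inverse_timed U)"
    have U': "?U' \<in> carrier_mat ?n ?n"
      using inverse_matsD[OF upper_inverse_timed_correct[OF c(5)] disjI1[OF c(3)]] by simp
    have "cost (leup_timed (edge_mat R i)) \<le> 14 * d ^ 3"
      using M dv by (intro cost_leup_le) auto
    moreover have "cost (mult_timed L E) \<le> 3 * d ^ 3" "cost (mult_timed U P) \<le> 3 * d ^ 3"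
      "cost (mult_timed (P\<^sup>T) ?U') \<le> 3 * d ^ 3"
      using c dv U' by (auto intro!: cost_mult_le)
    moreover have "cost (upper_inverse_timed U) \<le> 6 * d ^ 3"
      using c(5) dv(2) by (rule cost_upper_inverse_le)
    moreover have "cost (transpose_timed P) \<le> d\<^sup>2"
      using c dv by (intro cost_rearrange_le(2)) auto
    moreover have "U * P \<in> carrier_mat ?n ?n" "P\<^sup>T * ?U' \<in> carrier_mat ?n ?n"
      using c U' by auto
    note pass[OF this, of "L * E"]
    moreover have "dim_col L = dim_row E" "dim_col U = dim_row P" "dim_row P = dim_row ?U'"
      using c U' by auto
    ultimately show ?thesis
      using power2_le_power3[of d] by (simp add: first_pass_step_def Leftward r Let_def)
  next
    case Rightward
    then have st: "src R i = i" "tgt R i = Suc i" by (simp_all add: src_def tgt_def)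
    note M = zigzag_repD[OF R i, unfolded st]
    let ?m = "vdim R (Suc i)" and ?n = "vdim R i"
    obtain P U E L where r: "result (puel_timed (edge_mat R i)) = (P, U, E, L)"
      by (cases "result (puel_timed (edge_mat R i))") auto
    from puel_timed_correct[OF r] M have c: "L \<in> carrier_mat ?n ?n" "E \<in> carrier_mat ?m ?n"
      "U \<in> carrier_mat ?m ?m" "P \<in> carrier_mat ?m ?m" "is_U ?m U"
      by (auto simp: is_PUEL_def is_L_def is_U_def is_P_def)
    let ?U' = "result (upper_inverse_timed U)"
    have U': "?U' \<in> carrier_mat ?m ?m"
      using inverse_matsD[OF upper_inverse_timed_correct[OF c(5)] disjI1[OF c(3)]] by simp
    have "cost (puel_timed (edge_mat R i)) \<le> 19 * d ^ 3"
      using M dv by (intro cost_puel_le) auto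
    moreover have "cost (mult_timed E L) \<le> 3 * d ^ 3" "cost (mult_timed P U) \<le> 3 * d ^ 3"
      "cost (mult_timed ?U' (P\<^sup>T)) \<le> 3 * d ^ 3"
      using c dv U' by (auto intro!: cost_mult_le)
    moreover have "cost (upper_inverse_timed U) \<le> 6 * d ^ 3"
      using c(5) dv(2) by (rule cost_upper_inverse_le)
    moreover have "cost (transpose_timed P) \<le> d\<^sup>2"
      using c dv by (intro cost_rearrange_le(2)) auto
    moreover have "?U' * P\<^sup>T \<in> carrier_mat ?m ?m" "P * U \<in> carrier_mat ?m ?m"
      using c U' by auto
    note pass[OF this, of "E * L"]
    moreover have "dim_col E = dim_row L" "dim_col P = dim_row U" "dim_col ?U' = dim_col P"
      using c U' by auto
    ultimately show ?thesis
      using power2_le_power3[of d] by (simp add: first_pass_step_def Rightward r Let_def)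
  qed
qed

lemma cost_factor_le:
  fixes E :: "'a::field mat"
  assumes "dim_row E \<le> d" "dim_col E \<le> d"
  shows "cost (left_factor_timed E M) \<le> 2 * d ^ 3" "cost (right_factor_timed E M) \<le> 2 * d ^ 3"
proof -
  have cube: "(d + 1) * d\<^sup>2 \<le> 2 * d ^ 3"
    using power2_le_power3[of d] by (simp add: power2_eq_square power3_eq_cube)
  have find: "cost (find_nonzero f [0..<n]) \<le> d" if "n \<le> d" for f :: "nat \<Rightarrow> 'a" and n
    using cost_find_nonzero_le[of f "[0..<n]"] that by simp
  have "cost (left_factor_timed E M) \<le> (d + 1) * d\<^sup>2"
    unfolding left_factor_timed_def
    using assms find by (intro cost_make_mat_le) (auto split: option.split)
  moreover have "cost (right_factor_timed E M) \<le> (d + 1) * d\<^sup>2"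
    unfolding right_factor_timed_def
    using assms find by (intro cost_make_mat_le) (auto split: option.split)
  ultimately show "cost (left_factor_timed E M) \<le> 2 * d ^ 3" "cost (right_factor_timed E M) \<le> 2 * d ^ 3"
    using cube by linarith+
qed

lemma cost_second_pass_step_le:
  fixes R :: "'a::field zigzag"
  assumes R: "zigzag_rep R" and i: "i < nedges R" and d: "\<And>w. w \<le> nedges R \<Longrightarrow> vdim R w \<le> d"
    and red: "two_sided_reduced R i (Es i)"
  shows "cost (second_pass_step Es i R) \<le> 10 * d ^ 3"
proof -
  let ?E = "Es i" and ?s = "vdim R (src R i)" and ?t = "vdim R (tgt R i)"
  from red obtain L1 L2 where E: "?E \<in> carrier_mat ?t ?s" and L1: "is_L ?t L1" and L2: "is_L ?s L2"
    and M: "edge_mat R i = L1 * ?E * L2"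
    and s: "case dir R i of Leftward \<Rightarrow> EL_shape ?E | Rightward \<Rightarrow> EL_hat_shape ?E"
    by (auto simp: two_sided_reduced_def edge_shape_def)
  have dE: "dim_row ?E \<le> d" "dim_col ?E \<le> d" using E d i by auto
  have di: "vdim R i \<le> d" using d i by simp
  have pass: "cost (if 0 < i then pass_to_edge (i - 1) i g h (set_edge i A R)
      else ret (set_edge i A R)) \<le> 3 * d ^ 3"
    if "is_L (vdim R i) g" "is_L (vdim R i) h" for g h A
  proof (cases "0 < i")
    case True
    then have i1: "i - 1 < nedges R" using i by simp
    have "cost (pass_to_edge (i - 1) i g h (set_edge i A R)) = cost (pass_to_edge (i - 1) i g h R)"
      using True by (cases i) (simp_all add: pass_to_edge_def)
    then show ?thesis
      using cost_pass_to_edge_le[OF R i1 d _ _ di, of g h i] that True by (simp add: is_L_def)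
  qed simp
  have copy: "cost (copy_timed ?E) \<le> d ^ 3"
    using cost_rearrange_le(1)[OF dE] power2_le_power3[of d] by linarith
  show ?thesis
  proof (cases "dir R i")
    case Leftward
    then have st: "src R i = Suc i" "tgt R i = i" by (simp_all add: src_def tgt_def)
    have EL: "EL_shape ?E" using s Leftward by simp
    define K where "K = result (left_factor_timed ?E (edge_mat R i))"
    have K: "is_L (vdim R i) K"
      using left_factor_timed_correct(1)[OF E EL L1 L2 M] by (simp add: K_def st)
    have "cost (lower_inverse_timed K) \<le> 4 * d ^ 3"
      using K di by (intro cost_lower_inverse_le) (auto simp: is_L_def)
    moreover have "cost (second_pass_step Es i R) =
        cost (left_factor_timed ?E (edge_mat R i)) + cost (lower_inverse_timed K) +
        (cost (copy_timed ?E) + cost (if 0 < i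
          then pass_to_edge (i - 1) i (result (lower_inverse_timed K)) (K) (set_edge i ?E R)
          else ret (set_edge i ?E R)))"
      by (simp only: second_pass_step_def Leftward direction.case cost_bind result_bind result_ret
          prod.case Let_def K_def cost_ret result_copy_timed add_0_right)
    ultimately show ?thesis
      using cost_factor_le(1)[OF dE, of "edge_mat R i"] copy
        pass[OF lower_inverse_timed_correct(1)[OF K] K, of ?E]
      unfolding K_def by linarith
  next
    case Rightward
    then have st: "src R i = i" "tgt R i = Suc i" by (simp_all add: src_def tgt_def)
    have EL: "EL_hat_shape ?E" using s Rightward by simp
    define K where "K = result (right_factor_timed ?E (edge_mat R i))"
    have K: "is_L (vdim R i) K"
      using right_factor_timed_correct(1)[OF E EL L1 L2 M] by (simp add: K_def st)
    have "cost (lower_inverse_timed K) \<le> 4 * d ^ 3"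
      using K di by (intro cost_lower_inverse_le) (auto simp: is_L_def)
    moreover have "cost (second_pass_step Es i R) =
        cost (right_factor_timed ?E (edge_mat R i)) + cost (lower_inverse_timed K) +
        (cost (copy_timed ?E) + cost (if 0 < i
          then pass_to_edge (i - 1) i (K) (result (lower_inverse_timed K)) (set_edge i ?E R)
          else ret (set_edge i ?E R)))"
      by (simp only: second_pass_step_def Rightward direction.case cost_bind result_bind result_ret
          prod.case Let_def K_def cost_ret result_copy_timed add_0_right)
    ultimately show ?thesis
      using cost_factor_le(2)[OF dE, of "edge_mat R i"] copy
        pass[OF K lower_inverse_timed_correct(1)[OF K], of ?E]
      unfolding K_def by linarith
  qed
qed

lemma vdim_le_max_dim: "w \<le> nedges R \<Longrightarrow> vdim R w \<le> max_dim R"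
  unfolding max_dim_def by (intro Max_ge) auto

text \<open>
The bounds for single steps need the invariants of the two passes, which provide the sizes of the matrices
and, in the second pass, their shapes.
\<close>

lemma cost_rightward_initial_le:
  fixes R :: "'a::field zigzag"
  assumes R: "zigzag_rep R"
  shows "cost (rightward_initial R) \<le> 48 * nedges R * max_dim R ^ 3"
proof -
  let ?n = "nedges R" and ?d = "max_dim R"
  obtain R1 Es where R1: "first_pass_state R ?n = (R1, Es)" by fastforce
  have first: "cost (fold_timed first_pass_step [0..<k] (R, \<lambda>_. 0\<^sub>m 0 0)) \<le> k * (38 * ?d ^ 3)"
    if "k \<le> ?n" for k
    using that
  proof (induction k)
    case (Suc k)
    obtain S Fs where S: "first_pass_state R k = (S, Fs)" by fastforce
    have inv: "zigzag_rep S" "same_quiver R S"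
      using first_pass_state_correct[OF R, of k] Suc.prems S by simp_all
    have "cost (first_pass_step k (S, Fs)) \<le> 38 * ?d ^ 3"
      using Suc.prems vdim_le_max_dim same_quiver_simps[OF inv(2)]
      by (intro cost_first_pass_step_le[OF inv(1)]) simp_all
    then show ?case using Suc S by (simp add: first_pass_state_def)
  qed simp
  have "cost (fold_timed (second_pass_step Es) (rev [k..<?n]) R1) \<le> (?n - k) * (10 * ?d ^ 3)"
    if "k \<le> ?n" for k
    using that
  proof (induction k rule: inc_induct)
    case (step k)
    let ?S = "second_pass_state R (Suc k)"
    have S: "?S = result (fold_timed (second_pass_step Es) (rev [Suc k..<?n]) R1)"
      by (simp add: second_pass_state_def R1)
    have inv: "zigzag_rep ?S" "same_quiver R ?S" "two_sided_reduced ?S k (Es k)"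
      using second_pass_state_correct[OF R, of "Suc k"] step(2) by (simp_all add: R1)
    have "cost (second_pass_step Es k ?S) \<le> 10 * ?d ^ 3"
      using step(2) vdim_le_max_dim same_quiver_simps[OF inv(2)] inv(3)
      by (intro cost_second_pass_step_le[OF inv(1)]) simp_all
    moreover have "?n - k = Suc (?n - Suc k)" using step(2) by simp
    moreover have "rev [k..<?n] = rev [Suc k..<?n] @ [k]" using step(2) by (simp add: upt_conv_Cons)
    ultimately show ?case using step.IH S by simp
  qed simp
  from this[of 0] have second:
    "cost (fold_timed (second_pass_step Es) (rev [0..<?n]) R1) \<le> ?n * (10 * ?d ^ 3)" by simp
  have "cost (rightward_initial R) = cost (fold_timed first_pass_step [0..<?n] (R, \<lambda>_. 0\<^sub>m 0 0)) +
      cost (fold_timed (second_pass_step Es) (rev [0..<?n]) R1)"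
    using R1 by (simp add: rightward_initial_def first_pass_state_def)
  also have "\<dots> \<le> ?n * (38 * ?d ^ 3) + ?n * (10 * ?d ^ 3)"
    using first[OF order_refl] second by (rule add_le_mono)
  also have "\<dots> = 48 * ?n * ?d ^ 3" by simp
  finally show ?thesis .
qed

section \<open>Correctness and running time\<close>

theorem proposition11:
  shows "\<exists>C::nat. \<forall>R :: 'a::field zigzag. zigzag_rep R \<longrightarrow>
    (\<forall>B. rightward_initial_run R B \<longrightarrow> computes_barcode_form R B) \<and>
    rightward_initial_run R (result (rightward_initial R)) \<and>
    computes_barcode_form R (result (rightward_initial R)) \<and>
    cost (rightward_initial R) \<le> C * nedges R * max_dim R ^ 3"
proof (intro exI[of _ 48] allI impI)
  fix R :: "'a zigzag"
  assume R: "zigzag_rep R"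
  have runs: "computes_barcode_form R B" if run: "rightward_initial_run R B" for B
  proof -
    note B = rightward_initial_run_correct[OF R run]
    have "barcode_form B"
      using isomorphic_zigzag_rep[OF B(1)] edge_shape_pivot[OF B(2)] by (rule pivot_barcode_form)
    then show ?thesis using B(1) by (simp add: computes_barcode_form_def)
  qed
  show "(\<forall>B. rightward_initial_run R B \<longrightarrow> computes_barcode_form R B) \<and>
    rightward_initial_run R (result (rightward_initial R)) \<and>
    computes_barcode_form R (result (rightward_initial R)) \<and>
    cost (rightward_initial R) \<le> 48 * nedges R * max_dim R ^ 3"
    using runs rightward_initial_is_run[OF R] cost_rightward_initial_le[OF R] by blast
qed

end
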